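(* Let $p\in[1,\infty)$ and let $(\rho_t)_{t\in I}$ be as in the context. The following two conditions are equivalent. (A) There exists an infinitesimal sequence $(t_k)_{k\in\mathbb N}\subset I$ such that $$\sup_{R>0}\ \limsup_{k\to\infty}\ R^p\int_{\mathbb R^N}\frac{\rho_{t_k}(z)}{R^p+|z|^p}\,dz<\infty,$$ and the measures $\nu_k=\rho_{t_k}\mathcal L^N$ satisfy $\nu_k\overset{\star}{\rightharpoonup}\alpha\delta_0$ in $\mathcal M_{\rm loc}(\mathbb R^N)$ as $k\to\infty$ for some $\alpha\ge0$. (B) There exist an infinitesimal sequence $(t_k)_{k\in\mathbb N}\subset I$ and a measure $\mu\in\mathcal M^+(\mathbb S^{N-1})$ such that: (i) for every $u\in X^p(\mathbb R^N)$, $\limsup_{k\to\infty}\mathcal F_{t_k,p}(u)\le\mathcal D^\mu_p(u)$; (ii) whenever $(u_k)_{k\in\mathbb N}\subset L^p(\mathbb R^N)$ and $u_k\to u$ in $L^p(\mathbb R^N)$ for some $u\in X^p(\mathbb R^N)$, then $\liminf_{k\to\infty}\mathcal F_{t_k,p}(u_k)\ge\mathcal D^\mu_p(u)$. (The sequences $(t_k)$ in (A) and (B) need not coincide.)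
   Context: Let $N\ge1$ and $I=(0,1)$. $(\rho_t)_{t\in I}\subset L^1_{\rm loc}(\mathbb R^N)$ is a family of non-negative functions. For $p\in[1,\infty)$, $t\in I$ and $u\in L^p(\mathbb R^N)$, set $\mathcal F_{t,p}(u)=\int_{\mathbb R^N}\int_{\mathbb R^N}\frac{|u(x)-u(y)|^p}{|x-y|^p}\rho_t(x-y)\,dx\,dy\in[0,\infty]$. $X^p(\mathbb R^N)$ denotes $W^{1,p}(\mathbb R^N)$ if $p>1$ and $BV(\mathbb R^N)$ if $p=1$; $Du$ is the distributional gradient (a finite $\mathbb R^N$-valued Radon measure if $p=1$). For $\sigma\in\mathbb S^{N-1}$, $\|\sigma\cdot Du\|_{L^p}^p=\int_{\mathbb R^N}|\sigma\cdot\nabla u|^p\,dx$ if $p>1$ and $=|\sigma\cdot Du|(\mathbb R^N)$ (total variation) if $p=1$. For $\mu\in\mathcal M^+(\mathbb S^{N-1})$ (non-negative finite Radon measures on the unit sphere), $\mathcal D^\mu_p(u)=\int_{\mathbb S^{N-1}}\|\sigma\cdot Du\|_{L^p}^p\,d\mu(\sigma)$. A sequence is infinitesimal if it tends to $0$. $\mathcal L^N$ is Lebesgue measure; $\nu_k\overset{\star}{\rightharpoonup}\nu$ in $\mathcal M_{\rm loc}(\mathbb R^N)$ means $\int f\,d\nu_k\to\int f\,d\nu$ for every $f\in C_c(\mathbb R^N)$. *)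

theory Defs
  imports "HOL-Analysis.Analysis"
begin

fun iter_dd :: "'a list \<Rightarrow> ('a::euclidean_space \<Rightarrow> real) \<Rightarrow> 'a \<Rightarrow> real" where
  "iter_dd [] f = f"
| "iter_dd (v # vs) f = (\<lambda>x. frechet_derivative (iter_dd vs f) (at x) v)"

definition smooth_fun :: "('a::euclidean_space \<Rightarrow> real) \<Rightarrow> bool" where
  "smooth_fun f \<longleftrightarrow> (\<forall>vs x. iter_dd vs f differentiable (at x))"

definition test_fun :: "('a::euclidean_space \<Rightarrow> real) \<Rightarrow> bool" where
  "test_fun \<phi> \<longleftrightarrow> smooth_fun \<phi> \<and> compact (closure {x. \<phi> x \<noteq> 0})"

definition Lp_fun :: "real \<Rightarrow> ('a::euclidean_space \<Rightarrow> real) \<Rightarrow> bool" where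
  "Lp_fun p u \<longleftrightarrow> u \<in> borel_measurable lebesgue \<and>
     (\<integral>\<^sup>+ x. ennreal (\<bar>u x\<bar> powr p) \<partial>lebesgue) < \<infinity>"

definition is_weak_grad :: "('a::euclidean_space \<Rightarrow> real) \<Rightarrow> ('a \<Rightarrow> 'a) \<Rightarrow> bool" where
  "is_weak_grad u G \<longleftrightarrow> G \<in> borel_measurable lebesgue \<and>
     (\<forall>\<phi>. test_fun \<phi> \<longrightarrow> (\<forall>v\<in>Basis.
        (\<integral>x. u x * frechet_derivative \<phi> (at x) v \<partial>lebesgue) = - (\<integral>x. (G x \<bullet> v) * \<phi> x \<partial>lebesgue)))"

definition Lp_weak_grad :: "real \<Rightarrow> ('a::euclidean_space \<Rightarrow> real) \<Rightarrow> ('a \<Rightarrow> 'a) \<Rightarrow> bool" where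
  "Lp_weak_grad p u G \<longleftrightarrow> is_weak_grad u G \<and> Lp_fun p (\<lambda>x. norm (G x))"

definition W1p :: "real \<Rightarrow> ('a::euclidean_space \<Rightarrow> real) \<Rightarrow> bool" where
  "W1p p u \<longleftrightarrow> Lp_fun p u \<and> (\<exists>G. Lp_weak_grad p u G)"

definition divergence :: "('a::euclidean_space \<Rightarrow> 'a) \<Rightarrow> 'a \<Rightarrow> real" where
  "divergence \<phi> x = (\<Sum>b\<in>Basis. frechet_derivative (\<lambda>y. \<phi> y \<bullet> b) (at x) b)"

definition total_variation :: "('a::euclidean_space \<Rightarrow> real) \<Rightarrow> ereal" where
  "total_variation u = (SUP \<phi>\<in>{\<phi>. (\<forall>b\<in>Basis. test_fun (\<lambda>x. \<phi> x \<bullet> b)) \<and> (\<forall>x. norm (\<phi> x) \<le> 1)}.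
       ereal (\<integral>x. u x * divergence \<phi> x \<partial>lebesgue))"

definition BV :: "('a::euclidean_space \<Rightarrow> real) \<Rightarrow> bool" where
  "BV u \<longleftrightarrow> Lp_fun 1 u \<and> total_variation u < \<infinity>"

definition Xp :: "real \<Rightarrow> ('a::euclidean_space \<Rightarrow> real) \<Rightarrow> bool" where
  "Xp p u \<longleftrightarrow> (if p > 1 then W1p p u else BV u)"

definition dir_variation :: "('a::euclidean_space \<Rightarrow> real) \<Rightarrow> 'a \<Rightarrow> ennreal" where
  "dir_variation u \<sigma> = (SUP \<phi>\<in>{\<phi>. test_fun \<phi> \<and> (\<forall>x. \<bar>\<phi> x\<bar> \<le> 1)}.
       ennreal (\<integral>x. u x * frechet_derivative \<phi> (at x) \<sigma> \<partial>lebesgue))"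

definition dir_norm :: "real \<Rightarrow> ('a::euclidean_space \<Rightarrow> real) \<Rightarrow> 'a \<Rightarrow> ennreal" where
  "dir_norm p u \<sigma> = (if p > 1
      then (\<integral>\<^sup>+ x. ennreal (\<bar>\<sigma> \<bullet> (SOME G. Lp_weak_grad p u G) x\<bar> powr p) \<partial>lebesgue)
      else dir_variation u \<sigma>)"

definition D_mu :: "'a measure \<Rightarrow> real \<Rightarrow> ('a::euclidean_space \<Rightarrow> real) \<Rightarrow> ennreal" where
  "D_mu \<mu> p u = (\<integral>\<^sup>+ \<sigma>. dir_norm p u \<sigma> \<partial>\<mu>)"

(* finite nonnegative Radon (= finite Borel) measure on the unit sphere S^{N-1} *)
definition sphere_measure :: "'a::euclidean_space measure \<Rightarrow> bool" where
  "sphere_measure \<mu> \<longleftrightarrow> sets \<mu> = sets (restrict_space borel (sphere 0 1)) \<and> finite_measure \<mu>"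

definition F_tp :: "(real \<Rightarrow> 'a \<Rightarrow> real) \<Rightarrow> real \<Rightarrow> real \<Rightarrow> ('a::euclidean_space \<Rightarrow> real) \<Rightarrow> ennreal" where
  "F_tp \<rho> t p u = (\<integral>\<^sup>+ x. \<integral>\<^sup>+ y. ennreal (\<bar>u x - u y\<bar> powr p / norm (x - y) powr p * \<rho> t (x - y))
       \<partial>lebesgue \<partial>lebesgue)"

definition infinitesimal_in_I :: "(nat \<Rightarrow> real) \<Rightarrow> bool" where
  "infinitesimal_in_I t \<longleftrightarrow> (\<forall>k. t k \<in> {0<..<1}) \<and> t \<longlonglongrightarrow> 0"

definition loc_integrable :: "('a::euclidean_space \<Rightarrow> real) \<Rightarrow> bool" where
  "loc_integrable f \<longleftrightarrow> (\<forall>K. compact K \<longrightarrow> set_integrable lebesgue K f)"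

definition weak_star_to_delta :: "(nat \<Rightarrow> 'a::euclidean_space \<Rightarrow> real) \<Rightarrow> real \<Rightarrow> bool" where
  "weak_star_to_delta f \<alpha> \<longleftrightarrow> (\<forall>g::'a \<Rightarrow> real. continuous_on UNIV g \<and> compact (closure {x. g x \<noteq> 0}) \<longrightarrow>
      (\<lambda>k. \<integral>z. g z * f k z \<partial>lebesgue) \<longlonglongrightarrow> \<alpha> * g 0)"

end

theory Submission
  imports Defs "HOL-Probability.Helly_Selection"
begin

text \<open>Write \<open>T\<^sub>u(h)\<close> for the integral of \<open>|u(x + h) - u(x)|\<^sup>p\<close>. By Fubini the nonlocal energy is the
  integral of \<open>\<rho>(z) T\<^sub>u(z) / |z|\<^sup>p\<close>. Convexity gives \<open>T\<^sub>u(m z) \<le> m\<^sup>p T\<^sub>u(z)\<close>, so the quotients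
  \<open>T\<^sub>u(\<delta>\<sigma>) / \<delta>\<^sup>p\<close> increase along \<open>\<delta> = 2\<^sup>-\<^sup>j\<close>; by duality with test functions their supremum is
  \<open>\<parallel>\<sigma> \<cdot> Du\<parallel>\<^sup>p\<close>. Condition (A) says that \<open>\<rho>\<^sub>k\<close> has convergent mass on the unit ball while the
  integrals of \<open>\<rho>\<^sub>k(z) / |z|\<^sup>p\<close> over \<open>|z| \<ge> s\<close> vanish for every \<open>s > 0\<close>.

  From (A) to (B): \<open>\<mu>\<close> is a weak limit of the radial projections of \<open>\<rho>\<^sub>k\<close> to the sphere. The upper bound
  is \<open>T\<^sub>u(z) \<le> |z|\<^sup>p \<parallel>\<sigma> \<cdot> Du\<parallel>\<^sup>p\<close> with \<open>\<sigma> = z / |z|\<close>. For the lower bound a small \<open>z\<close> is multiplied by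
  \<open>m = \<lfloor>\<delta> / |z|\<rfloor>\<close>, which moves it next to \<open>\<delta>\<sigma>\<close> without increasing the quotient, and there
  \<open>T\<close> of \<open>u\<^sub>k\<close> is close to \<open>T\<^sub>u(\<delta>\<sigma>)\<close>.

  From (B) to (A): let \<open>u\<close> be a bump supported in the ball of radius \<open>s/2\<close>. The energies of \<open>u\<close> and of
  \<open>u(2 \<cdot>)\<close>, suitably rescaled, have the same limit, and the difference of their integrands is
  nonnegative and equals a positive constant times \<open>\<rho>\<^sub>k(z) / |z|\<^sup>p\<close> for \<open>|z| \<ge> s\<close>.\<close>

section \<open>Powers and the \<open>p\<close>-energy\<close>

text \<open>The difficulty is sharpness: the upper and the lower bound must meet at the same
  functional. In the lower bound the triangle inequality may therefore cost a main term only a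
  factor 1 + e, while the large constant C falls on errors that vanish. This fixes the order of
  limits: k to infinity, then e to 0, then the step 2^-j to 0. The last one is exchanged with the
  integral over directions by monotone convergence, hence the dyadic steps. The cases p = 1 and p >
  1 differ mainly in the duality argument. Both end in one formula for the directional norm, as a
  supremum of difference quotients of u, and this formula no longer mentions the weak gradient
  picked by choice. In the converse direction the limit functional is p-homogeneous in the gradient,
  so it scales exactly under dilation. At distances where a bump and its translate are disjoint,
  T(z) has stopped growing, and this strict loss detects kernel mass away from the origin. A
  subsequence is taken in both directions: in one to make the projected measures converge, in the
  other to make the masses converge.\<close>

lemma powr_add_le:
  fixes a b p :: real assumes "p \<ge> 0"
  shows "\<bar>a + b\<bar> powr p \<le> 2 powr p * (\<bar>a\<bar> powr p + \<bar>b\<bar> powr p)"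
proof -
  have "\<bar>a + b\<bar> powr p \<le> (2 * max \<bar>a\<bar> \<bar>b\<bar>) powr p"
    by (rule powr_mono2) (use assms in auto)
  also have "\<dots> = 2 powr p * max \<bar>a\<bar> \<bar>b\<bar> powr p" by (simp add: powr_mult)
  also have "max \<bar>a\<bar> \<bar>b\<bar> powr p \<le> \<bar>a\<bar> powr p + \<bar>b\<bar> powr p" by (auto simp: max_def)
  finally show ?thesis by simp
qed

text \<open>Either |b| <= l|a|, and the sum is absorbed by (1 + l)|a|, or |a| <= |b|/l, and it is
  absorbed by a multiple of |b|. The factor of |a|^p can be any number above 1, which keeps the
  lower bound sharp.\<close>

lemma powr_add_eps:
  fixes p e :: real assumes "p \<ge> 1" "e > 0"
  shows "\<exists>C\<ge>0. \<forall>a b::real. \<bar>a + b\<bar> powr p \<le> (1 + e) * \<bar>a\<bar> powr p + C * \<bar>b\<bar> powr p"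
proof -
  \<comment> \<open>Chosen so that \<open>(1 + l) powr p = 1 + e\<close>.\<close>
  define l where "l = (1 + e) powr (1/p) - 1"
  have l: "l > 0" using assms by (simp add: l_def powr_def)
  have l1: "(1 + l) powr p = 1 + e" using assms by (simp add: l_def powr_powr)
  have "\<bar>a + b\<bar> powr p \<le> (1 + e) * \<bar>a\<bar> powr p + (1 + 1/l) powr p * \<bar>b\<bar> powr p" for a b :: real
  proof (cases "\<bar>b\<bar> \<le> l * \<bar>a\<bar>")
    case True
    have "\<bar>a + b\<bar> powr p \<le> ((1 + l) * \<bar>a\<bar>) powr p"
      by (rule powr_mono2) (use assms l True in \<open>auto simp: algebra_simps\<close>)
    also have "\<dots> = (1 + e) * \<bar>a\<bar> powr p" using l1 l by (simp add: powr_mult)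
    also have "\<dots> \<le> \<dots> + (1 + 1/l) powr p * \<bar>b\<bar> powr p" by simp
    finally show ?thesis .
  next
    case False
    then have "\<bar>a\<bar> \<le> \<bar>b\<bar> / l" using l by (simp add: field_simps)
    then have "\<bar>a + b\<bar> powr p \<le> ((1 + 1/l) * \<bar>b\<bar>) powr p"
      by (intro powr_mono2) (use assms l in \<open>auto simp: algebra_simps\<close>)
    also have "\<dots> = (1 + 1/l) powr p * \<bar>b\<bar> powr p" using l by (simp add: powr_mult)
    also have "\<dots> \<le> (1 + e) * \<bar>a\<bar> powr p + \<dots>" using assms by simp
    finally show ?thesis .
  qed
  moreover have "(1 + 1/l) powr p \<ge> 0" by simp
  ultimately show ?thesis by blast
qed

text \<open>Between positive points this is \<open>powr_convex\<close>; if an endpoint is 0 it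
  reduces to (s z)^p <= s z^p, that is to s^p <= s for s in (0,1).\<close>

lemma powr_convex_atLeast:
  assumes "p \<ge> 1" shows "convex_on {0..} (\<lambda>x::real. x powr p)"
proof (rule convex_onI)
  fix t x y :: real assume t: "0 < t" "t < 1" and xy: "x \<in> {0..}" "y \<in> {0..}"
  have sc: "(s * z) powr p \<le> s * z powr p" if "0 < s" "s < 1" "z \<ge> 0" for s z :: real
  proof -
    have "s powr p \<le> s powr 1" using that assms by (intro powr_mono') auto
    then show ?thesis using that by (simp add: powr_mult mult_right_mono)
  qed
  show "((1 - t) *\<^sub>R x + t *\<^sub>R y) powr p \<le> (1 - t) * x powr p + t * y powr p"
  proof (cases "x = 0 \<or> y = 0")
    case True then show ?thesis using sc[of t y] sc[of "1-t" x] t xy assms by auto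
  next
    case False
    then show ?thesis using convex_onD[OF powr_convex[OF assms], of t x y] t xy by auto
  qed
qed auto

text \<open>Jensen with equal weights 1/m. For m equal summands the bound is exactly m^p times one
  of them, which is the constant in \<open>tdiff_multiple_le\<close>.\<close>

lemma powr_sum_le:
  fixes a :: "nat \<Rightarrow> real" assumes "p \<ge> 1" "m > 0"
  shows "\<bar>\<Sum>i<m. a i\<bar> powr p \<le> real m powr (p - 1) * (\<Sum>i<m. \<bar>a i\<bar> powr p)"
proof -
  have "(\<Sum>i<m. (1/m) *\<^sub>R \<bar>a i\<bar>) powr p \<le> (\<Sum>i<m. (1/m) * \<bar>a i\<bar> powr p)"
    by (rule convex_on_sum[OF _ _ powr_convex_atLeast[OF assms(1)]]) (use assms in auto)
  then have j: "((\<Sum>i<m. \<bar>a i\<bar>) / m) powr p \<le> (\<Sum>i<m. \<bar>a i\<bar> powr p) / m"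
    by (simp add: sum_divide_distrib)
  have "\<bar>\<Sum>i<m. a i\<bar> powr p \<le> (\<Sum>i<m. \<bar>a i\<bar>) powr p"
    by (rule powr_mono2) (use assms in auto)
  also have "\<dots> = real m powr p * ((\<Sum>i<m. \<bar>a i\<bar>) / m) powr p"
    using assms by (simp add: powr_divide sum_nonneg)
  also have "\<dots> \<le> real m powr p * ((\<Sum>i<m. \<bar>a i\<bar> powr p) / m)"
    by (rule mult_left_mono[OF j]) simp
  also have "\<dots> = real m powr (p - 1) * (\<Sum>i<m. \<bar>a i\<bar> powr p)"
    using assms by (simp add: powr_diff)
  finally show ?thesis .
qed

section \<open>Lebesgue measure under affine changes of variables\<close>

lemma nn_integral_lborel_affine:
  fixes f :: "'a::euclidean_space \<Rightarrow> ennreal"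
  assumes [measurable]: "f \<in> borel_measurable borel" and c: "c \<noteq> 0"
  shows "(\<integral>\<^sup>+x. f x \<partial>lborel) = ennreal (\<bar>c\<bar> ^ DIM('a)) * (\<integral>\<^sup>+x. f (t + c *\<^sub>R x) \<partial>lborel)"
  by (subst lborel_affine[OF c, of t])
     (simp add: nn_integral_density nn_integral_distr nn_integral_cmult)

lemma nn_integral_lborel_translate:
  fixes f :: "'a::euclidean_space \<Rightarrow> ennreal"
  assumes "f \<in> borel_measurable borel"
  shows "(\<integral>\<^sup>+x. f (x + a) \<partial>lborel) = (\<integral>\<^sup>+x. f x \<partial>lborel)"
  using nn_integral_lborel_affine[OF assms, of 1 a] by (simp add: add.commute)

lemma nn_integral_lborel_reflect:
  fixes f :: "'a::euclidean_space \<Rightarrow> ennreal"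
  assumes "f \<in> borel_measurable borel"
  shows "(\<integral>\<^sup>+x. f (a - x) \<partial>lborel) = (\<integral>\<^sup>+x. f x \<partial>lborel)"
  using nn_integral_lborel_affine[OF assms, of "-1" a] by simp

section \<open>The p-energy of a function and of its increments\<close>

definition Lpow :: "real \<Rightarrow> ('a::euclidean_space \<Rightarrow> real) \<Rightarrow> ennreal" where
  "Lpow p f = (\<integral>\<^sup>+x. ennreal (\<bar>f x\<bar> powr p) \<partial>lborel)"

text \<open>This is \<open>T\<^sub>u(h)\<close> of the overview.\<close>

definition tdiff :: "real \<Rightarrow> ('a::euclidean_space \<Rightarrow> real) \<Rightarrow> 'a \<Rightarrow> ennreal" where
  "tdiff p u h = Lpow p (\<lambda>x. u (x + h) - u x)"

lemma Lpow_translate: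
  fixes f :: "'a::euclidean_space \<Rightarrow> real"
  assumes [measurable]: "f \<in> borel_measurable borel"
  shows "Lpow p (\<lambda>x. f (x + a)) = Lpow p f"
  unfolding Lpow_def by (rule nn_integral_lborel_translate) measurable

lemma Lpow_zero [simp]: "Lpow p (\<lambda>x. 0) = 0"
  by (simp add: Lpow_def)

lemma Lpow_uminus [simp]: "Lpow p (\<lambda>x. - f x) = Lpow p f"
  by (simp add: Lpow_def)

lemma Lpow_cmult:
  fixes f :: "'a::euclidean_space \<Rightarrow> real"
  assumes [measurable]: "f \<in> borel_measurable borel"
  shows "Lpow p (\<lambda>x. c * f x) = ennreal (\<bar>c\<bar> powr p) * Lpow p f"
  unfolding Lpow_def by (simp add: abs_mult powr_mult ennreal_mult nn_integral_cmult)

lemma Lpow_add_le: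
  fixes f g :: "'a::euclidean_space \<Rightarrow> real"
  assumes [measurable]: "f \<in> borel_measurable borel" "g \<in> borel_measurable borel" and p: "p \<ge> 0"
  shows "Lpow p (\<lambda>x. f x + g x) \<le> ennreal (2 powr p) * (Lpow p f + Lpow p g)"
proof -
  have "Lpow p (\<lambda>x. f x + g x)
      \<le> (\<integral>\<^sup>+x. ennreal (2 powr p) * (ennreal (\<bar>f x\<bar> powr p) + ennreal (\<bar>g x\<bar> powr p)) \<partial>lborel)"
    unfolding Lpow_def
    by (intro nn_integral_mono)
       (simp add: powr_add_le[OF p] flip: ennreal_plus ennreal_mult)
  also have "\<dots> = ennreal (2 powr p) * (Lpow p f + Lpow p g)"
    unfolding Lpow_def by (simp add: nn_integral_cmult nn_integral_add)
  finally show ?thesis .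
qed

lemma Lpow_diff_le:
  fixes f g :: "'a::euclidean_space \<Rightarrow> real"
  assumes [measurable]: "f \<in> borel_measurable borel" "g \<in> borel_measurable borel" and p: "p \<ge> 0"
  shows "Lpow p (\<lambda>x. f x - g x) \<le> ennreal (2 powr p) * (Lpow p f + Lpow p g)"
  using Lpow_add_le[of f "\<lambda>x. - g x" p] p by simp

text \<open>C depends on p and e only and is fixed before f and g; the lower bound applies it to a
  whole sequence of functions.\<close>

lemma Lpow_add_eps:
  fixes p e :: real assumes "p \<ge> 1" "e > 0"
  shows "\<exists>C\<ge>0. \<forall>f g. f \<in> borel_measurable (borel :: 'a::euclidean_space measure) \<longrightarrow>
     g \<in> borel_measurable borel \<longrightarrow>
     Lpow p (\<lambda>x. f x + g x) \<le> ennreal (1 + e) * Lpow p f + ennreal C * Lpow p g"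
proof -
  obtain C where C: "C \<ge> 0" "\<And>a b::real. \<bar>a + b\<bar> powr p \<le> (1 + e) * \<bar>a\<bar> powr p + C * \<bar>b\<bar> powr p"
    using powr_add_eps[OF assms] by blast
  have "Lpow p (\<lambda>x. f x + g x) \<le> ennreal (1 + e) * Lpow p f + ennreal C * Lpow p g"
    if [measurable]: "f \<in> borel_measurable (borel :: 'a measure)" "g \<in> borel_measurable borel" for f g
  proof -
    have "Lpow p (\<lambda>x. f x + g x)
      \<le> (\<integral>\<^sup>+x. ennreal (1 + e) * ennreal (\<bar>f x\<bar> powr p) + ennreal C * ennreal (\<bar>g x\<bar> powr p) \<partial>lborel)"
      unfolding Lpow_def
      by (intro nn_integral_mono)
         (use assms C in \<open>simp flip: ennreal_plus ennreal_mult\<close>)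
    also have "\<dots> = ennreal (1 + e) * Lpow p f + ennreal C * Lpow p g"
      unfolding Lpow_def by (simp add: nn_integral_cmult nn_integral_add)
    finally show ?thesis .
  qed
  with C(1) show ?thesis by blast
qed

lemma tdiff_le_Lpow:
  fixes u :: "'a::euclidean_space \<Rightarrow> real"
  assumes [measurable]: "u \<in> borel_measurable borel" and p: "p \<ge> 0"
  shows "tdiff p u h \<le> ennreal (2 powr (p + 1)) * Lpow p u"
proof -
  have "tdiff p u h \<le> ennreal (2 powr p) * (Lpow p (\<lambda>x. u (x + h)) + Lpow p u)"
    unfolding tdiff_def by (rule Lpow_diff_le) (use p in measurable)
  also have "\<dots> = ennreal (2 powr (p + 1)) * Lpow p u"
    by (simp add: Lpow_translate powr_add ennreal_mult mult.assoc flip: mult_2)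
  finally show ?thesis .
qed

text \<open>The increment over m z telescopes into m increments over z, all of the same energy by
  translation invariance; Jensen then costs m^(p-1) times m. So passing from z to m z never
  increases the quotient T(z) / |z|^p.\<close>

lemma tdiff_multiple_le:
  fixes u :: "'a::euclidean_space \<Rightarrow> real"
  assumes [measurable]: "u \<in> borel_measurable borel" and p: "p \<ge> 1" and m: "m > 0"
  shows "tdiff p u (real m *\<^sub>R z) \<le> ennreal (real m powr p) * tdiff p u z"
proof -
  define a where "a i x = u (x + real (Suc i) *\<^sub>R z) - u (x + real i *\<^sub>R z)" for i x
  have [measurable]: "a i \<in> borel_measurable borel" for i unfolding a_def by measurable
  have tele: "u (x + real m *\<^sub>R z) - u x = (\<Sum>i<m. a i x)" for x
    unfolding a_def by (subst sum_lessThan_telescope) simp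
  have each: "Lpow p (a i) = tdiff p u z" for i
  proof -
    have "Lpow p (a i) = Lpow p (\<lambda>x. (\<lambda>y. u (y + z) - u y) (x + real i *\<^sub>R z))"
      by (rule arg_cong[where f = "Lpow p"]) (auto simp: a_def algebra_simps)
    also have "\<dots> = tdiff p u z" unfolding tdiff_def by (rule Lpow_translate) measurable
    finally show ?thesis .
  qed
  have "tdiff p u (real m *\<^sub>R z)
     \<le> (\<integral>\<^sup>+x. ennreal (real m powr (p - 1)) * (\<Sum>i<m. ennreal (\<bar>a i x\<bar> powr p)) \<partial>lborel)"
    unfolding tdiff_def Lpow_def tele
    by (intro nn_integral_mono)
       (simp add: powr_sum_le[OF p m] sum_nonneg flip: ennreal_mult)
  also have "\<dots> = ennreal (real m powr (p - 1)) * (\<Sum>i<m. Lpow p (a i))"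
    unfolding Lpow_def by (simp add: nn_integral_cmult nn_integral_sum del: sum_ennreal)
  also have "\<dots> = ennreal (real m powr (p - 1) * real m) * tdiff p u z"
    by (simp add: each ennreal_mult mult.assoc ennreal_of_nat_eq_real_of_nat)
  also have "real m powr (p - 1) * real m = real m powr p"
    using m by (simp add: powr_diff)
  finally show ?thesis .
qed

lemma tdiff_uminus:
  fixes u :: "'a::euclidean_space \<Rightarrow> real"
  assumes [measurable]: "u \<in> borel_measurable borel"
  shows "tdiff p u (- h) = tdiff p u h"
proof -
  have "tdiff p u (- h) = Lpow p (\<lambda>x. (\<lambda>y. u (y - h) - u y) (x + h))"
    unfolding tdiff_def by (subst Lpow_translate) auto
  also have "\<dots> = tdiff p u h"
    unfolding tdiff_def Lpow_def by (simp add: abs_minus_commute)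
  finally show ?thesis .
qed

lemma tdiff_zero [simp]: "tdiff p u 0 = 0"
  by (simp add: tdiff_def)

lemma tdiff_add_eps:
  fixes p e :: real assumes "p \<ge> 1" "e > 0"
  shows "\<exists>C\<ge>0. \<forall>u a b. u \<in> borel_measurable (borel :: 'a::euclidean_space measure) \<longrightarrow>
     tdiff p u (a + b) \<le> ennreal (1 + e) * tdiff p u a + ennreal C * tdiff p u b"
proof -
  obtain C where C: "C \<ge> 0" "\<And>f g. f \<in> borel_measurable (borel :: 'a measure) \<Longrightarrow>
     g \<in> borel_measurable borel \<Longrightarrow>
     Lpow p (\<lambda>x. f x + g x) \<le> ennreal (1 + e) * Lpow p f + ennreal C * Lpow p g"
    using Lpow_add_eps[OF assms] by blast
  have "tdiff p u (a + b) \<le> ennreal (1 + e) * tdiff p u a + ennreal C * tdiff p u b"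
    if [measurable]: "u \<in> borel_measurable (borel :: 'a measure)" for u a b
  proof -
    have "tdiff p u (a + b) = Lpow p (\<lambda>x. (u (x + a) - u x) + (u (x + a + b) - u (x + a)))"
      by (simp add: tdiff_def algebra_simps)
    also have "\<dots> \<le> ennreal (1 + e) * tdiff p u a + ennreal C * Lpow p (\<lambda>x. u (x + a + b) - u (x + a))"
      unfolding tdiff_def by (rule C) measurable
    also have "Lpow p (\<lambda>x. u (x + a + b) - u (x + a)) = tdiff p u b"
      using Lpow_translate[of "\<lambda>x. u (x + b) - u x" p a] by (simp add: tdiff_def algebra_simps)
    finally show ?thesis .
  qed
  with C(1) show ?thesis by blast
qed

section \<open>Continuity of translations\<close>

lemma tendsto_zero_le_ennreal:
  fixes f g :: "'a \<Rightarrow> ennreal"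
  assumes "\<And>x. f x \<le> g x" "(g \<longlongrightarrow> 0) F"
  shows "(f \<longlongrightarrow> 0) F"
  by (rule tendsto_sandwich[OF _ _ tendsto_const assms(2)]) (use assms(1) in auto)

text \<open>What counts are the points of A that the shift moves out of A. Given an open U around A
  with U - A small, such a point either leaves U, which by openness happens on a set of vanishing
  measure, or lands in U - A, whose shifted copy is just as small.\<close>

lemma tdiff_indicator_tendsto:
  fixes A :: "'a::euclidean_space set"
  assumes A [measurable]: "A \<in> sets borel" and fin: "emeasure lborel A < \<infinity>"
    and h: "h \<longlonglongrightarrow> 0"
  shows "(\<lambda>n. tdiff p (indicator A) (h n)) \<longlonglongrightarrow> 0"
proof -
  define N where "N g = emeasure lborel {x\<in>A. x + g \<notin> A}" for g :: 'a
  have one: "(\<lambda>n. N (g n)) \<longlonglongrightarrow> 0" if g: "g \<longlonglongrightarrow> 0" for g :: "nat \<Rightarrow> 'a"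
  proof (rule tendsto_zero_ennreal)
    fix e :: real assume e: "0 < e"
    obtain U where U: "open U" "A \<subseteq> U" "emeasure lborel (U - A) < ennreal (e/2)"
      using outer_regular_lborel[OF A, of "e/2"] e by auto
    then have [measurable]: "U \<in> sets borel" by auto
    define V where "V n = {x\<in>A. x + g n \<notin> U}" for n
    have [measurable]: "V n \<in> sets borel" for n unfolding V_def by measurable
    have "(\<lambda>n. \<integral>\<^sup>+x. indicator (V n) x \<partial>lborel) \<longlonglongrightarrow> (\<integral>\<^sup>+x. 0 \<partial>(lborel :: 'a measure))"
    proof (rule nn_integral_dominated_convergence[where w = "indicator A"])
      show "AE x in lborel. (\<lambda>n. indicator (V n) x :: ennreal) \<longlonglongrightarrow> 0"
      proof (rule AE_I2)
        fix x
        show "(\<lambda>n. indicator (V n) x :: ennreal) \<longlonglongrightarrow> 0"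
        proof (cases "x \<in> A")
          case True
          have "(\<lambda>n. x + g n) \<longlonglongrightarrow> x + 0" by (intro tendsto_intros g)
          then have "\<forall>\<^sub>F n in sequentially. x + g n \<in> U"
            using U True by (intro topological_tendstoD) auto
          then have "\<forall>\<^sub>F n in sequentially. indicator (V n) x = (0::ennreal)"
            by eventually_elim (auto simp: V_def)
          then show ?thesis by (rule tendsto_eventually)
        qed (simp add: V_def)
      qed
    qed (use fin in \<open>auto simp: V_def split: split_indicator\<close>)
    then have "(\<lambda>n. emeasure lborel (V n)) \<longlonglongrightarrow> 0" by simp
    then have "\<forall>\<^sub>F n in sequentially. emeasure lborel (V n) < ennreal (e/2)"
      by (rule order_tendstoD) (use e in simp)
    then show "\<forall>\<^sub>F n in sequentially. N (g n) < ennreal e"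
    proof eventually_elim
      case (elim n)
      have "emeasure lborel {x. x + g n \<in> U - A} = (\<integral>\<^sup>+x. indicator (U - A) (x + g n) \<partial>lborel)"
      proof -
        have "{x. x + g n \<in> U - A} \<in> sets lborel" by measurable
        from nn_integral_indicator[OF this] show ?thesis by (simp add: indicator_def)
      qed
      also have "\<dots> = emeasure lborel (U - A)"
        by (subst nn_integral_lborel_translate) auto
      finally have sh: "emeasure lborel {x. x + g n \<in> U - A} = emeasure lborel (U - A)" .
      have "N (g n) \<le> emeasure lborel (V n \<union> {x. x + g n \<in> U - A})"
        unfolding N_def by (intro emeasure_mono) (auto simp: V_def)
      also have "\<dots> \<le> emeasure lborel (V n) + emeasure lborel {x. x + g n \<in> U - A}"
        by (intro emeasure_subadditive) measurable
      also have "\<dots> < ennreal (e/2) + ennreal (e/2)"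
        unfolding sh by (rule add_strict_mono) (use elim U in auto)
      also have "\<dots> = ennreal e" using e by (simp flip: ennreal_plus)
      finally show ?case .
    qed
  qed
  \<comment> \<open>The difference of the indicators has modulus 0 or 1, so p drops out. A point
    that enters A is counted at its image, which the shift by -g moves out of A.\<close>
  have bound: "tdiff p (indicator A) g \<le> N g + N (- g)" for g
  proof -
    have "tdiff p (indicator A) g
       \<le> (\<integral>\<^sup>+x. indicator {x\<in>A. x + g \<notin> A} x + indicator {x\<in>A. x + - g \<notin> A} (x + g) \<partial>lborel)"
      unfolding tdiff_def Lpow_def
      by (intro nn_integral_mono) (auto simp: indicator_def)
    also have "\<dots> = N g + (\<integral>\<^sup>+x. indicator {x\<in>A. x + - g \<notin> A} (x + g) \<partial>lborel)"
      by (subst nn_integral_add) (auto simp: N_def)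
    also have "(\<integral>\<^sup>+x. indicator {x\<in>A. x + - g \<notin> A} (x + g) \<partial>lborel) = N (- g)"
      by (subst nn_integral_lborel_translate) (auto simp: N_def)
    finally show ?thesis .
  qed
  have h': "(\<lambda>n. - h n) \<longlonglongrightarrow> 0" using tendsto_minus[OF h] by simp
  have "(\<lambda>n. N (h n) + N (- h n)) \<longlonglongrightarrow> 0 + 0"
    by (intro tendsto_add one h h')
  then have "(\<lambda>n. N (h n) + N (- h n)) \<longlonglongrightarrow> 0" by simp
  from tendsto_zero_le_ennreal[OF bound this] show ?thesis .
qed

lemma tdiff_add_le:
  fixes f g :: "'a::euclidean_space \<Rightarrow> real"
  assumes [measurable]: "f \<in> borel_measurable borel" "g \<in> borel_measurable borel" and p: "p \<ge> 0"
  shows "tdiff p (\<lambda>x. f x + g x) h \<le> ennreal (2 powr p) * (tdiff p f h + tdiff p g h)"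
proof -
  have "tdiff p (\<lambda>x. f x + g x) h = Lpow p (\<lambda>x. (f (x + h) - f x) + (g (x + h) - g x))"
    by (simp add: tdiff_def algebra_simps)
  also have "\<dots> \<le> ennreal (2 powr p) * (tdiff p f h + tdiff p g h)"
    unfolding tdiff_def by (rule Lpow_add_le) (use p in measurable)
  finally show ?thesis .
qed

lemma tdiff_tendsto_add:
  fixes f g :: "'a::euclidean_space \<Rightarrow> real"
  assumes [measurable]: "f \<in> borel_measurable borel" "g \<in> borel_measurable borel" and p: "p \<ge> 0"
    and lim: "(\<lambda>n. tdiff p f (h n)) \<longlonglongrightarrow> 0" "(\<lambda>n. tdiff p g (h n)) \<longlonglongrightarrow> 0"
  shows "(\<lambda>n. tdiff p (\<lambda>x. f x + g x) (h n)) \<longlonglongrightarrow> 0"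
proof -
  have "(\<lambda>n. ennreal (2 powr p) * (tdiff p f (h n) + tdiff p g (h n))) \<longlonglongrightarrow> ennreal (2 powr p) * (0 + 0)"
    by (intro ennreal_tendsto_cmult tendsto_add lim) auto
  then have "(\<lambda>n. ennreal (2 powr p) * (tdiff p f (h n) + tdiff p g (h n))) \<longlonglongrightarrow> 0" by simp
  from tendsto_zero_le_ennreal[OF tdiff_add_le[OF assms(1-3)] this] show ?thesis .
qed

lemma tdiff_tendsto_sum:
  fixes f :: "'i \<Rightarrow> 'a::euclidean_space \<Rightarrow> real"
  assumes "finite I" and p: "p \<ge> 0"
    and "\<And>i. i \<in> I \<Longrightarrow> f i \<in> borel_measurable borel"
    and "\<And>i. i \<in> I \<Longrightarrow> (\<lambda>n. tdiff p (f i) (h n)) \<longlonglongrightarrow> 0"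
  shows "(\<lambda>n. tdiff p (\<lambda>x. \<Sum>i\<in>I. f i x) (h n)) \<longlonglongrightarrow> 0"
  using assms(1,3,4)
proof (induction I rule: finite_induct)
  case empty
  then show ?case by (simp add: tdiff_def)
next
  case (insert i I)
  have "(\<lambda>n. tdiff p (\<lambda>x. f i x + (\<Sum>i\<in>I. f i x)) (h n)) \<longlonglongrightarrow> 0"
    using insert by (intro tdiff_tendsto_add p borel_measurable_sum insert.IH) auto
  then show ?case using insert by simp
qed

lemma tdiff_simple_tendsto:
  fixes s :: "'a::euclidean_space \<Rightarrow> real"
  assumes s: "simple_function borel s" and fin: "Lpow p s < \<infinity>" and p: "p \<ge> 1"
    and h: "h \<longlonglongrightarrow> 0"
  shows "(\<lambda>n. tdiff p s (h n)) \<longlonglongrightarrow> 0"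
proof -
  have finr: "finite (range s)" using s by (auto simp: simple_function_def)
  have meas [measurable]: "s \<in> borel_measurable borel" using s by (rule borel_measurable_simple_function)
  have se: "s = (\<lambda>x. \<Sum>y\<in>range s. y * indicator (s -` {y}) x)"
  proof
    fix x
    have "(\<Sum>y\<in>range s. y * indicator (s -` {y}) x) = (\<Sum>y\<in>range s. if y = s x then y else 0)"
      by (intro sum.cong) (auto simp: indicator_def)
    also have "\<dots> = s x" using finr by (subst sum.delta) auto
    finally show "s x = (\<Sum>y\<in>range s. y * indicator (s -` {y}) x)" by simp
  qed
  have each: "(\<lambda>n. tdiff p (\<lambda>x. y * indicator (s -` {y}) x) (h n)) \<longlonglongrightarrow> 0" for y
  proof (cases "y = 0")
    case True then show ?thesis by (simp add: tdiff_def)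
  next
    case False
    have B [measurable]: "s -` {y} \<in> sets borel" using measurable_sets[OF meas, of "{y}"] by simp
    \<comment> \<open>Chebyshev: a nonzero value of s is taken on a set of finite measure, because
      that set contributes to the finite energy of s.\<close>
    have "ennreal (\<bar>y\<bar> powr p) * emeasure lborel (s -` {y})
       = (\<integral>\<^sup>+x. ennreal (\<bar>y\<bar> powr p) * indicator (s -` {y}) x \<partial>lborel)"
      by (subst nn_integral_cmult_indicator) auto
    also have "\<dots> \<le> Lpow p s" unfolding Lpow_def
      by (intro nn_integral_mono) (auto simp: indicator_def)
    finally have "ennreal (\<bar>y\<bar> powr p) * emeasure lborel (s -` {y}) < \<infinity>"
      using fin by (rule order.strict_trans1)
    then have fin: "emeasure lborel (s -` {y}) < \<infinity>"
      using False by (auto simp: ennreal_mult_less_top)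
    have eq: "tdiff p (\<lambda>x. y * indicator (s -` {y}) x) g = ennreal (\<bar>y\<bar> powr p) * tdiff p (indicator (s -` {y})) g" for g
      unfolding tdiff_def by (subst Lpow_cmult[symmetric]) (auto simp: algebra_simps)
    have "(\<lambda>n. ennreal (\<bar>y\<bar> powr p) * tdiff p (indicator (s -` {y})) (h n)) \<longlonglongrightarrow> ennreal (\<bar>y\<bar> powr p) * 0"
      by (intro ennreal_tendsto_cmult tdiff_indicator_tendsto fin h) auto
    then show ?thesis unfolding eq by simp
  qed
  have B: "s -` {y} \<in> sets borel" for y using measurable_sets[OF meas, of "{y}"] by simp
  show ?thesis
    by (subst se, rule tdiff_tendsto_sum[OF finr _ _ each]) (use p B in auto)
qed

lemma Lpow_approx_simple:
  fixes u :: "'a::euclidean_space \<Rightarrow> real"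
  assumes [measurable]: "u \<in> borel_measurable borel" and fin: "Lpow p u < \<infinity>" and p: "p \<ge> 1" and e: "e > 0"
  shows "\<exists>s. simple_function borel s \<and> Lpow p s < \<infinity> \<and> Lpow p (\<lambda>x. u x - s x) < ennreal e"
proof -
  obtain s where s: "\<And>i. simple_function borel (s i)" "\<And>x. (\<lambda>i. s i x) \<longlonglongrightarrow> u x"
      "\<And>i x. norm (s i x) \<le> 2 * norm (u x)"
    using borel_measurable_implies_sequence_metric[OF assms(1), of 0] by auto
  have [measurable]: "s i \<in> borel_measurable borel" for i
    using s(1) by (rule borel_measurable_simple_function)
  have fs: "Lpow p (s i) < \<infinity>" for i
  proof -
    have "Lpow p (s i) \<le> Lpow p (\<lambda>x. 2 * u x)"
      unfolding Lpow_def using s(3) p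
      by (intro nn_integral_mono ennreal_leI powr_mono2) (auto simp: abs_mult)
    also have "\<dots> < \<infinity>" using fin by (simp add: Lpow_cmult ennreal_mult_less_top)
    finally show ?thesis .
  qed
  \<comment> \<open>The factor 3 covers |u - s i|, since |s i| <= 2|u| along the approximating
    sequence.\<close>
  have dom: "Lpow p (\<lambda>x. 3 * u x) < \<infinity>"
    using fin by (simp add: Lpow_cmult ennreal_mult_less_top)
  have le: "ennreal (\<bar>u x - s i x\<bar> powr p) \<le> ennreal (\<bar>3 * u x\<bar> powr p)" for i x
    using s(3)[of i x] p by (intro ennreal_leI powr_mono2) auto
  have lim: "(\<lambda>i. ennreal (\<bar>u x - s i x\<bar> powr p)) \<longlonglongrightarrow> 0" for x
  proof -
    have "(\<lambda>i. \<bar>u x - s i x\<bar> powr p) \<longlonglongrightarrow> \<bar>u x - u x\<bar> powr p"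
      by (rule tendsto_powr'[OF tendsto_rabs[OF tendsto_diff[OF tendsto_const s(2)]] tendsto_const]) (use p in auto)
    from tendsto_ennrealI[OF this] show ?thesis
      using p by simp
  qed
  have "(\<lambda>i. \<integral>\<^sup>+x. ennreal (\<bar>u x - s i x\<bar> powr p) \<partial>lborel) \<longlonglongrightarrow> (\<integral>\<^sup>+x. 0 \<partial>(lborel :: 'a measure))"
    by (rule nn_integral_dominated_convergence[where w = "\<lambda>x. ennreal (\<bar>3 * u x\<bar> powr p)"])
       (use le lim dom[unfolded Lpow_def] in simp_all)
  then have "(\<lambda>i. Lpow p (\<lambda>x. u x - s i x)) \<longlonglongrightarrow> 0"
    by (simp add: Lpow_def)
  then have "\<forall>\<^sub>F i in sequentially. Lpow p (\<lambda>x. u x - s i x) < ennreal e"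
    by (intro order_tendstoD(2)[where y=0]) (use e in auto)
  then obtain i where "Lpow p (\<lambda>x. u x - s i x) < ennreal e"
    by (meson eventually_happens' trivial_limit_sequentially)
  with s(1) fs show ?thesis by blast
qed

lemma tdiff_tendsto_zero:
  fixes u :: "'a::euclidean_space \<Rightarrow> real"
  assumes [measurable]: "u \<in> borel_measurable borel" and fin: "Lpow p u < \<infinity>" and p: "p \<ge> 1"
  shows "(tdiff p u \<longlongrightarrow> 0) (nhds 0)"
proof -
  have seq: "(\<lambda>n. tdiff p u (h n)) \<longlonglongrightarrow> 0" if h: "h \<longlonglongrightarrow> 0" for h
  proof (rule tendsto_zero_ennreal)
    fix e :: real assume e: "e > 0"
    \<comment> \<open>Undoes the two constants met below, 2^p from the splitting u = (u - s) + s and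
      2^(p+1) from the crude bound on u - s, so that each part costs e/2.\<close>
    define d where "d = e / 2 / 2 powr p / 2 powr (p + 1)"
    have d: "d > 0" using e by (simp add: d_def)
    obtain s where s: "simple_function borel s" "Lpow p s < \<infinity>" "Lpow p (\<lambda>x. u x - s x) < ennreal d"
      using Lpow_approx_simple[OF assms(1) fin p d] by blast
    have [measurable]: "s \<in> borel_measurable borel"
      using s(1) by (rule borel_measurable_simple_function)
    have ds: "ennreal (e / 2 / 2 powr p) > 0" using e by simp
    have "\<forall>\<^sub>F n in sequentially. tdiff p s (h n) < ennreal (e / 2 / 2 powr p)"
      by (rule order_tendstoD(2)[OF tdiff_simple_tendsto[OF s(1,2) p h] ds])
    then show "\<forall>\<^sub>F n in sequentially. tdiff p u (h n) < ennreal e"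
    proof eventually_elim
      case (elim n)
      have "tdiff p u (h n) = tdiff p (\<lambda>x. (u x - s x) + s x) (h n)" by simp
      also have "\<dots> \<le> ennreal (2 powr p) * (tdiff p (\<lambda>x. u x - s x) (h n) + tdiff p s (h n))"
        by (rule tdiff_add_le) (use p in auto)
      also have "\<dots> \<le> ennreal (2 powr p) * (ennreal (2 powr (p + 1)) * Lpow p (\<lambda>x. u x - s x) + tdiff p s (h n))"
        by (intro mult_left_mono add_right_mono tdiff_le_Lpow) (use p in auto)
      also have "\<dots> < ennreal (2 powr p) * (ennreal (2 powr (p + 1)) * ennreal d + ennreal (e / 2 / 2 powr p))"
      proof (rule ennreal_mult_strict_left_mono)
        show "ennreal (2 powr (p + 1)) * Lpow p (\<lambda>x. u x - s x) + tdiff p s (h n)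
            < ennreal (2 powr (p + 1)) * ennreal d + ennreal (e / 2 / 2 powr p)"
          by (intro add_strict_mono ennreal_mult_strict_left_mono s(3) elim) auto
      qed auto
      also have "\<dots> = ennreal (2 powr p * (2 powr (p + 1) * d + e / 2 / 2 powr p))"
        using d e by (simp add: ennreal_mult)
      also have "2 powr p * (2 powr (p + 1) * d + e / 2 / 2 powr p) = e"
        by (simp add: d_def distrib_left)
      finally show ?case .
    qed
  qed
  show "(tdiff p u \<longlongrightarrow> 0) (nhds 0)"
    unfolding tendsto_def
    using seq sequentially_imp_eventually_nhds_within[where s = UNIV and a = "0::'a"]
    by (simp add: tendsto_def)
qed

section \<open>Test functions\<close>

text \<open>\<open>iter_dd\<close> keeps the outermost derivative at the head of the list, so a
  derivative taken first goes to the end. Hence derivatives of smooth functions are smooth.\<close>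

lemma iter_dd_snoc: "iter_dd vs (\<lambda>x. frechet_derivative f (at x) v) = iter_dd (vs @ [v]) f"
  by (induction vs) auto

lemma test_fun_iff:
  "test_fun \<phi> \<longleftrightarrow> smooth_fun \<phi> \<and> (\<exists>R>0. \<forall>x. norm x > R \<longrightarrow> \<phi> x = 0)"
proof -
  have "bounded {x. \<phi> x \<noteq> 0} \<longleftrightarrow> (\<exists>R>0. \<forall>x. norm x > R \<longrightarrow> \<phi> x = 0)"
    unfolding bounded_pos by (metis (mono_tags, lifting) mem_Collect_eq not_less)
  then show ?thesis by (simp add: test_fun_def compact_closure)
qed

lemma smooth_fun_differentiable: "smooth_fun \<phi> \<Longrightarrow> \<phi> differentiable (at x)"
  unfolding smooth_fun_def by (metis iter_dd.simps(1))

lemma smooth_fun_has_derivative: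
  "smooth_fun \<phi> \<Longrightarrow> (\<phi> has_derivative frechet_derivative \<phi> (at x)) (at x)"
  using smooth_fun_differentiable frechet_derivative_works by blast

lemma smooth_fun_continuous: "smooth_fun \<phi> \<Longrightarrow> continuous_on UNIV \<phi>"
  by (meson continuous_at_imp_continuous_on differentiable_imp_continuous_within smooth_fun_differentiable)

lemma smooth_fun_dd: "smooth_fun \<phi> \<Longrightarrow> smooth_fun (\<lambda>x. frechet_derivative \<phi> (at x) v)"
  unfolding smooth_fun_def iter_dd_snoc by blast

lemma test_fun_borel [measurable_dest]: "test_fun \<phi> \<Longrightarrow> \<phi> \<in> borel_measurable borel"
  by (auto simp: test_fun_def intro!: borel_measurable_continuous_onI smooth_fun_continuous)

lemma frechet_derivative_zero_outside:
  fixes \<phi> :: "'a::euclidean_space \<Rightarrow> real"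
  assumes "\<And>x. norm x > R \<Longrightarrow> \<phi> x = 0" "norm x > R"
  shows "frechet_derivative \<phi> (at x) v = 0"
proof -
  have "open {x::'a. norm x > R}" by (intro open_Collect_less continuous_intros)
  then have "(\<phi> has_derivative (\<lambda>_. 0)) (at x)"
    using has_derivative_transform_within_open[of "\<lambda>_. 0" "\<lambda>_. 0" x UNIV "{x. norm x > R}" \<phi>] assms by auto
  then show ?thesis by (metis frechet_derivative_at)
qed

lemma test_fun_dd:
  assumes "test_fun \<phi>" shows "test_fun (\<lambda>x. frechet_derivative \<phi> (at x) v)"
proof -
  obtain R where "R > 0" "\<And>x. norm x > R \<Longrightarrow> \<phi> x = 0" using assms test_fun_iff by blast
  then have "\<forall>x. norm x > R \<longrightarrow> frechet_derivative \<phi> (at x) v = 0"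
    using frechet_derivative_zero_outside by blast
  with \<open>R > 0\<close> show ?thesis
    using assms smooth_fun_dd by (auto simp: test_fun_iff)
qed

lemma test_fun_iter_dd: "test_fun \<phi> \<Longrightarrow> test_fun (iter_dd vs \<phi>)"
  by (induction vs) (auto intro: test_fun_dd)

lemma test_fun_uniformly_continuous:
  assumes "test_fun \<phi>" shows "uniformly_continuous_on UNIV \<phi>"
proof -
  obtain R where R: "R > 0" "\<And>x. norm x > R \<Longrightarrow> \<phi> x = 0" using assms test_fun_iff by blast
  have c: "continuous_on UNIV \<phi>" using assms smooth_fun_continuous test_fun_def by blast
  have "uniformly_continuous_on (cball 0 (R + 1)) \<phi>"
    by (intro compact_uniformly_continuous continuous_on_subset[OF c]) auto
  show ?thesis unfolding uniformly_continuous_on_def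
  proof safe
    fix e :: real assume "e > 0"
    then obtain d where d: "d > 0" "\<And>x y. x \<in> cball 0 (R+1) \<Longrightarrow> y \<in> cball 0 (R+1) \<Longrightarrow> dist y x < d \<Longrightarrow> dist (\<phi> y) (\<phi> x) < e"
      using \<open>uniformly_continuous_on (cball 0 (R + 1)) \<phi>\<close> unfolding uniformly_continuous_on_def by metis
    \<comment> \<open>The margin 1 leaves two cases: both points lie in the ball of radius R + 1,
      where \<phi> is uniformly continuous, or both lie outside the ball of radius R, where it
      vanishes.\<close>
    have "dist (\<phi> y) (\<phi> x) < e" if "dist y x < min d 1" for x y
    proof (cases "norm x \<le> R + 1 \<and> norm y \<le> R + 1")
      case True then show ?thesis using d that by auto
    next
      case False
      have "norm x \<le> norm y + dist y x" "norm y \<le> norm x + dist y x"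
        unfolding dist_norm by norm+
      then have "norm x > R \<and> norm y > R" using False that by auto
      then show ?thesis using R \<open>e > 0\<close> by simp
    qed
    then show "\<exists>d>0. \<forall>x\<in>UNIV. \<forall>y\<in>UNIV. dist y x < d \<longrightarrow> dist (\<phi> y) (\<phi> x) < e"
      using d(1) by (intro exI[of _ "min d 1"]) auto
  qed
qed

lemma test_fun_bounded:
  assumes "test_fun \<phi>" shows "\<exists>B>0. \<forall>x. \<bar>\<phi> x\<bar> \<le> B"
proof -
  obtain R where R: "R > 0" "\<And>x. norm x > R \<Longrightarrow> \<phi> x = 0" using assms test_fun_iff by blast
  have c: "continuous_on UNIV \<phi>" using assms smooth_fun_continuous test_fun_def by blast
  have "bounded (\<phi> ` cball 0 R)"
    by (intro compact_imp_bounded compact_continuous_image continuous_on_subset[OF c]) auto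
  then obtain B where B: "B > 0" "\<And>x. x \<in> cball 0 R \<Longrightarrow> \<bar>\<phi> x\<bar> \<le> B"
    unfolding bounded_pos by auto
  have "\<bar>\<phi> x\<bar> \<le> B" for x
    using B R(2)[of x] by (cases "norm x \<le> R") auto
  with B(1) show ?thesis by blast
qed

lemma smooth_fun_fd_sum:
  assumes "smooth_fun (\<phi> :: 'a::euclidean_space \<Rightarrow> real)"
  shows "frechet_derivative \<phi> (at x) h = (\<Sum>b\<in>Basis. (h \<bullet> b) * frechet_derivative \<phi> (at x) b)"
proof -
  have l: "linear (frechet_derivative \<phi> (at x))"
    using linear_frechet_derivative smooth_fun_differentiable[OF assms] by blast
  have "frechet_derivative \<phi> (at x) h = frechet_derivative \<phi> (at x) (\<Sum>b\<in>Basis. (h \<bullet> b) *\<^sub>R b)"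
    by (simp add: euclidean_representation)
  also have "\<dots> = (\<Sum>b\<in>Basis. (h \<bullet> b) * frechet_derivative \<phi> (at x) b)"
    by (simp add: linear_sum[OF l] linear_scale[OF l])
  finally show ?thesis .
qed

lemma smooth_fun_mvt:
  assumes "smooth_fun (\<phi> :: 'a::euclidean_space \<Rightarrow> real)"
  shows "\<exists>s. 0 < s \<and> s < 1 \<and> \<phi> (x + h) - \<phi> x = frechet_derivative \<phi> (at (x + s *\<^sub>R h)) h"
proof -
  have der: "((\<lambda>s. \<phi> (x + s *\<^sub>R h)) has_real_derivative frechet_derivative \<phi> (at (x + s *\<^sub>R h)) h) (at s)" for s
  proof -
    have "((\<lambda>s. \<phi> (x + s *\<^sub>R h)) has_derivative (\<lambda>t. frechet_derivative \<phi> (at (x + s *\<^sub>R h)) (t *\<^sub>R h))) (at s)"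
      by (rule has_derivative_compose[of "\<lambda>s. x + s *\<^sub>R h", OF _ smooth_fun_has_derivative[OF assms]])
         (auto intro!: derivative_eq_intros)
    moreover have "frechet_derivative \<phi> (at (x + s *\<^sub>R h)) (t *\<^sub>R h) = frechet_derivative \<phi> (at (x + s *\<^sub>R h)) h * t" for t
      using linear_scale[OF linear_frechet_derivative[OF smooth_fun_differentiable[OF assms]]]
      by (simp add: mult.commute)
    ultimately show ?thesis by (simp add: has_field_derivative_def)
  qed
  have "\<exists>z>0. z < 1 \<and> \<phi> (x + 1 *\<^sub>R h) - \<phi> (x + 0 *\<^sub>R h) = (1 - 0) * frechet_derivative \<phi> (at (x + z *\<^sub>R h)) h"
    by (rule MVT2) (use der in auto)
  then show ?thesis by auto
qed

text \<open>The mean value theorem turns the Taylor error into differences of partial derivatives,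
  and these are test functions, hence uniformly continuous. Uniformity in x is what allows
  differentiation under the integral in \<open>corr_has_derivative\<close>.\<close>

lemma test_fun_uniform_derivative:
  assumes t: "test_fun (\<phi> :: 'a::euclidean_space \<Rightarrow> real)" and e: "e > 0"
  shows "\<exists>d>0. \<forall>x h. norm h < d \<longrightarrow> \<bar>\<phi> (x + h) - \<phi> x - frechet_derivative \<phi> (at x) h\<bar> \<le> e * norm h"
proof -
  have s: "smooth_fun \<phi>" using t test_fun_def by blast
  define e' where "e' = e / DIM('a)"
  have e': "e' > 0" using e by (simp add: e'_def)
  have "\<exists>d>0. \<forall>x y. dist y x < d \<longrightarrow> \<bar>frechet_derivative \<phi> (at y) b - frechet_derivative \<phi> (at x) b\<bar> < e'" for b
    using test_fun_uniformly_continuous[OF test_fun_dd[OF t, of b]] e'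
    unfolding uniformly_continuous_on_def dist_real_def by (metis UNIV_I)
  then obtain d where d: "\<And>b. d b > 0"
    "\<And>b x y. dist y x < d b \<Longrightarrow> \<bar>frechet_derivative \<phi> (at y) b - frechet_derivative \<phi> (at x) b\<bar> < e'"
    by metis
  have D: "Min (d ` Basis) > 0" using d(1) by (subst Min_gr_iff) auto
  have "\<bar>\<phi> (x + h) - \<phi> x - frechet_derivative \<phi> (at x) h\<bar> \<le> e * norm h" if h: "norm h < Min (d ` Basis)" for x h
  proof -
    obtain r where r: "0 < r" "r < 1" "\<phi> (x + h) - \<phi> x = frechet_derivative \<phi> (at (x + r *\<^sub>R h)) h"
      using smooth_fun_mvt[OF s] by blast
    have "\<bar>\<phi> (x + h) - \<phi> x - frechet_derivative \<phi> (at x) h\<bar>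
       = \<bar>\<Sum>b\<in>Basis. (h \<bullet> b) * (frechet_derivative \<phi> (at (x + r *\<^sub>R h)) b - frechet_derivative \<phi> (at x) b)\<bar>"
      unfolding r(3) by (subst (1 2) smooth_fun_fd_sum[OF s]) (simp add: sum_subtractf algebra_simps)
    also have "\<dots> \<le> (\<Sum>b\<in>(Basis::'a set). norm h * e')"
    proof (rule order.trans[OF sum_abs sum_mono])
      fix b :: 'a assume b: "b \<in> Basis"
      have "r * norm h \<le> norm h" using r by (simp add: mult_left_le_one_le)
      then have "dist (x + r *\<^sub>R h) x < d b" using h b r by (auto simp: dist_norm)
      then have "\<bar>frechet_derivative \<phi> (at (x + r *\<^sub>R h)) b - frechet_derivative \<phi> (at x) b\<bar> \<le> e'"
        using d(2) less_imp_le by blast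
      then show "\<bar>h \<bullet> b * (frechet_derivative \<phi> (at (x + r *\<^sub>R h)) b - frechet_derivative \<phi> (at x) b)\<bar> \<le> norm h * e'"
        unfolding abs_mult using b by (intro mult_mono) (auto simp: Basis_le_norm)
    qed
    also have "\<dots> = e * norm h" by (simp add: e'_def)
    finally show ?thesis .
  qed
  with D show ?thesis by blast
qed

lemma iter_dd_translate:
  assumes "smooth_fun \<phi>"
  shows "iter_dd vs (\<lambda>x. \<phi> (x + a)) = (\<lambda>x. iter_dd vs \<phi> (x + a)) \<and>
     (\<forall>x. (\<lambda>x. iter_dd vs \<phi> (x + a)) differentiable (at x))"
proof (induction vs)
  have tr: "((\<lambda>x. f (x + a)) has_derivative frechet_derivative f (at (x + a))) (at x)"
    if "f differentiable (at (x + a))" for f :: "'a \<Rightarrow> real" and x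
  proof -
    have "(f has_derivative frechet_derivative f (at (x + a))) (at (x + a))"
      using that by (simp add: frechet_derivative_works)
    then show ?thesis
      by (rule has_derivative_compose[of "\<lambda>x. x + a", rotated]) (auto intro!: derivative_eq_intros)
  qed
  have sm: "iter_dd vs \<phi> differentiable (at x)" for vs x using assms smooth_fun_def by blast
  case Nil
  then show ?case using tr[OF smooth_fun_differentiable[OF assms]] by (auto simp: differentiable_def)
  case (Cons v vs)
  have "iter_dd (v # vs) (\<lambda>x. \<phi> (x + a)) = (\<lambda>x. iter_dd (v # vs) \<phi> (x + a))"
    using Cons tr[OF sm, THEN frechet_derivative_at] by simp
  moreover have "(\<lambda>x. iter_dd (v # vs) \<phi> (x + a)) differentiable (at x)" for x
    using tr[OF sm] by (meson differentiable_def)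
  ultimately show ?case by blast
qed

lemma test_fun_translate:
  assumes "test_fun \<phi>" shows "test_fun (\<lambda>x. \<phi> (x + a))"
proof -
  have s: "smooth_fun \<phi>" using assms test_fun_def by blast
  obtain R where R: "R > 0" "\<And>x. norm x > R \<Longrightarrow> \<phi> x = 0" using assms test_fun_iff by blast
  have "\<phi> (x + a) = 0" if "norm x > R + norm a" for x
  proof -
    have "norm x \<le> norm (x + a) + norm a" by norm
    then show ?thesis using that R by auto
  qed
  moreover have "R + norm a > 0" using R by (simp add: add_pos_nonneg)
  moreover have "smooth_fun (\<lambda>x. \<phi> (x + a))"
    unfolding smooth_fun_def using iter_dd_translate[OF s] by metis
  ultimately show ?thesis unfolding test_fun_iff by blast
qed

lemma frechet_derivative_translate:
  assumes "smooth_fun \<phi>"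
  shows "frechet_derivative (\<lambda>x. \<phi> (x + a)) (at x) v = frechet_derivative \<phi> (at (x + a)) v"
  using iter_dd_translate[OF assms, of "[v]"] by (simp add: fun_eq_iff)

subsection \<open>Bump functions\<close>

text \<open>For n = 0 this is the classical smooth function that is flat at 0. The index makes the
  family closed under differentiation up to linear combinations.\<close>

definition flat :: "nat \<Rightarrow> real \<Rightarrow> real" where
  "flat n t = (if t > 0 then inverse t ^ n * exp (- inverse t) else 0)"

lemma flat_nonneg: "flat n t \<ge> 0"
  by (simp add: flat_def)

lemma power_div_fact_le_exp:
  fixes x :: real assumes "x \<ge> 0" shows "x ^ k / fact k \<le> exp x"
proof -
  have "sum (\<lambda>n. x ^ n /\<^sub>R fact n) {k} \<le> (\<Sum>n. x ^ n /\<^sub>R fact n)"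
    by (rule sum_le_suminf[OF summable_exp_generic]) (use assms in auto)
  then show ?thesis by (simp add: exp_def divide_inverse mult.commute)
qed

text \<open>The bound x^k / k! <= exp x at x = 1/t with k = n + 2: the two powers beyond n are
  traded for the factor t^2, which makes the derivative at 0 vanish.\<close>

lemma flat_le: "flat n t \<le> fact (n + 2) * t\<^sup>2"
proof (cases "t > 0")
  case True
  have "inverse t ^ (n + 2) / fact (n + 2) \<le> exp (inverse t)"
    using True by (intro power_div_fact_le_exp) auto
  then have "inverse t ^ (n + 2) * exp (- inverse t) \<le> fact (n + 2)"
    using divide_le_eq[of "inverse t ^ (n + 2)" "fact (n + 2)" "exp (inverse t)"]
      pos_divide_le_eq[of "exp (inverse t)" "inverse t ^ (n + 2)" "fact (n + 2)"]
    by (simp add: exp_minus divide_inverse mult.commute del: fact_Suc add_2_eq_Suc')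
  then have "t\<^sup>2 * (inverse t ^ (n + 2) * exp (- inverse t)) \<le> t\<^sup>2 * fact (n + 2)"
    by (rule mult_left_mono) simp
  moreover have "t\<^sup>2 * (inverse t ^ (n + 2) * exp (- inverse t)) = inverse t ^ n * exp (- inverse t)"
    using True by (simp add: power_add power_inverse field_simps power2_eq_square)
  ultimately have "inverse t ^ n * exp (- inverse t) \<le> fact (n + 2) * t\<^sup>2"
    by (simp only: mult.commute)
  then show ?thesis using True by (simp add: flat_def)
qed (simp add: flat_def)

lemma flat_has_derivative:
  "(flat n has_real_derivative (flat (n + 2) t - real n * flat (n + 1) t)) (at t)"
proof -
  consider "t > 0" | "t < 0" | "t = 0" by linarith
  then show ?thesis
  proof cases
    case 1
    have "((\<lambda>t. inverse t ^ n * exp (- inverse t)) has_real_derivative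
        (flat (n + 2) t - real n * flat (n + 1) t)) (at t)"
    proof -
      have i: "(inverse has_real_derivative (- (inverse t)\<^sup>2)) (at t)"
        using 1 by (auto intro!: derivative_eq_intros simp: power2_eq_square)
      have "((\<lambda>t. inverse t ^ n * exp (- inverse t)) has_real_derivative
          (real n * inverse t ^ (n - 1) * - (inverse t)\<^sup>2) * exp (- inverse t)
            + inverse t ^ n * (exp (- inverse t) * (inverse t)\<^sup>2)) (at t)"
        using 1 by (auto intro!: derivative_eq_intros i simp: power2_eq_square algebra_simps)
      then show ?thesis
        by (rule DERIV_cong) (use 1 in \<open>cases n; simp add: flat_def power2_eq_square algebra_simps\<close>)
    qed
    moreover have "\<forall>\<^sub>F s in nhds t. inverse s ^ n * exp (- inverse s) = flat n s"
      using eventually_nhds_in_open[of "{0<..}" t] 1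
      by (auto elim!: eventually_mono simp: flat_def)
    ultimately show ?thesis by (subst DERIV_cong_ev[OF refl _ refl, of "flat n" "\<lambda>t. inverse t ^ n * exp (- inverse t)"])
        (auto elim: eventually_mono)
  next
    case 2
    moreover have "\<forall>\<^sub>F s in nhds t. flat n s = 0"
      using eventually_nhds_in_open[of "{..<0}" t] 2
      by (auto elim!: eventually_mono simp: flat_def)
    ultimately show ?thesis
      by (subst DERIV_cong_ev[OF refl _ refl, of "flat n" "\<lambda>t. 0"]) (auto simp: flat_def)
  next
    case 3
    \<comment> \<open>At 0 the difference quotient is at most c|h|, and the claimed derivative is 0
      because every \<open>flat\<close> vanishes there.\<close>
    obtain c :: real where c: "\<And>t. flat n t \<le> c * t\<^sup>2" using flat_le by blast
    have "((\<lambda>h. flat n h / h) \<longlongrightarrow> 0) (at 0)"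
    proof (rule tendsto_rabs_zero_cancel, rule tendsto_sandwich[OF _ _ tendsto_const])
      show "\<forall>\<^sub>F h in at 0. \<bar>flat n h / h\<bar> \<le> c * \<bar>h\<bar>"
      proof (rule always_eventually, rule allI)
        fix h :: real
        have "flat n h \<le> c * \<bar>h\<bar> * \<bar>h\<bar>" using c[of h] by (simp add: power2_eq_square mult.assoc)
        then show "\<bar>flat n h / h\<bar> \<le> c * \<bar>h\<bar>"
          using flat_nonneg[of n h] by (cases "h = 0") (auto simp: divide_le_eq)
      qed
      have "((\<lambda>h. c * \<bar>h\<bar>) \<longlongrightarrow> c * \<bar>0::real\<bar>) (at 0)"
        by (intro tendsto_intros)
      then show "((\<lambda>h. c * \<bar>h :: real\<bar>) \<longlongrightarrow> 0) (at 0)" by simp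
    qed auto
    then show ?thesis using 3 by (simp add: DERIV_def flat_def)
  qed
qed

text \<open>An algebra of functions that is closed under directional derivatives; membership thus yields
  smoothness.\<close>

inductive flat_alg :: "('a::euclidean_space \<Rightarrow> real) \<Rightarrow> bool" where
  flat_alg_const: "flat_alg (\<lambda>x. c)"
| flat_alg_inner: "flat_alg (\<lambda>x. x \<bullet> v)"
| flat_alg_flat: "flat_alg (\<lambda>x. flat n (a - b * (x \<bullet> x)))"
| flat_alg_add: "flat_alg f \<Longrightarrow> flat_alg g \<Longrightarrow> flat_alg (\<lambda>x. f x + g x)"
| flat_alg_mult: "flat_alg f \<Longrightarrow> flat_alg g \<Longrightarrow> flat_alg (\<lambda>x. f x * g x)"

lemma flat_alg_derivative:
  "flat_alg f \<Longrightarrow> \<exists>f'. (\<forall>x. (f has_derivative f' x) (at x)) \<and> (\<forall>v. flat_alg (\<lambda>x. f' x v))"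
proof (induction rule: flat_alg.induct)
  case (flat_alg_const c)
  show ?case by (rule exI[of _ "\<lambda>_ _. 0"]) (auto intro: flat_alg.flat_alg_const)
next
  case (flat_alg_inner v)
  show ?case
    by (rule exI[of _ "\<lambda>_ h. h \<bullet> v"]) (auto intro!: flat_alg.flat_alg_const derivative_eq_intros)
next
  case (flat_alg_flat n a b)
  define G where "G x = flat (n + 2) (a - b * (x \<bullet> x)) + (- real n) * flat (n + 1) (a - b * (x \<bullet> x))" for x :: 'a
  have "((\<lambda>x. flat n (a - b * (x \<bullet> x))) has_derivative (\<lambda>h. G x * (- (2 * b) * (x \<bullet> h)))) (at x)" for x :: 'a
  proof -
    have "(flat n has_derivative (\<lambda>t. G x * t)) (at (a - b * (x \<bullet> x)))"
      using flat_has_derivative[of n "a - b * (x \<bullet> x)"] by (simp add: has_field_derivative_def G_def)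
    then have "((\<lambda>x. flat n (a - b * (x \<bullet> x))) has_derivative (\<lambda>h. G x * (0 - b * (x \<bullet> h + h \<bullet> x)))) (at x)"
      by (rule has_derivative_compose[of "\<lambda>x. a - b * (x \<bullet> x)", rotated]) (auto intro!: derivative_eq_intros)
    then show ?thesis by (simp add: inner_commute algebra_simps)
  qed
  moreover have "flat_alg (\<lambda>x. G x * (- (2 * b) * (x \<bullet> h)))" for h :: 'a
    unfolding G_def by (intro flat_alg.intros)
  ultimately show ?case by (intro exI[of _ "\<lambda>x h. G x * (- (2 * b) * (x \<bullet> h))"]) auto
next
  case (flat_alg_add f g)
  then obtain f' g' where "\<forall>x. (f has_derivative f' x) (at x)" "\<forall>v. flat_alg (\<lambda>x. f' x v)"
     "\<forall>x. (g has_derivative g' x) (at x)" "\<forall>v. flat_alg (\<lambda>x. g' x v)" by blast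
  then show ?case
    by (intro exI[of _ "\<lambda>x h. f' x h + g' x h"]) (auto intro!: flat_alg.flat_alg_add derivative_intros)
next
  case (flat_alg_mult f g)
  then obtain f' g' where "\<forall>x. (f has_derivative f' x) (at x)" "\<forall>v. flat_alg (\<lambda>x. f' x v)"
     "\<forall>x. (g has_derivative g' x) (at x)" "\<forall>v. flat_alg (\<lambda>x. g' x v)" by blast
  then show ?case using flat_alg_mult.hyps
    by (intro exI[of _ "\<lambda>x h. f x * g' x h + f' x h * g x"])
       (auto intro!: flat_alg.flat_alg_add flat_alg.flat_alg_mult derivative_intros)
qed

lemma flat_alg_smooth:
  assumes "flat_alg f" shows "smooth_fun f"
proof -
  have "flat_alg (iter_dd vs f)" for vs
  proof (induction vs)
    case (Cons v vs)
    then obtain f' where "\<And>x. (iter_dd vs f has_derivative f' x) (at x)" "flat_alg (\<lambda>x. f' x v)"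
      using flat_alg_derivative by blast
    then have "(\<lambda>x. frechet_derivative (iter_dd vs f) (at x) v) = (\<lambda>x. f' x v)"
      by (metis frechet_derivative_at)
    then show ?case using \<open>flat_alg (\<lambda>x. f' x v)\<close> by simp
  qed (use assms in simp)
  then show ?thesis
    unfolding smooth_fun_def using flat_alg_derivative differentiable_def by blast
qed

text \<open>With a = r^2 and b = 1 the support is the closed ball of radius r. The parameter b
  absorbs dilations, see \<open>bump_scale\<close>, so a dilated bump is again a bump.\<close>

definition bump :: "real \<Rightarrow> real \<Rightarrow> 'a::euclidean_space \<Rightarrow> real" where
  "bump a b x = flat 0 (a - b * (x \<bullet> x))"

lemma bump_nonneg: "bump a b x \<ge> 0"
  by (simp add: bump_def flat_nonneg)

lemma bump_zero: "r > 0 \<Longrightarrow> norm x \<ge> r \<Longrightarrow> bump (r\<^sup>2) 1 x = 0"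
  using power_mono[of r "norm x" 2]
  by (simp add: bump_def flat_def power2_norm_eq_inner)

lemma bump_pos: "norm x < r \<Longrightarrow> bump (r\<^sup>2) 1 x > 0"
  by (auto simp: bump_def flat_def power_strict_mono simp flip: power2_norm_eq_inner)

lemma bump_scale: "bump a 1 (c *\<^sub>R x) = bump a (c\<^sup>2) x"
  by (simp add: bump_def power2_eq_square mult.assoc)

text \<open>The factor c serves the normalised mollifier and, with c = 0, provides the zero function
  as a test function.\<close>

lemma test_fun_cmult_bump:
  assumes b: "b > 0" shows "test_fun (\<lambda>x::'a::euclidean_space. c * bump a b x)"
proof -
  have "bump a b x = 0" if "norm x > max 1 (a / b)" for x :: 'a
  proof -
    have "a / b \<le> norm x" "1 \<le> norm x" using that by auto
    then have "a / b \<le> norm x * norm x" by (meson dual_order.trans mult_le_cancel_left1 norm_ge_zero order.strict_trans1 mult_left_le le_less_trans not_le linorder_not_less mult_le_cancel_right1)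
    then have "a \<le> b * (x \<bullet> x)" using b by (simp add: field_simps flip: power2_norm_eq_inner power2_eq_square)
    then show ?thesis by (simp add: bump_def flat_def)
  qed
  moreover have "smooth_fun (\<lambda>x::'a. c * bump a b x)"
    unfolding bump_def by (intro flat_alg_smooth flat_alg.intros)
  ultimately show ?thesis unfolding test_fun_iff
    by (intro conjI exI[of _ "max 1 (a / b)"]) auto
qed

subsection \<open>Mollification\<close>

lemma cball_borel [measurable]: "cball (a::'a::euclidean_space) r \<in> sets borel"
  by (simp add: borel_closed)

text \<open>Counterpart of \<open>loc_integrable\<close> for Borel functions; measurability is
  included so that this is the single condition on a function paired with test functions.\<close>

definition loc_int :: "('a::euclidean_space \<Rightarrow> real) \<Rightarrow> bool" where
  "loc_int u \<longleftrightarrow> u \<in> borel_measurable borel \<and> (\<forall>R. integrable lborel (\<lambda>x. indicator (cball 0 R) x * u x))"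

lemma loc_int_borel [measurable_dest]: "loc_int u \<Longrightarrow> u \<in> borel_measurable borel"
  by (simp add: loc_int_def)

lemma integral_lborel_translate:
  fixes f :: "'a::euclidean_space \<Rightarrow> real"
  assumes [measurable]: "f \<in> borel_measurable borel"
  shows "(\<integral>x. f (x + a) \<partial>lborel) = (\<integral>x. f x \<partial>lborel)"
proof -
  have "(\<integral>x. f x \<partial>lborel) = (\<integral>x. f x \<partial>(distr lborel borel ((+) a)))" by (simp add: lborel_distr_plus)
  also have "\<dots> = (\<integral>x. f (x + a) \<partial>lborel)" by (subst integral_distr) (auto simp: add.commute)
  finally show ?thesis by simp
qed

lemma loc_int_bounded:
  fixes u :: "'a::euclidean_space \<Rightarrow> real"
  assumes [measurable]: "u \<in> borel_measurable borel" and B: "\<And>x. \<bar>u x\<bar> \<le> B"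
  shows "loc_int u"
  unfolding loc_int_def
proof (intro conjI allI)
  fix R
  have "integrable lborel (indicator (cball (0::'a) R) :: 'a \<Rightarrow> real)"
    using emeasure_bounded_finite[of "cball (0::'a) R"] by (intro integrable_real_indicator) auto
  then have "integrable lborel (\<lambda>x. B * indicator (cball (0::'a) R) x)" by simp
  then show "integrable lborel (\<lambda>x. indicator (cball 0 R) x * u x)"
  proof (rule Bochner_Integration.integrable_bound)
    have "\<bar>u x\<bar> \<le> \<bar>B\<bar>" for x using B[of x] by linarith
    then show "AE x in lborel. norm (indicator (cball 0 R) x * u x) \<le> norm (B * indicator (cball 0 R) x)"
      by (auto simp: abs_mult split: split_indicator)
  qed measurable
qed fact

lemma loc_int_Lpow:
  fixes u :: "'a::euclidean_space \<Rightarrow> real"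
  assumes [measurable]: "u \<in> borel_measurable borel" and p: "p \<ge> 1" and fin: "Lpow p u < \<infinity>"
  shows "loc_int u"
  unfolding loc_int_def
proof (intro conjI allI)
  fix R
  have le: "\<bar>a\<bar> \<le> 1 + \<bar>a\<bar> powr p" for a :: real
  proof (cases "\<bar>a\<bar> \<le> 1")
    case True then show ?thesis by (simp add: add_increasing2)
  next
    case False
    then have "\<bar>a\<bar> powr 1 \<le> \<bar>a\<bar> powr p" using p by (intro powr_mono) auto
    then show ?thesis using False by simp
  qed
  have "(\<integral>\<^sup>+x. ennreal (norm (indicator (cball 0 R) x * u x)) \<partial>lborel)
     \<le> (\<integral>\<^sup>+x. indicator (cball 0 R) x + ennreal (\<bar>u x\<bar> powr p) \<partial>lborel)"
    using le by (intro nn_integral_mono) (auto split: split_indicator simp flip: ennreal_1 ennreal_plus)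
  also have "\<dots> = emeasure lborel (cball (0::'a) R) + Lpow p u"
    unfolding Lpow_def by (subst nn_integral_add) (auto intro!: borel_measurable_indicator)
  also have "\<dots> < \<infinity>" using fin emeasure_bounded_finite[of "cball (0::'a) R"] by simp
  finally have "(\<integral>\<^sup>+x. ennreal (norm (indicator (cball 0 R) x * u x)) \<partial>lborel) < \<infinity>" .
  then show "integrable lborel (\<lambda>x. indicator (cball 0 R) x * u x)"
    by (rule integrableI_bounded[rotated]) measurable
qed fact

lemma integrable_loc_int_mult:
  fixes u g :: "'a::euclidean_space \<Rightarrow> real"
  assumes u: "loc_int u" and [measurable]: "g \<in> borel_measurable borel"
    and B: "\<And>x. \<bar>g x\<bar> \<le> B" and R: "\<And>x. norm x > R \<Longrightarrow> g x = 0"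
  shows "integrable lborel (\<lambda>x. u x * g x)"
proof -
  have [measurable]: "u \<in> borel_measurable borel" using u by (simp add: loc_int_def)
  have "integrable lborel (\<lambda>x. B * (indicator (cball 0 R) x * u x))"
    using u by (simp add: loc_int_def)
  then show ?thesis
  proof (rule Bochner_Integration.integrable_bound)
    have "norm (u x * g x) \<le> norm (B * (indicator (cball 0 R) x * u x))" for x
    proof (cases "norm x > R")
      case False
      have "\<bar>g x\<bar> \<le> \<bar>B\<bar>" using B[of x] by linarith
      then show ?thesis using False by (auto simp: abs_mult mult.commute[of _ "\<bar>u x\<bar>"] intro: mult_left_mono)
    qed (simp add: R)
    then show "AE x in lborel. norm (u x * g x) \<le> norm (B * (indicator (cball 0 R) x * u x))" by simp
  qed measurable
qed

lemma integrable_loc_int_test: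
  assumes "loc_int u" "test_fun \<phi>"
  shows "integrable lborel (\<lambda>x. u x * \<phi> x)"
proof -
  obtain R where R: "R > 0" "\<And>x. norm x > R \<Longrightarrow> \<phi> x = 0" using assms test_fun_iff by blast
  obtain B where B: "\<And>x. \<bar>\<phi> x\<bar> \<le> B" using test_fun_bounded[OF assms(2)] by blast
  show ?thesis by (rule integrable_loc_int_mult[OF assms(1) test_fun_borel[OF assms(2)] B R(2)])
qed

lemma integrable_test: "test_fun \<phi> \<Longrightarrow> integrable lborel \<phi>"
  using integrable_loc_int_test[of "\<lambda>_. 1" \<phi>] loc_int_bounded[of "\<lambda>_. 1" 1] by simp

text \<open>A correlation rather than a convolution: its variation in z is the pairing of \<phi>
  with increments of \<psi>, and with a reflected \<psi> it becomes the usual mollification.\<close>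

definition corr :: "('a::euclidean_space \<Rightarrow> real) \<Rightarrow> ('a \<Rightarrow> real) \<Rightarrow> 'a \<Rightarrow> real" where
  "corr \<phi> \<psi> z = (\<integral>x. \<psi> x * \<phi> (x + z) \<partial>lborel)"

text \<open>The derivative falls on \<phi>, so \<psi> need only be locally integrable: the Taylor
  error of \<phi> is uniformly at most e'|h| and is integrated against \<psi> over one fixed
  ball.\<close>

lemma corr_has_derivative:
  fixes \<psi> :: "'a::euclidean_space \<Rightarrow> real"
  assumes \<psi>: "loc_int \<psi>" and \<phi>: "test_fun \<phi>"
  shows "(corr \<phi> \<psi> has_derivative (\<lambda>h. corr (\<lambda>x. frechet_derivative \<phi> (at x) h) \<psi> z)) (at z)"
proof -
  have s: "smooth_fun \<phi>" using \<phi> test_fun_def by blast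
  have int: "integrable lborel (\<lambda>x. \<psi> x * f (x + z))" if "test_fun f" for f z
    using integrable_loc_int_test[OF \<psi> test_fun_translate[OF that]] .
  have lin: "corr (\<lambda>x. frechet_derivative \<phi> (at x) h) \<psi> z
      = (\<Sum>b\<in>Basis. (h \<bullet> b) * corr (\<lambda>x. frechet_derivative \<phi> (at x) b) \<psi> z)" for h
  proof -
    have "corr (\<lambda>x. frechet_derivative \<phi> (at x) h) \<psi> z
       = (\<integral>x. (\<Sum>b\<in>Basis. (h \<bullet> b) * (\<psi> x * frechet_derivative \<phi> (at (x + z)) b)) \<partial>lborel)"
      unfolding corr_def
      by (subst smooth_fun_fd_sum[OF s]) (simp add: sum_distrib_left algebra_simps)
    also have "\<dots> = (\<Sum>b\<in>Basis. (h \<bullet> b) * corr (\<lambda>x. frechet_derivative \<phi> (at x) b) \<psi> z)"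
      unfolding corr_def
      by (subst Bochner_Integration.integral_sum) (auto intro!: integrable_mult_right int[OF test_fun_dd[OF \<phi>]])
    finally show ?thesis .
  qed
  obtain R where R: "R > 0" "\<And>x. norm x > R \<Longrightarrow> \<phi> x = 0" using \<phi> test_fun_iff by blast
  have R': "\<And>x h. norm x > R \<Longrightarrow> frechet_derivative \<phi> (at x) h = 0"
    using frechet_derivative_zero_outside R(2) by blast
  \<comment> \<open>For |h| < 1 the values of \<phi> at x + z and x + z + h and the derivative term
    all vanish beyond this radius.\<close>
  define S where "S = R + norm z + 1"
  define A where "A = (\<integral>x. \<bar>indicator (cball 0 S) x * \<psi> x\<bar> \<partial>lborel)"
  have intA: "integrable lborel (\<lambda>x. \<bar>indicator (cball 0 S) x * \<psi> x\<bar>)"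
    using \<psi> unfolding loc_int_def by (intro integrable_abs) auto
  have A: "A \<ge> 0" unfolding A_def by simp
  show ?thesis unfolding has_derivative_at_alt
  proof safe
    have "bounded_linear (\<lambda>h. \<Sum>b\<in>Basis. (h \<bullet> b) * corr (\<lambda>x. frechet_derivative \<phi> (at x) b) \<psi> z)"
      by (intro bounded_linear_sum bounded_linear_mult_const bounded_linear_inner_left)
    then show "bounded_linear (\<lambda>h. corr (\<lambda>x. frechet_derivative \<phi> (at x) h) \<psi> z)"
      by (rule back_subst[of bounded_linear]) (rule ext, rule lin[symmetric])
    fix e :: real assume e: "e > 0"
    \<comment> \<open>A + 1 instead of A, as A may be 0.\<close>
    define e' where "e' = e / (A + 1)"
    have e': "e' > 0" using e A by (simp add: e'_def)
    obtain d where d: "d > 0" "\<And>x h. norm h < d \<Longrightarrow> \<bar>\<phi> (x + h) - \<phi> x - frechet_derivative \<phi> (at x) h\<bar> \<le> e' * norm h"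
      using test_fun_uniform_derivative[OF \<phi> e'] by blast
    have "norm (corr \<phi> \<psi> y - corr \<phi> \<psi> z - corr (\<lambda>x. frechet_derivative \<phi> (at x) (y - z)) \<psi> z) \<le> e * norm (y - z)"
      if y: "norm (y - z) < min d 1" for y
    proof -
      define h where "h = y - z"
      define r where "r x = \<phi> (x + z + h) - \<phi> (x + z) - frechet_derivative \<phi> (at (x + z)) h" for x
      have rb: "\<bar>r x\<bar> \<le> e' * norm h" for x using d(2)[of h "x + z"] y by (simp add: r_def h_def)
      have r0: "r x = 0" if "norm x > S" for x
      proof -
        have "norm (x + z + h) > R" "norm (x + z) > R"
          using that y norm_triangle_ineq4[of "x + z + h" "z + h"] norm_triangle_ineq4[of "x + z" z] norm_triangle_ineq[of z h]
          by (auto simp: S_def h_def algebra_simps)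
        then show ?thesis by (simp add: r_def R R')
      qed
      have "corr \<phi> \<psi> y - corr \<phi> \<psi> z - corr (\<lambda>x. frechet_derivative \<phi> (at x) (y - z)) \<psi> z
         = (\<integral>x. \<psi> x * \<phi> (x + y) - \<psi> x * \<phi> (x + z) - \<psi> x * frechet_derivative \<phi> (at (x + z)) (y - z) \<partial>lborel)"
        unfolding corr_def using int[OF \<phi>] int[OF test_fun_dd[OF \<phi>]] by simp
      also have "\<dots> = (\<integral>x. \<psi> x * r x \<partial>lborel)"
        by (intro Bochner_Integration.integral_cong) (auto simp: r_def h_def algebra_simps)
      finally have eq: "corr \<phi> \<psi> y - corr \<phi> \<psi> z - corr (\<lambda>x. frechet_derivative \<phi> (at x) (y - z)) \<psi> z
         = (\<integral>x. \<psi> x * r x \<partial>lborel)" .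
      have "\<bar>\<integral>x. \<psi> x * r x \<partial>lborel\<bar> \<le> (\<integral>x. \<bar>\<psi> x * r x\<bar> \<partial>lborel)"
        by (rule integral_abs_bound)
      also have "\<dots> \<le> (\<integral>x. e' * norm h * \<bar>indicator (cball 0 S) x * \<psi> x\<bar> \<partial>lborel)"
      proof (rule integral_mono')
        show "integrable lborel (\<lambda>x. e' * norm h * \<bar>indicator (cball 0 S) x * \<psi> x\<bar>)" using intA by simp
        show "\<bar>\<psi> x * r x\<bar> \<le> e' * norm h * \<bar>indicator (cball 0 S) x * \<psi> x\<bar>" for x
          using mult_left_mono[OF rb[of x], of "\<bar>\<psi> x\<bar>"] r0[of x]
          by (cases "norm x > S") (auto simp: abs_mult algebra_simps)
      qed (use e' in auto)
      also have "\<dots> = e' * norm h * A" unfolding A_def by simp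
      also have "\<dots> \<le> e * norm h"
      proof -
        have "e' * A \<le> e" using e A by (simp add: e'_def field_simps)
        then show ?thesis using mult_right_mono[of "e' * A" e "norm h"] by (simp add: algebra_simps)
      qed
      finally show ?thesis unfolding eq by (simp add: h_def)
    qed
    then show "\<exists>d>0. \<forall>y. norm (y - z) < d \<longrightarrow>
       norm (corr \<phi> \<psi> y - corr \<phi> \<psi> z - corr (\<lambda>x. frechet_derivative \<phi> (at x) (y - z)) \<psi> z) \<le> e * norm (y - z)"
      using d(1) by (intro exI[of _ "min d 1"]) auto
  qed
qed

lemma corr_test_fun:
  fixes \<psi> :: "'a::euclidean_space \<Rightarrow> real"
  assumes \<psi>: "loc_int \<psi>" "\<And>x. norm x > S \<Longrightarrow> \<psi> x = 0" "S > 0" and \<phi>: "test_fun \<phi>"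
    and R: "\<And>x. norm x > R \<Longrightarrow> \<phi> x = 0" "R > 0"
  shows "test_fun (corr \<phi> \<psi>)" "norm z > S + R \<Longrightarrow> corr \<phi> \<psi> z = 0"
proof -
  have z: "corr \<phi> \<psi> z = 0" if "norm z > S + R" for z
  proof -
    have "\<psi> x * \<phi> (x + z) = 0" for x
    proof (cases "norm x > S")
      case False
      then have "norm (x + z) > R" using that norm_triangle_ineq4[of "x + z" x] by simp
      then show ?thesis using R by simp
    qed (simp add: \<psi>)
    then have eq: "(\<lambda>x. \<psi> x * \<phi> (x + z)) = (\<lambda>x. 0)" by blast
    show ?thesis unfolding corr_def by (subst eq) simp
  qed
  have it: "iter_dd vs (corr \<phi> \<psi>) = corr (iter_dd vs \<phi>) \<psi>" for vs
  proof (induction vs)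
    case (Cons v vs)
    show ?case
      using corr_has_derivative[OF \<psi>(1) test_fun_iter_dd[OF \<phi>, of vs], THEN frechet_derivative_at]
      by (simp add: Cons fun_eq_iff)
  qed simp
  have "smooth_fun (corr \<phi> \<psi>)"
    unfolding smooth_fun_def it
    using corr_has_derivative[OF \<psi>(1) test_fun_iter_dd[OF \<phi>]] differentiable_def by blast
  then show "test_fun (corr \<phi> \<psi>)"
    unfolding test_fun_iff using z \<psi>(3) R(2) by (intro conjI exI[of _ "S + R"]) auto
  show "norm z > S + R \<Longrightarrow> corr \<phi> \<psi> z = 0" using z .
qed

lemma mollifier_exists:
  assumes r: "r > 0"
  shows "\<exists>\<eta>::'a::euclidean_space \<Rightarrow> real. test_fun \<eta> \<and> (\<forall>x. \<eta> x \<ge> 0) \<and> (\<forall>x. norm x \<ge> r \<longrightarrow> \<eta> x = 0)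
     \<and> integral\<^sup>L lborel \<eta> = 1"
proof -
  let ?b = "bump (r\<^sup>2) 1 :: 'a \<Rightarrow> real"
  have t: "test_fun (\<lambda>x. c * ?b x)" for c by (rule test_fun_cmult_bump) simp
  have i: "integrable lborel ?b" using integrable_test[OF t[of 1]] by simp
  have "integral\<^sup>L lborel ?b \<noteq> 0"
  proof
    assume "integral\<^sup>L lborel ?b = 0"
    then have "AE x in lborel. ?b x = 0"
      using integral_nonneg_eq_0_iff_AE[OF i] bump_nonneg by auto
    then have "AE x in lborel. x \<notin> ball (0::'a) r"
      by eventually_elim (use bump_pos in force)
    then have "emeasure lborel (ball (0::'a) r) = 0"
      by (subst (asm) AE_iff_measurable[OF _ refl]) (auto simp: ball_def)
    then show False using r emeasure_lborel_ball_finite content_ball_pos[of r "0::'a"] by (simp add: measure_def)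
  qed
  then show ?thesis
    using t[of "1 / integral\<^sup>L lborel ?b"] bump_nonneg bump_zero[OF r] i
    by (intro exI[of _ "\<lambda>x. 1 / integral\<^sup>L lborel ?b * ?b x"]) (auto intro!: divide_nonneg_nonneg integral_nonneg)
qed

text \<open>Mollification converges in L^1 by continuity of translations, and a subsequence
  converges almost everywhere. The common bound M and the common support are kept so that dominated
  convergence applies against any locally integrable function.\<close>

lemma test_fun_approx:
  fixes \<psi> :: "'a::euclidean_space \<Rightarrow> real"
  assumes [measurable]: "\<psi> \<in> borel_measurable borel" and M: "\<And>x. \<bar>\<psi> x\<bar> \<le> M"
    and R: "\<And>x. norm x > R \<Longrightarrow> \<psi> x = 0" "R > 0"
  shows "\<exists>\<phi>::nat \<Rightarrow> 'a \<Rightarrow> real. (\<forall>n. test_fun (\<phi> n)) \<and> (\<forall>n x. \<bar>\<phi> n x\<bar> \<le> M) \<and>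
    (\<forall>n x. norm x > R + 1 \<longrightarrow> \<phi> n x = 0) \<and> (AE x in lborel. (\<lambda>n. \<phi> n x) \<longlonglongrightarrow> \<psi> x)"
proof -
  have L\<psi>: "loc_int \<psi>" by (rule loc_int_bounded[OF assms(1) M])
  have "integrable lborel (\<lambda>x. 1 * \<psi> x)"
    by (rule integrable_loc_int_mult[OF loc_int_bounded _ M R(1)]) auto
  then have I\<psi>: "integrable lborel \<psi>" by simp
  have "Lpow 1 \<psi> < \<infinity>" using I\<psi> unfolding Lpow_def integrable_iff_bounded by simp
  then have lim: "(tdiff 1 \<psi> \<longlongrightarrow> 0) (nhds 0)" by (intro tdiff_tendsto_zero) auto
  \<comment> \<open>The mollification radii are read off from the modulus of continuity of
    translations, so that the n-th error is at most 1/(n + 1); r <= 1 keeps the supports within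
    radius R + 1.\<close>
  have "\<exists>r>0. r \<le> 1 \<and> (\<forall>h. norm h < r \<longrightarrow> tdiff 1 \<psi> h < ennreal (1 / real (Suc n)))" for n
  proof -
    have "\<forall>\<^sub>F h in nhds 0. tdiff 1 \<psi> h < ennreal (1 / real (Suc n))"
      by (rule order_tendstoD(2)[OF lim]) simp
    then obtain d where "d > 0" "\<And>h. dist h 0 < d \<Longrightarrow> tdiff 1 \<psi> h < ennreal (1 / real (Suc n))"
      unfolding eventually_nhds_metric by blast
    then show ?thesis by (intro exI[of _ "min d 1"]) auto
  qed
  then obtain r where r: "\<And>n. r n > 0" "\<And>n. r n \<le> 1"
     "\<And>n h. norm h < r n \<Longrightarrow> tdiff 1 \<psi> h < ennreal (1 / real (Suc n))" by metis
  obtain \<eta> :: "nat \<Rightarrow> 'a \<Rightarrow> real" where \<eta>: "\<And>n. test_fun (\<eta> n)" "\<And>n x. \<eta> n x \<ge> 0" "\<And>n x. norm x \<ge> r n \<Longrightarrow> \<eta> n x = 0"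
     "\<And>n. integral\<^sup>L lborel (\<eta> n) = 1"
  proof -
    have "\<forall>n. \<exists>\<eta>::'a \<Rightarrow> real. test_fun \<eta> \<and> (\<forall>x. \<eta> x \<ge> 0) \<and> (\<forall>x. norm x \<ge> r n \<longrightarrow> \<eta> x = 0)
     \<and> integral\<^sup>L lborel \<eta> = 1" using mollifier_exists r(1) by blast
    then show ?thesis using that by metis
  qed
  note [measurable] = test_fun_borel[OF \<eta>(1)]
  have I\<eta>: "integrable lborel (\<eta> n)" for n using \<eta>(1) by (rule integrable_test)
  have N\<eta>: "(\<integral>\<^sup>+x. ennreal (\<eta> n x) \<partial>lborel) = 1" for n
    using nn_integral_eq_integral[OF I\<eta>, of n] \<eta> by simp
  define \<phi> where "\<phi> n = corr (\<eta> n) (\<lambda>x. \<psi> (- x))" for n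
  have L': "loc_int (\<lambda>x. \<psi> (- x))" by (rule loc_int_bounded[of _ M]) (use M in auto)
  have conv: "\<phi> n z = (\<integral>y. \<psi> (z - y) * \<eta> n y \<partial>lborel)" for n z
    unfolding \<phi>_def corr_def
    by (subst integral_lborel_translate[symmetric, where a = "- z"]) auto
  have tf: "test_fun (\<phi> n)" "norm z > R + 1 \<Longrightarrow> \<phi> n z = 0" for n z
    unfolding \<phi>_def
    by (rule corr_test_fun[OF L' _ R(2) \<eta>(1) \<eta>(3), of 1]; use R r(2)[of n] in \<open>auto intro: \<eta>(3)\<close>)+
  have I1: "integrable lborel (\<lambda>y. \<psi> (z - y) * \<eta> n y)" for n z
    by (rule integrable_loc_int_test[OF loc_int_bounded[of _ M] \<eta>(1)]) (use M in auto)
  have M0: "M \<ge> 0" using M[of 0] by linarith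
  have bd: "\<bar>\<phi> n z\<bar> \<le> M" for n z
  proof -
    have "\<bar>\<phi> n z\<bar> \<le> (\<integral>y. \<bar>\<psi> (z - y) * \<eta> n y\<bar> \<partial>lborel)" unfolding conv by (rule integral_abs_bound)
    also have "\<dots> \<le> (\<integral>y. M * \<eta> n y \<partial>lborel)"
      by (rule integral_mono') (use I\<eta> M M0 \<eta>(2) in \<open>auto simp: abs_mult intro!: mult_right_mono\<close>)
    also have "\<dots> = M" using \<eta>(4) by simp
    finally show ?thesis .
  qed
  have I\<phi>: "integrable lborel (\<lambda>x. \<phi> n x - \<psi> x)" for n
    using integrable_test[OF tf(1)] I\<psi> by auto
  have L1: "(\<integral>\<^sup>+z. ennreal \<bar>\<phi> n z - \<psi> z\<bar> \<partial>lborel) \<le> ennreal (1 / real (Suc n))" for n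
  proof -
    have "ennreal \<bar>\<phi> n z - \<psi> z\<bar> \<le> (\<integral>\<^sup>+y. ennreal (\<bar>\<psi> (z - y) - \<psi> z\<bar> * \<eta> n y) \<partial>lborel)" for z
    proof -
      have "\<phi> n z - \<psi> z = (\<integral>y. \<psi> (z - y) * \<eta> n y \<partial>lborel) - (\<integral>y. \<psi> z * \<eta> n y \<partial>lborel)"
        unfolding conv using \<eta>(4) by simp
      also have "\<dots> = (\<integral>y. (\<psi> (z - y) - \<psi> z) * \<eta> n y \<partial>lborel)"
        using I1 I\<eta> by (subst Bochner_Integration.integral_diff[symmetric]) (auto simp: algebra_simps)
      finally have "\<phi> n z - \<psi> z = (\<integral>y. (\<psi> (z - y) - \<psi> z) * \<eta> n y \<partial>lborel)" .
      moreover have "integrable lborel (\<lambda>y. (\<psi> (z - y) - \<psi> z) * \<eta> n y)"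
        using I1[of z n] I\<eta>[of n] by (auto simp: left_diff_distrib)
      ultimately show ?thesis
        using integral_norm_bound_ennreal[of lborel "\<lambda>y. (\<psi> (z - y) - \<psi> z) * \<eta> n y"] \<eta>(2)
        by (simp add: abs_mult)
    qed
    then have "(\<integral>\<^sup>+z. ennreal \<bar>\<phi> n z - \<psi> z\<bar> \<partial>lborel)
        \<le> (\<integral>\<^sup>+z. \<integral>\<^sup>+y. ennreal (\<bar>\<psi> (z - y) - \<psi> z\<bar> * \<eta> n y) \<partial>lborel \<partial>lborel)"
      by (rule nn_integral_mono)
    \<comment> \<open>Exchanging the integrals turns the L^1 error into an average of T(-y) over the
      support of the mollifier.\<close>
    also have "\<dots> = (\<integral>\<^sup>+y. \<integral>\<^sup>+z. ennreal (\<bar>\<psi> (z - y) - \<psi> z\<bar> * \<eta> n y) \<partial>lborel \<partial>lborel)"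
      by (rule lborel_pair.Fubini') measurable
    also have "\<dots> = (\<integral>\<^sup>+y. ennreal (\<eta> n y) * tdiff 1 \<psi> (- y) \<partial>lborel)"
      unfolding tdiff_def Lpow_def using \<eta>(2)
      by (subst nn_integral_cmult[symmetric]) (auto simp: ennreal_mult mult.commute)
    also have "\<dots> \<le> (\<integral>\<^sup>+y. ennreal (\<eta> n y) * ennreal (1 / real (Suc n)) \<partial>lborel)"
    proof (rule nn_integral_mono)
      fix y
      show "ennreal (\<eta> n y) * tdiff 1 \<psi> (- y) \<le> ennreal (\<eta> n y) * ennreal (1 / real (Suc n))"
        using r(3)[of "- y" n] \<eta>(3)[where n=n and x=y]
        by (cases "norm y < r n") (auto intro!: mult_left_mono simp: less_imp_le)
    qed
    also have "\<dots> = ennreal (1 / real (Suc n))"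
      by (subst nn_integral_multc) (auto simp: N\<eta>)
    finally show ?thesis .
  qed
  have "(\<lambda>n. \<integral>x. norm (\<phi> n x - \<psi> x) \<partial>lborel) \<longlonglongrightarrow> 0"
  proof (rule tendsto_sandwich[OF _ _ tendsto_const LIMSEQ_inverse_real_of_nat])
    show "\<forall>\<^sub>F n in sequentially. (\<integral>x. norm (\<phi> n x - \<psi> x) \<partial>lborel) \<le> inverse (real (Suc n))"
    proof (rule always_eventually, rule allI)
      fix n
      have "ennreal (\<integral>x. norm (\<phi> n x - \<psi> x) \<partial>lborel) \<le> ennreal (1 / real (Suc n))"
        using L1[of n] by (subst nn_integral_eq_integral[symmetric]) (use I\<phi> in auto)
      then show "(\<integral>x. norm (\<phi> n x - \<psi> x) \<partial>lborel) \<le> inverse (real (Suc n))"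
        by (subst (asm) ennreal_le_iff) (auto simp: divide_inverse)
    qed
  qed auto
  from tendsto_L1_AE_subseq[OF I\<phi> this] obtain s where
    s: "strict_mono s" "AE x in lborel. (\<lambda>n. \<phi> (s n) x - \<psi> x) \<longlonglongrightarrow> 0" by blast
  have "AE x in lborel. (\<lambda>n. \<phi> (s n) x) \<longlonglongrightarrow> \<psi> x"
    using s(2) by eventually_elim (simp add: LIM_zero_iff)
  then show ?thesis
    using tf bd by (intro exI[of _ "\<lambda>n. \<phi> (s n)"]) auto
qed

section \<open>Directional energies as suprema of difference quotients\<close>

lemma integral_loc_int_tendsto:
  fixes f \<psi> :: "'a::euclidean_space \<Rightarrow> real"
  assumes f: "loc_int f" and [measurable]: "\<And>n. \<phi> n \<in> borel_measurable borel" "\<psi> \<in> borel_measurable borel"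
    and B: "\<And>n x. \<bar>\<phi> n x\<bar> \<le> B" and R: "\<And>n x. norm x > R \<Longrightarrow> \<phi> n x = 0"
    and lim: "AE x in lborel. (\<lambda>n. \<phi> n x) \<longlonglongrightarrow> \<psi> x"
  shows "(\<lambda>n. \<integral>x. f x * \<phi> n x \<partial>lborel) \<longlonglongrightarrow> (\<integral>x. f x * \<psi> x \<partial>lborel)"
proof (rule integral_dominated_convergence[where w = "\<lambda>x. B * \<bar>indicator (cball 0 R) x * f x\<bar>"])
  have [measurable]: "f \<in> borel_measurable borel" using f by (simp add: loc_int_def)
  show "(\<lambda>x. f x * \<psi> x) \<in> borel_measurable lborel" "\<And>n. (\<lambda>x. f x * \<phi> n x) \<in> borel_measurable lborel"
    by measurable
  show "integrable lborel (\<lambda>x. B * \<bar>indicator (cball 0 R) x * f x\<bar>)"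
    using f by (auto simp: loc_int_def)
  show "AE x in lborel. (\<lambda>n. f x * \<phi> n x) \<longlonglongrightarrow> f x * \<psi> x"
    using lim by eventually_elim (intro tendsto_intros)
  show "AE x in lborel. norm (f x * \<phi> n x) \<le> B * \<bar>indicator (cball 0 R) x * f x\<bar>" for n
  proof (rule AE_I2)
    fix x
    show "norm (f x * \<phi> n x) \<le> B * \<bar>indicator (cball 0 R) x * f x\<bar>"
      using mult_left_mono[OF B[of n x], of "\<bar>f x\<bar>"] R[of x n]
      by (cases "norm x > R") (auto simp: abs_mult mult.commute)
  qed
qed

lemma integrable_bounded_support:
  fixes g :: "'a::euclidean_space \<Rightarrow> real"
  assumes "g \<in> borel_measurable borel" "\<And>x. \<bar>g x\<bar> \<le> B" "\<And>x. norm x > R \<Longrightarrow> g x = 0"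
  shows "integrable lborel g"
proof -
  have "integrable lborel (\<lambda>x. 1 * g x)"
    by (rule integrable_loc_int_mult[OF loc_int_bounded[of _ 1]]) (use assms in auto)
  then show ?thesis by simp
qed

lemma test_fun_powr:
  assumes t: "test_fun \<phi>" and q: "q > 0"
  shows "integrable lborel (\<lambda>x. \<bar>\<phi> x\<bar> powr q)"
proof -
  obtain R where R: "R > 0" "\<And>x. norm x > R \<Longrightarrow> \<phi> x = 0" using t test_fun_iff by blast
  obtain B where B: "\<And>x. \<bar>\<phi> x\<bar> \<le> B" using test_fun_bounded[OF t] by blast
  note [measurable] = test_fun_borel[OF t]
  show ?thesis
  proof (rule integrable_bounded_support)
    show "\<bar>\<bar>\<phi> x\<bar> powr q\<bar> \<le> B powr q" for x using B[of x] q by (simp add: powr_mono2)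
    show "norm x > R \<Longrightarrow> \<bar>\<phi> x\<bar> powr q = 0" for x using R by simp
  qed measurable
qed

text \<open>Young's inequality multiplied by p. Equality holds at b = sgn(a)|a|^(p-1), so the
  duality built on it loses nothing.\<close>

lemma young_powr:
  fixes a b p :: real assumes p: "p > 1"
  shows "p * (a * b) \<le> \<bar>a\<bar> powr p + (p - 1) * \<bar>b\<bar> powr (p / (p - 1))"
proof -
  define q where "q = p / (p - 1)"
  have q: "q > 1" "1 / p + 1 / q = 1" using p by (auto simp: q_def field_simps)
  have "a * b \<le> \<bar>a\<bar> * \<bar>b\<bar>" by (metis abs_ge_self abs_mult)
  also have "\<dots> \<le> \<bar>a\<bar> powr p / p + \<bar>b\<bar> powr q / q"
    by (rule Youngs_inequality) (use p q in auto)
  finally have "p * (a * b) \<le> p * (\<bar>a\<bar> powr p / p + \<bar>b\<bar> powr q / q)" using p by simp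
  also have "\<dots> = \<bar>a\<bar> powr p + (p - 1) * \<bar>b\<bar> powr q" using p by (simp add: q_def field_simps)
  finally show ?thesis by (simp add: q_def)
qed

text \<open>Hoelder in penalised form: a bound K on the p-th power is encoded by inequalities that
  are linear in f, without roots, and these survive limits of f. \<open>Lpow_le_duality_gt1\<close>
  is the converse.\<close>

lemma pairing_le_gt1:
  fixes f :: "'a::euclidean_space \<Rightarrow> real"
  assumes [measurable]: "f \<in> borel_measurable borel" and p: "p > 1" and K: "Lpow p f \<le> ennreal K" "K \<ge> 0"
    and t: "test_fun \<phi>"
  shows "p * (\<integral>x. f x * \<phi> x \<partial>lborel) \<le> K + (p - 1) * (\<integral>x. \<bar>\<phi> x\<bar> powr (p / (p - 1)) \<partial>lborel)"
proof -
  have fin: "Lpow p f < \<infinity>" using K(1) by (rule order.strict_trans1) simp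
  have i1: "integrable lborel (\<lambda>x. \<bar>f x\<bar> powr p)"
    using fin by (intro integrableI_bounded) (auto simp: Lpow_def)
  have i2: "integrable lborel (\<lambda>x. \<bar>\<phi> x\<bar> powr (p / (p - 1)))" using test_fun_powr[OF t] p by simp
  have i3: "integrable lborel (\<lambda>x. f x * \<phi> x)"
    using integrable_loc_int_test[OF loc_int_Lpow[OF _ _ fin] t] p by simp
  have "p * (\<integral>x. f x * \<phi> x \<partial>lborel) = (\<integral>x. p * (f x * \<phi> x) \<partial>lborel)" by simp
  also have "\<dots> \<le> (\<integral>x. \<bar>f x\<bar> powr p + (p - 1) * \<bar>\<phi> x\<bar> powr (p / (p - 1)) \<partial>lborel)"
    by (rule integral_mono) (use i1 i2 i3 young_powr[OF p] in auto)
  also have "\<dots> = (\<integral>x. \<bar>f x\<bar> powr p \<partial>lborel) + (p - 1) * (\<integral>x. \<bar>\<phi> x\<bar> powr (p / (p - 1)) \<partial>lborel)"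
    using i1 i2 by simp
  also have "(\<integral>x. \<bar>f x\<bar> powr p \<partial>lborel) \<le> K"
    using K nn_integral_eq_integral[OF i1] by (simp add: Lpow_def)
  finally show ?thesis by simp
qed

lemma pairing_le_1:
  fixes f :: "'a::euclidean_space \<Rightarrow> real"
  assumes [measurable]: "f \<in> borel_measurable borel" and K: "Lpow 1 f \<le> ennreal K" "K \<ge> 0"
    and t: "test_fun \<phi>" "\<And>x. \<bar>\<phi> x\<bar> \<le> 1"
  shows "(\<integral>x. f x * \<phi> x \<partial>lborel) \<le> K"
proof -
  have fin: "Lpow 1 f < \<infinity>" using K(1) by (rule order.strict_trans1) simp
  have i1: "integrable lborel (\<lambda>x. \<bar>f x\<bar>)"
    using fin by (intro integrableI_bounded) (auto simp: Lpow_def)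
  have i3: "integrable lborel (\<lambda>x. f x * \<phi> x)"
    using integrable_loc_int_test[OF loc_int_Lpow[OF _ _ fin] t(1)] by simp
  have le: "f x * \<phi> x \<le> \<bar>f x\<bar>" for x
  proof -
    have "f x * \<phi> x \<le> \<bar>f x\<bar> * \<bar>\<phi> x\<bar>" by (metis abs_ge_self abs_mult)
    also have "\<dots> \<le> \<bar>f x\<bar> * 1" by (rule mult_left_mono) (use t(2) in auto)
    finally show ?thesis by simp
  qed
  have "(\<integral>x. f x * \<phi> x \<partial>lborel) \<le> (\<integral>x. \<bar>f x\<bar> \<partial>lborel)"
    by (rule integral_mono) (use i1 i3 le in auto)
  also have "\<dots> \<le> K"
    using K nn_integral_eq_integral[OF i1] by (simp add: Lpow_def)
  finally show ?thesis .
qed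

text \<open>Fatou along the truncations. Finiteness of the energy is part of the conclusion, while
  duality can only test with bounded functions of bounded support.\<close>

lemma Lpow_le_truncation:
  fixes f :: "'a::euclidean_space \<Rightarrow> real"
  assumes [measurable]: "f \<in> borel_measurable borel"
    and trunc: "\<And>M::nat. M > 0 \<Longrightarrow>
        (\<integral>x. \<bar>f x\<bar> powr p * indicator {x. norm x \<le> real M \<and> \<bar>f x\<bar> \<le> real M} x \<partial>lborel) \<le> K"
    and p: "p \<ge> 1"
  shows "Lpow p f \<le> ennreal K"
proof -
  \<comment> \<open>\<open>Suc M\<close>, because the bound is assumed for positive M.\<close>
  define g where "g M x = \<bar>f x\<bar> powr p * indicator {x. norm x \<le> real (Suc M) \<and> \<bar>f x\<bar> \<le> real (Suc M)} x" for M :: nat and x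
  have [measurable]: "g M \<in> borel_measurable borel" for M unfolding g_def by measurable
  have le: "(\<integral>\<^sup>+x. ennreal (g M x) \<partial>lborel) \<le> ennreal K" for M
  proof -
    have "integrable lborel (g M)"
    proof (rule integrable_bounded_support)
      show "\<bar>g M x\<bar> \<le> real (Suc M) powr p" for x
        using p by (auto simp: g_def split: split_indicator intro: powr_mono2)
      show "norm x > real (Suc M) \<Longrightarrow> g M x = 0" for x by (simp add: g_def)
    qed measurable
    then have "(\<integral>\<^sup>+x. ennreal (g M x) \<partial>lborel) = ennreal (\<integral>x. g M x \<partial>lborel)"
      by (rule nn_integral_eq_integral) (simp add: g_def)
    also have "\<dots> \<le> ennreal K" using trunc[of "Suc M"] by (intro ennreal_leI) (simp add: g_def)
    finally show ?thesis .
  qed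
  have "Lpow p f \<le> (\<integral>\<^sup>+x. liminf (\<lambda>M. ennreal (g M x)) \<partial>lborel)"
    unfolding Lpow_def
  proof (rule nn_integral_mono)
    fix x
    obtain N :: nat where N: "max (norm x) \<bar>f x\<bar> \<le> real N" using real_arch_simple by blast
    have "\<forall>\<^sub>F M in sequentially. g M x = \<bar>f x\<bar> powr p"
      using eventually_ge_at_top[of N] by eventually_elim (use N in \<open>auto simp: g_def indicator_def\<close>)
    then have "(\<lambda>M. ennreal (g M x)) \<longlonglongrightarrow> ennreal (\<bar>f x\<bar> powr p)"
      by (intro tendsto_eventually) (auto elim: eventually_mono)
    then show "ennreal (\<bar>f x\<bar> powr p) \<le> liminf (\<lambda>M. ennreal (g M x))"
      by (simp add: lim_imp_Liminf)
  qed
  also have "\<dots> \<le> liminf (\<lambda>M. \<integral>\<^sup>+x. ennreal (g M x) \<partial>lborel)"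
    by (rule nn_integral_liminf) measurable
  also have "\<dots> \<le> liminf (\<lambda>M::nat. ennreal K)"
    by (rule Liminf_mono) (use le in simp)
  also have "\<dots> = ennreal K" by (simp add: Liminf_const)
  finally show ?thesis .
qed

lemma Lpow_le_duality_gt1:
  fixes f :: "'a::euclidean_space \<Rightarrow> real"
  assumes f: "loc_int f" and p: "p > 1"
    and dual: "\<And>\<phi>. test_fun \<phi> \<Longrightarrow>
       p * (\<integral>x. f x * \<phi> x \<partial>lborel) \<le> K + (p - 1) * (\<integral>x. \<bar>\<phi> x\<bar> powr (p / (p - 1)) \<partial>lborel)"
  shows "Lpow p f \<le> ennreal K"
proof (rule Lpow_le_truncation)
  show [measurable]: "f \<in> borel_measurable borel" using f by (simp add: loc_int_def)
  show "p \<ge> 1" using p by simp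
  fix M :: nat assume M: "M > 0"
  define q where "q = p / (p - 1)"
  have q: "q > 0" using p by (simp add: q_def)
  define E where "E = {x. norm x \<le> real M \<and> \<bar>f x\<bar> \<le> real M}"
  have [measurable]: "E \<in> sets borel" unfolding E_def by measurable
  define B where "B = real M powr (p - 1)"
  \<comment> \<open>The extremal function of Young's inequality, cut off to E. It is not smooth, so
    the hypothesis is applied to test functions approximating it.\<close>
  define \<psi> where "\<psi> x = sgn (f x) * \<bar>f x\<bar> powr (p - 1) * indicator E x" for x
  have [measurable]: "\<psi> \<in> borel_measurable borel" unfolding \<psi>_def by measurable
  have \<psi>B: "\<bar>\<psi> x\<bar> \<le> B" for x
    using p by (auto simp: \<psi>_def B_def E_def abs_mult abs_sgn_eq split: split_indicator intro: powr_mono2)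
  obtain \<phi> where \<phi>: "\<And>n. test_fun (\<phi> n)" "\<And>n x. \<bar>\<phi> n x\<bar> \<le> B" "\<And>n x. norm x > real M + 1 \<Longrightarrow> \<phi> n x = 0"
     "AE x in lborel. (\<lambda>n. \<phi> n x) \<longlonglongrightarrow> \<psi> x"
    using test_fun_approx[of \<psi> B "real M"] \<psi>B M by (auto simp: \<psi>_def E_def)
  note [measurable] = test_fun_borel[OF \<phi>(1)]
  have l1: "(\<lambda>n. \<integral>x. f x * \<phi> n x \<partial>lborel) \<longlonglongrightarrow> (\<integral>x. f x * \<psi> x \<partial>lborel)"
    by (rule integral_loc_int_tendsto[OF f _ _ \<phi>(2-4)]) auto
  have l2: "(\<lambda>n. \<integral>x. 1 * \<bar>\<phi> n x\<bar> powr q \<partial>lborel) \<longlonglongrightarrow> (\<integral>x. 1 * \<bar>\<psi> x\<bar> powr q \<partial>lborel)"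
  proof (rule integral_loc_int_tendsto[of _ _ _ "B powr q" "real M + 1"])
    show "loc_int (\<lambda>_. 1 :: real)" by (rule loc_int_bounded[of _ 1]) auto
    show "\<bar>\<bar>\<phi> n x\<bar> powr q\<bar> \<le> B powr q" for n x using \<phi>(2) q by (simp add: powr_mono2)
    show "norm x > real M + 1 \<Longrightarrow> \<bar>\<phi> n x\<bar> powr q = 0" for n x using \<phi>(3) by simp
    show "AE x in lborel. (\<lambda>n. \<bar>\<phi> n x\<bar> powr q) \<longlonglongrightarrow> \<bar>\<psi> x\<bar> powr q"
      using \<phi>(4)
      by eventually_elim (rule tendsto_powr'[OF tendsto_rabs tendsto_const], use q in auto)
  qed measurable
  have "p * (\<integral>x. f x * \<psi> x \<partial>lborel) \<le> K + (p - 1) * (\<integral>x. \<bar>\<psi> x\<bar> powr q \<partial>lborel)"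
  proof (rule LIMSEQ_le)
    show "(\<lambda>n. p * (\<integral>x. f x * \<phi> n x \<partial>lborel)) \<longlonglongrightarrow> p * (\<integral>x. f x * \<psi> x \<partial>lborel)"
      by (intro tendsto_mult tendsto_const l1)
    show "(\<lambda>n. K + (p - 1) * (\<integral>x. \<bar>\<phi> n x\<bar> powr q \<partial>lborel)) \<longlonglongrightarrow> K + (p - 1) * (\<integral>x. \<bar>\<psi> x\<bar> powr q \<partial>lborel)"
      using l2 by (intro tendsto_add tendsto_mult tendsto_const) simp
    show "\<exists>N. \<forall>n\<ge>N. p * (\<integral>x. f x * \<phi> n x \<partial>lborel) \<le> K + (p - 1) * (\<integral>x. \<bar>\<phi> n x\<bar> powr q \<partial>lborel)"
      using dual[OF \<phi>(1)] by (auto simp: q_def)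
  qed
  \<comment> \<open>Both integrals now equal the truncated energy I, and the inequality above reads
    p I <= K + (p - 1) I.\<close>
  moreover have "f x * \<psi> x = \<bar>f x\<bar> powr p * indicator E x" for x
  proof -
    have "f x * sgn (f x) = \<bar>f x\<bar>" by (simp add: abs_sgn)
    then have "f x * \<psi> x = \<bar>f x\<bar> * \<bar>f x\<bar> powr (p - 1) * indicator E x" by (simp add: \<psi>_def)
    also have "\<bar>f x\<bar> * \<bar>f x\<bar> powr (p - 1) = \<bar>f x\<bar> powr p"
      by (cases "f x = 0") (auto simp: powr_diff)
    finally show ?thesis .
  qed
  moreover have "\<bar>\<psi> x\<bar> powr q = \<bar>f x\<bar> powr p * indicator E x" for x
    using p by (auto simp: \<psi>_def abs_mult abs_sgn_eq powr_powr q_def split: split_indicator)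
  ultimately show "(\<integral>x. \<bar>f x\<bar> powr p * indicator {x. norm x \<le> real M \<and> \<bar>f x\<bar> \<le> real M} x \<partial>lborel) \<le> K"
    unfolding E_def by (simp add: algebra_simps)
qed

text \<open>For p = 1 the extremal function is the sign of f on the truncation set, and the penalty
  becomes the constraint |\<phi>| <= 1.\<close>

lemma Lpow_le_duality_1:
  fixes f :: "'a::euclidean_space \<Rightarrow> real"
  assumes f: "loc_int f"
    and dual: "\<And>\<phi>. test_fun \<phi> \<Longrightarrow> (\<And>x. \<bar>\<phi> x\<bar> \<le> 1) \<Longrightarrow> (\<integral>x. f x * \<phi> x \<partial>lborel) \<le> K"
  shows "Lpow 1 f \<le> ennreal K"
proof (rule Lpow_le_truncation)
  show [measurable]: "f \<in> borel_measurable borel" using f by (simp add: loc_int_def)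
  fix M :: nat assume M: "M > 0"
  define E where "E = {x. norm x \<le> real M \<and> \<bar>f x\<bar> \<le> real M}"
  have [measurable]: "E \<in> sets borel" unfolding E_def by measurable
  define \<psi> where "\<psi> x = sgn (f x) * indicator E x" for x
  have [measurable]: "\<psi> \<in> borel_measurable borel" unfolding \<psi>_def by measurable
  have \<psi>B: "\<bar>\<psi> x\<bar> \<le> 1" for x
    by (auto simp: \<psi>_def abs_mult abs_sgn_eq split: split_indicator)
  obtain \<phi> where \<phi>: "\<And>n. test_fun (\<phi> n)" "\<And>n x. \<bar>\<phi> n x\<bar> \<le> 1" "\<And>n x. norm x > real M + 1 \<Longrightarrow> \<phi> n x = 0"
     "AE x in lborel. (\<lambda>n. \<phi> n x) \<longlonglongrightarrow> \<psi> x"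
    using test_fun_approx[of \<psi> 1 "real M"] \<psi>B M by (auto simp: \<psi>_def E_def)
  note [measurable] = test_fun_borel[OF \<phi>(1)]
  have "(\<lambda>n. \<integral>x. f x * \<phi> n x \<partial>lborel) \<longlonglongrightarrow> (\<integral>x. f x * \<psi> x \<partial>lborel)"
    by (rule integral_loc_int_tendsto[OF f _ _ \<phi>(2-4)]) auto
  then have "(\<integral>x. f x * \<psi> x \<partial>lborel) \<le> K"
    by (rule LIMSEQ_le_const2) (use dual[OF \<phi>(1,2)] in auto)
  moreover have "f x * \<psi> x = \<bar>f x\<bar> powr 1 * indicator E x" for x
    by (auto simp: \<psi>_def sgn_if abs_if)
  ultimately show "(\<integral>x. \<bar>f x\<bar> powr 1 * indicator {x. norm x \<le> real M \<and> \<bar>f x\<bar> \<le> real M} x \<partial>lborel) \<le> K"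
    unfolding E_def by simp
qed simp

section \<open>Finite differences against weak derivatives\<close>

lemma corr_diff_eq:
  fixes u :: "'a::euclidean_space \<Rightarrow> real"
  assumes u: "loc_int u" and t: "test_fun \<phi>"
  shows "corr \<phi> u h - corr \<phi> u 0 = (\<integral>x. (u (x - h) - u x) * \<phi> x \<partial>lborel)"
proof -
  have [measurable]: "u \<in> borel_measurable borel" using u by (simp add: loc_int_def)
  note [measurable] = test_fun_borel[OF t]
  have i: "integrable lborel (\<lambda>x. u x * \<phi> (x + h))" for h
    by (rule integrable_loc_int_test[OF u test_fun_translate[OF t]])
  have e: "(\<integral>x. u x * \<phi> (x + h) \<partial>lborel) = (\<integral>x. u (x - h) * \<phi> x \<partial>lborel)"
    by (subst integral_lborel_translate[symmetric, where a = "- h"]) auto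
  have i2: "integrable lborel (\<lambda>x. u (x - h) * \<phi> x)"
  proof -
    have "integrable (distr lborel borel ((+) (- h))) (\<lambda>x. u x * \<phi> (x + h))"
      using i by (simp add: lborel_distr_plus)
    then show ?thesis by (subst (asm) integrable_distr_eq) auto
  qed
  show ?thesis
    using i2 i[of 0] e by (simp add: corr_def left_diff_distrib)
qed

lemma corr_line_derivative:
  fixes u :: "'a::euclidean_space \<Rightarrow> real"
  assumes u: "loc_int u" and t: "test_fun \<phi>"
  shows "((\<lambda>s. corr \<phi> u (s *\<^sub>R h)) has_real_derivative corr (\<lambda>x. frechet_derivative \<phi> (at x) h) u (s *\<^sub>R h)) (at s)"
proof -
  have sm: "smooth_fun \<phi>" using t test_fun_def by blast
  have "((\<lambda>s. corr \<phi> u (s *\<^sub>R h)) has_derivative (\<lambda>r. corr (\<lambda>x. frechet_derivative \<phi> (at x) (r *\<^sub>R h)) u (s *\<^sub>R h))) (at s)"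
    by (rule has_derivative_compose[of "\<lambda>s. s *\<^sub>R h", OF _ corr_has_derivative[OF u t]])
       (auto intro!: derivative_eq_intros)
  moreover have "corr (\<lambda>x. frechet_derivative \<phi> (at x) (r *\<^sub>R h)) u z = corr (\<lambda>x. frechet_derivative \<phi> (at x) h) u z * r" for r z
  proof -
    have "frechet_derivative \<phi> (at x) (r *\<^sub>R h) = r * frechet_derivative \<phi> (at x) h" for x
      using linear_scale[OF linear_frechet_derivative[OF smooth_fun_differentiable[OF sm]]] by simp
    then show ?thesis by (simp add: corr_def mult.left_commute mult.commute)
  qed
  ultimately show ?thesis by (simp add: has_field_derivative_def)
qed

text \<open>The mean value theorem along s -> \<open>corr \<phi> u (s *\<^sub>R h)\<close>: a finite
  difference of u is tested like its derivative, only with a translate of \<phi>. Translates are as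
  admissible in the duality as \<phi> itself, so no averaging over the segment is required.\<close>

lemma translation_pairing_mvt:
  fixes u :: "'a::euclidean_space \<Rightarrow> real"
  assumes u: "loc_int u" and t: "test_fun \<phi>"
  shows "\<exists>a. (\<integral>x. (u (x - h) - u x) * \<phi> x \<partial>lborel)
     = (\<integral>x. u x * frechet_derivative (\<lambda>x. \<phi> (x + a)) (at x) h \<partial>lborel)"
proof -
  have sm: "smooth_fun \<phi>" using t test_fun_def by blast
  have "\<exists>z>0. z < 1 \<and> corr \<phi> u (1 *\<^sub>R h) - corr \<phi> u (0 *\<^sub>R h)
     = (1 - 0) * corr (\<lambda>x. frechet_derivative \<phi> (at x) h) u (z *\<^sub>R h)"
    by (rule MVT2) (use corr_line_derivative[OF u t] in auto)
  then obtain z where "corr \<phi> u h - corr \<phi> u 0 = corr (\<lambda>x. frechet_derivative \<phi> (at x) h) u (z *\<^sub>R h)" by auto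
  then show ?thesis
    unfolding corr_diff_eq[OF u t] by (auto simp: corr_def frechet_derivative_translate[OF sm])
qed

text \<open>The derivative at 0 of the same function of s, sampled along s = 2^-j.\<close>

lemma translation_pairing_tendsto:
  fixes u :: "'a::euclidean_space \<Rightarrow> real"
  assumes u: "loc_int u" and t: "test_fun \<phi>"
  shows "(\<lambda>j. \<integral>x. 2 ^ j * (u (x - (1/2) ^ j *\<^sub>R h) - u x) * \<phi> x \<partial>lborel)
     \<longlonglongrightarrow> (\<integral>x. u x * frechet_derivative \<phi> (at x) h \<partial>lborel)"
proof -
  have "((\<lambda>s. (corr \<phi> u ((0 + s) *\<^sub>R h) - corr \<phi> u (0 *\<^sub>R h)) / s) \<longlongrightarrow> corr (\<lambda>x. frechet_derivative \<phi> (at x) h) u (0 *\<^sub>R h)) (at 0)"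
    using corr_line_derivative[OF u t, of h 0] unfolding DERIV_def .
  moreover have "filterlim (\<lambda>j. (1/2) ^ j :: real) (at 0) sequentially"
    unfolding filterlim_at by (auto intro!: LIMSEQ_power_zero)
  ultimately have "(\<lambda>j. (corr \<phi> u ((0 + (1/2) ^ j) *\<^sub>R h) - corr \<phi> u (0 *\<^sub>R h)) / (1/2) ^ j)
     \<longlonglongrightarrow> corr (\<lambda>x. frechet_derivative \<phi> (at x) h) u (0 *\<^sub>R h)"
    by (rule filterlim_compose)
  moreover have "(corr \<phi> u ((0 + (1/2) ^ j) *\<^sub>R h) - corr \<phi> u (0 *\<^sub>R h)) / (1/2) ^ j
     = (\<integral>x. 2 ^ j * (u (x - (1/2) ^ j *\<^sub>R h) - u x) * \<phi> x \<partial>lborel)" for j :: nat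
    using corr_diff_eq[OF u t, of "(1/2) ^ j *\<^sub>R h"] by (simp add: mult.assoc power_divide)
  ultimately show ?thesis by (simp add: corr_def)
qed

text \<open>The quotient T(\<delta>\<sigma>) / \<delta>^p at \<delta> = 2^-j. Halving the step never
  decreases it (\<open>dq_mono\<close>), so the supremum over j commutes with integration over
  \<sigma>.\<close>

definition dq :: "real \<Rightarrow> ('a::euclidean_space \<Rightarrow> real) \<Rightarrow> 'a \<Rightarrow> nat \<Rightarrow> ennreal" where
  "dq p u \<sigma> j = ennreal ((2 ^ j) powr p) * tdiff p u ((1/2) ^ j *\<^sub>R \<sigma>)"

lemma dq_eq_Lpow:
  fixes u :: "'a::euclidean_space \<Rightarrow> real"
  assumes [measurable]: "u \<in> borel_measurable borel"
  shows "Lpow p (\<lambda>x. 2 ^ j * (u (x - (1/2) ^ j *\<^sub>R \<sigma>) - u x)) = dq p u \<sigma> j"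
proof -
  have "Lpow p (\<lambda>x. 2 ^ j * (u (x - (1/2) ^ j *\<^sub>R \<sigma>) - u x)) = ennreal ((2 ^ j) powr p) * tdiff p u (- ((1/2) ^ j *\<^sub>R \<sigma>))"
    unfolding tdiff_def by (subst Lpow_cmult) auto
  then show ?thesis by (simp add: dq_def tdiff_uminus)
qed

lemma loc_int_tdiff:
  fixes u :: "'a::euclidean_space \<Rightarrow> real"
  assumes [measurable]: "u \<in> borel_measurable borel" and p: "p \<ge> 1" and fin: "Lpow p u < \<infinity>"
  shows "loc_int (\<lambda>x. u (x - h) - u x)"
proof (rule loc_int_Lpow[OF _ p])
  have "Lpow p (\<lambda>x. u (x - h) - u x) = tdiff p u (- h)" by (simp add: tdiff_def)
  also have "\<dots> \<le> ennreal (2 powr (p + 1)) * Lpow p u" by (rule tdiff_le_Lpow) (use p in auto)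
  also have "\<dots> < \<infinity>" using fin by (simp add: ennreal_mult_less_top)
  finally show "Lpow p (\<lambda>x. u (x - h) - u x) < \<infinity>" .
qed measurable

text \<open>Two uses of duality. A pairing of the increment with \<phi> is a pairing of -g with a
  translate of \<phi>, whose penalty is the same. Conversely a pairing of -g is a limit of pairings
  of difference quotients, each controlled by the supremum.\<close>

lemma weak_derivative_energy:
  fixes u g :: "'a::euclidean_space \<Rightarrow> real"
  assumes [measurable]: "u \<in> borel_measurable borel" "g \<in> borel_measurable borel"
    and p: "p > 1" and fin: "Lpow p u < \<infinity>" "Lpow p g < \<infinity>"
    and weak: "\<And>\<phi>. test_fun \<phi> \<Longrightarrow>
      (\<integral>x. u x * frechet_derivative \<phi> (at x) h \<partial>lborel) = - (\<integral>x. g x * \<phi> x \<partial>lborel)"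
  shows "tdiff p u h \<le> Lpow p g" "Lpow p g \<le> (SUP j. dq p u h j)"
proof -
  have L: "loc_int u" "loc_int g" using loc_int_Lpow[of u p] loc_int_Lpow[of g p] p fin by auto
  obtain K where K: "Lpow p g = ennreal K" "K \<ge> 0"
    using fin(2) by (cases "Lpow p g") auto
  have "Lpow p (\<lambda>x. u (x - h) - u x) \<le> ennreal K"
  proof (rule Lpow_le_duality_gt1[OF loc_int_tdiff[OF _ _ fin(1)] p])
    fix \<phi> :: "'a \<Rightarrow> real" assume t: "test_fun \<phi>"
    note [measurable] = test_fun_borel[OF t]
    obtain a where a: "(\<integral>x. (u (x - h) - u x) * \<phi> x \<partial>lborel)
     = (\<integral>x. u x * frechet_derivative (\<lambda>x. \<phi> (x + a)) (at x) h \<partial>lborel)"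
      using translation_pairing_mvt[OF L(1) t] by blast
    have t': "test_fun (\<lambda>x. \<phi> (x + a))" by (rule test_fun_translate[OF t])
    have "p * (\<integral>x. - g x * \<phi> (x + a) \<partial>lborel)
       \<le> K + (p - 1) * (\<integral>x. \<bar>\<phi> (x + a)\<bar> powr (p / (p - 1)) \<partial>lborel)"
      by (rule pairing_le_gt1[OF _ p _ _ t']) (use K in auto)
    also have "(\<integral>x. \<bar>\<phi> (x + a)\<bar> powr (p / (p - 1)) \<partial>lborel) = (\<integral>x. \<bar>\<phi> x\<bar> powr (p / (p - 1)) \<partial>lborel)"
      by (rule integral_lborel_translate) measurable
    finally show "p * (\<integral>x. (u (x - h) - u x) * \<phi> x \<partial>lborel)
       \<le> K + (p - 1) * (\<integral>x. \<bar>\<phi> x\<bar> powr (p / (p - 1)) \<partial>lborel)"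
      unfolding a weak[OF t'] by simp
  qed (use p in auto)
  then show "tdiff p u h \<le> Lpow p g"
    using tdiff_uminus[of u p h] by (simp add: tdiff_def K)
  show "Lpow p g \<le> (SUP j. dq p u h j)"
  proof (cases "(SUP j. dq p u h j) = \<infinity>")
    case False
    then obtain S where S: "(SUP j. dq p u h j) = ennreal S" "S \<ge> 0"
      by (cases "SUP j. dq p u h j") auto
    have "Lpow p (\<lambda>x. - g x) \<le> ennreal S"
    proof (rule Lpow_le_duality_gt1[OF _ p])
      show "loc_int (\<lambda>x. - g x)" by (rule loc_int_Lpow) (use p fin in auto)
      fix \<phi> :: "'a \<Rightarrow> real" assume t: "test_fun \<phi>"
      have "(\<lambda>j. p * (\<integral>x. 2 ^ j * (u (x - (1/2) ^ j *\<^sub>R h) - u x) * \<phi> x \<partial>lborel))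
         \<longlonglongrightarrow> p * (\<integral>x. u x * frechet_derivative \<phi> (at x) h \<partial>lborel)"
        by (intro tendsto_mult tendsto_const translation_pairing_tendsto L t)
      moreover have "p * (\<integral>x. 2 ^ j * (u (x - (1/2) ^ j *\<^sub>R h) - u x) * \<phi> x \<partial>lborel)
         \<le> S + (p - 1) * (\<integral>x. \<bar>\<phi> x\<bar> powr (p / (p - 1)) \<partial>lborel)" for j
      proof (rule pairing_le_gt1[OF _ p _ S(2) t])
        show "Lpow p (\<lambda>x. 2 ^ j * (u (x - (1/2) ^ j *\<^sub>R h) - u x)) \<le> ennreal S"
          unfolding dq_eq_Lpow[OF assms(1)] S(1)[symmetric] by (rule SUP_upper) simp
      qed measurable
      ultimately have "p * (\<integral>x. u x * frechet_derivative \<phi> (at x) h \<partial>lborel)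
         \<le> S + (p - 1) * (\<integral>x. \<bar>\<phi> x\<bar> powr (p / (p - 1)) \<partial>lborel)"
        by (blast intro: LIMSEQ_le_const2)
      then show "p * (\<integral>x. - g x * \<phi> x \<partial>lborel) \<le> S + (p - 1) * (\<integral>x. \<bar>\<phi> x\<bar> powr (p / (p - 1)) \<partial>lborel)"
        unfolding weak[OF t] by simp
    qed
    then show ?thesis using S by simp
  next
    case True
    show ?thesis unfolding True by simp
  qed
qed

text \<open>The same two arguments for p = 1. The variation V is already a supremum of pairings, so
  the derivative measure itself is never constructed; V may be infinite.\<close>

lemma variation_energy:
  fixes u :: "'a::euclidean_space \<Rightarrow> real" and h :: 'a
  assumes [measurable]: "u \<in> borel_measurable borel" and fin: "Lpow 1 u < \<infinity>"
  defines "V \<equiv> SUP \<phi>\<in>{\<phi>. test_fun \<phi> \<and> (\<forall>x. \<bar>\<phi> x\<bar> \<le> 1)}. ennreal (\<integral>x. u x * frechet_derivative \<phi> (at x) h \<partial>lborel)"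
  shows "tdiff 1 u h \<le> V" "V \<le> (SUP j. dq 1 u h j)"
proof -
  have L: "loc_int u" using loc_int_Lpow[of u 1] fin by auto
  show "tdiff 1 u h \<le> V"
  proof (cases "V = \<infinity>")
    case False
    then obtain K where K: "V = ennreal K" "K \<ge> 0" by (cases V) auto
    have "Lpow 1 (\<lambda>x. u (x - h) - u x) \<le> ennreal K"
    proof (rule Lpow_le_duality_1[OF loc_int_tdiff[OF _ _ fin]])
      fix \<phi> :: "'a \<Rightarrow> real" assume t: "test_fun \<phi>" "\<And>x. \<bar>\<phi> x\<bar> \<le> 1"
      obtain a where a: "(\<integral>x. (u (x - h) - u x) * \<phi> x \<partial>lborel)
       = (\<integral>x. u x * frechet_derivative (\<lambda>x. \<phi> (x + a)) (at x) h \<partial>lborel)"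
        using translation_pairing_mvt[OF L t(1)] by blast
      have "ennreal (\<integral>x. u x * frechet_derivative (\<lambda>x. \<phi> (x + a)) (at x) h \<partial>lborel) \<le> V"
        unfolding V_def
        by (rule SUP_upper[of "\<lambda>x. \<phi> (x + a)"]) (use test_fun_translate[OF t(1)] t(2) in auto)
      then show "(\<integral>x. (u (x - h) - u x) * \<phi> x \<partial>lborel) \<le> K"
        unfolding a K(1) using K(2) by (simp add: ennreal_le_iff)
    qed auto
    then show ?thesis
      using tdiff_uminus[of u 1 h] by (simp add: tdiff_def K)
  qed simp
  show "V \<le> (SUP j. dq 1 u h j)"
  proof (cases "(SUP j. dq 1 u h j) = \<infinity>")
    case False
    then obtain S where S: "(SUP j. dq 1 u h j) = ennreal S" "S \<ge> 0"
      by (cases "SUP j. dq 1 u h j") auto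
    show ?thesis unfolding V_def S(1)
    proof (rule SUP_least, intro ennreal_leI)
      fix \<phi> :: "'a \<Rightarrow> real" assume "\<phi> \<in> {\<phi>. test_fun \<phi> \<and> (\<forall>x. \<bar>\<phi> x\<bar> \<le> 1)}"
      then have t: "test_fun \<phi>" "\<And>x. \<bar>\<phi> x\<bar> \<le> 1" by auto
      have le: "(\<integral>x. 2 ^ j * (u (x - (1/2) ^ j *\<^sub>R h) - u x) * \<phi> x \<partial>lborel) \<le> S" for j
      proof (rule pairing_le_1[OF _ _ S(2) t])
        show "Lpow 1 (\<lambda>x. 2 ^ j * (u (x - (1/2) ^ j *\<^sub>R h) - u x)) \<le> ennreal S"
          unfolding dq_eq_Lpow[OF assms(1)] S(1)[symmetric] by (rule SUP_upper) simp
      qed measurable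
      show "(\<integral>x. u x * frechet_derivative \<phi> (at x) h \<partial>lborel) \<le> S"
        by (rule LIMSEQ_le_const2[OF translation_pairing_tendsto[OF L t(1), of h]]) (use le in auto)
    qed
  next
    case True
    show ?thesis unfolding True by simp
  qed
qed

section \<open>Integration by parts for test functions\<close>

lemma iter_dd_cmult:
  assumes "smooth_fun \<phi>"
  shows "iter_dd vs (\<lambda>x. c * \<phi> x) = (\<lambda>x. c * iter_dd vs \<phi> x)"
proof (induction vs)
  case (Cons v vs)
  have "((\<lambda>x. c * iter_dd vs \<phi> x) has_derivative (\<lambda>h. c * frechet_derivative (iter_dd vs \<phi>) (at x) h)) (at x)" for x
    using assms by (intro has_derivative_mult_right) (simp add: smooth_fun_def frechet_derivative_works[symmetric])
  then have "frechet_derivative (\<lambda>x. c * iter_dd vs \<phi> x) (at x) v = c * frechet_derivative (iter_dd vs \<phi>) (at x) v" for x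
    by (metis frechet_derivative_at)
  then show ?case by (simp add: Cons)
qed simp

lemma test_fun_cmult:
  assumes "test_fun \<phi>" shows "test_fun (\<lambda>x. c * \<phi> x)"
    and "frechet_derivative (\<lambda>x. c * \<phi> x) (at x) v = c * frechet_derivative \<phi> (at x) v"
proof -
  have s: "smooth_fun \<phi>" using assms test_fun_def by blast
  have "smooth_fun (\<lambda>x. c * \<phi> x)"
    using s unfolding smooth_fun_def iter_dd_cmult[OF s] by (auto intro!: differentiable_mult)
  with assms show "test_fun (\<lambda>x. c * \<phi> x)" unfolding test_fun_iff by auto
  show "frechet_derivative (\<lambda>x. c * \<phi> x) (at x) v = c * frechet_derivative \<phi> (at x) v"
    using iter_dd_cmult[OF s, of "[v]" c] by (simp add: fun_eq_iff)
qed

text \<open>The function s -> \<open>corr \<phi> u (s *\<^sub>R v)\<close> equals s ->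
  \<open>corr u \<phi> (- s *\<^sub>R v)\<close> by translation invariance; its derivative at 0 is
  computed in both forms.\<close>

lemma integration_by_parts_test:
  assumes u: "test_fun u" and \<phi>: "test_fun \<phi>"
  shows "(\<integral>x. u x * frechet_derivative \<phi> (at x) v \<partial>lborel) = - (\<integral>x. frechet_derivative u (at x) v * \<phi> x \<partial>lborel)"
proof -
  have L: "loc_int f" if "test_fun f" for f :: "'a \<Rightarrow> real"
    using test_fun_bounded[OF that] test_fun_borel[OF that] loc_int_bounded by blast
  note [measurable] = test_fun_borel[OF u] test_fun_borel[OF \<phi>]
  have sw: "corr \<phi> u h = corr u \<phi> (- h)" for h
    unfolding corr_def
    by (subst integral_lborel_translate[symmetric, where a = "- h"]) (auto simp: mult.commute)
  have "((\<lambda>s. corr \<phi> u (s *\<^sub>R v)) has_real_derivative corr (\<lambda>x. frechet_derivative \<phi> (at x) v) u (0 *\<^sub>R v)) (at 0)"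
    by (rule corr_line_derivative[OF L[OF u] \<phi>])
  moreover have "((\<lambda>s. corr u \<phi> ((- s) *\<^sub>R v)) has_real_derivative corr (\<lambda>x. frechet_derivative u (at x) v) \<phi> ((- 0) *\<^sub>R v) * - 1) (at 0)"
    by (rule DERIV_chain2[of "\<lambda>s. corr u \<phi> (s *\<^sub>R v)", OF corr_line_derivative[OF L[OF \<phi>] u]])
       (auto intro!: derivative_eq_intros)
  ultimately have "corr (\<lambda>x. frechet_derivative \<phi> (at x) v) u 0 = - corr (\<lambda>x. frechet_derivative u (at x) v) \<phi> 0"
    using DERIV_unique by (fastforce simp: sw)
  then show ?thesis by (simp add: corr_def mult.commute)
qed

section \<open>Borel representatives\<close>

lemma borel_version_real:
  fixes u :: "'a::euclidean_space \<Rightarrow> real"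
  assumes "u \<in> borel_measurable lebesgue"
  shows "\<exists>u'\<in>borel_measurable borel. AE x in lborel. u x = u' x"
  using completion_ex_borel_measurable_real[OF assms] by simp

lemma borel_version_vec:
  fixes G :: "'a::euclidean_space \<Rightarrow> 'a"
  assumes [measurable]: "G \<in> borel_measurable lebesgue"
  shows "\<exists>G'\<in>borel_measurable borel. AE x in lborel. G x = G' x"
proof -
  have "\<exists>g\<in>borel_measurable borel. AE x in lborel. G x \<bullet> b = g x" for b
    by (rule borel_version_real) measurable
  then obtain g where g: "\<And>b. g b \<in> borel_measurable borel" "\<And>b. AE x in lborel. G x \<bullet> b = g b x"
    by metis
  note [measurable] = g(1)
  have "AE x in lborel. \<forall>b\<in>(Basis::'a set). G x \<bullet> b = g b x"
    by (rule AE_finite_allI) (use g(2) in auto)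
  then have "AE x in lborel. G x = (\<Sum>b\<in>Basis. g b x *\<^sub>R b)"
  proof eventually_elim
    case (elim x)
    have "G x = (\<Sum>b\<in>Basis. (G x \<bullet> b) *\<^sub>R b)" by (simp add: euclidean_representation)
    then show ?case using elim by simp
  qed
  then show ?thesis by (intro bexI[of _ "\<lambda>x. \<Sum>b\<in>Basis. g b x *\<^sub>R b"]) auto
qed

lemma Lp_fun_iff_Lpow:
  assumes "u \<in> borel_measurable borel"
  shows "Lp_fun p u \<longleftrightarrow> Lpow p u < \<infinity>"
  using assms by (simp add: Lp_fun_def Lpow_def nn_integral_completion measurable_completion)

lemma integral_lebesgue_eq:
  fixes f :: "'a::euclidean_space \<Rightarrow> real"
  assumes "f \<in> borel_measurable borel"
  shows "integral\<^sup>L lebesgue f = integral\<^sup>L lborel f"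
  using assms by (intro integral_completion) simp

lemma fd_test_borel [measurable_dest]:
  "test_fun \<phi> \<Longrightarrow> (\<lambda>x. frechet_derivative \<phi> (at x) v) \<in> borel_measurable borel"
  by (intro test_fun_borel test_fun_dd)

lemma integral_cong_lebesgue:
  fixes u u' g :: "'a::euclidean_space \<Rightarrow> real"
  assumes "u \<in> borel_measurable lebesgue" "u' \<in> borel_measurable lebesgue" "g \<in> borel_measurable borel"
    and ae: "AE x in lborel. u x = u' x"
  shows "(\<integral>x. u x * g x \<partial>lebesgue) = (\<integral>x. u' x * g x \<partial>lebesgue)"
proof (rule integral_cong_AE)
  have "g \<in> borel_measurable lebesgue" using assms(3) by (simp add: measurable_completion)
  then show "(\<lambda>x. u x * g x) \<in> borel_measurable lebesgue" "(\<lambda>x. u' x * g x) \<in> borel_measurable lebesgue"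
    using assms(1,2) by auto
  show "AE x in lebesgue. u x * g x = u' x * g x"
    using AE_completion[OF ae] by eventually_elim simp
qed

lemma divergence_borel:
  assumes "\<forall>b\<in>Basis. test_fun (\<lambda>x. \<Phi> x \<bullet> b)"
  shows "divergence \<Phi> \<in> borel_measurable borel"
  unfolding divergence_def[abs_def] using assms by (intro borel_measurable_sum fd_test_borel) auto

text \<open>\<open>dir_norm\<close> involves a chosen weak gradient. The choice is the same for u
  and u', because \<open>Lp_weak_grad p u\<close> and \<open>Lp_weak_grad p u'\<close> are equal as
  predicates, not merely equivalent up to null sets.\<close>

lemma AE_invariance:
  fixes u u' :: "'a::euclidean_space \<Rightarrow> real"
  assumes m: "u \<in> borel_measurable lebesgue" "u' \<in> borel_measurable lebesgue"
    and ae: "AE x in lborel. u x = u' x"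
  shows "Xp p u \<longleftrightarrow> Xp p u'" "dir_norm p u = dir_norm p u'" "Lp_fun p u \<longleftrightarrow> Lp_fun p u'"
proof -
  have w: "is_weak_grad u = is_weak_grad u'"
    unfolding is_weak_grad_def fun_eq_iff
    using integral_cong_lebesgue[OF m fd_test_borel ae] by auto
  have lp: "Lp_fun p u \<longleftrightarrow> Lp_fun p u'" for p
  proof -
    have "(\<integral>\<^sup>+x. ennreal (\<bar>u x\<bar> powr p) \<partial>lebesgue) = (\<integral>\<^sup>+x. ennreal (\<bar>u' x\<bar> powr p) \<partial>lebesgue)"
      by (rule nn_integral_cong_AE) (use AE_completion[OF ae] in eventually_elim, simp)
    then show ?thesis using m by (simp add: Lp_fun_def)
  qed
  have tv: "total_variation u = total_variation u'"
    unfolding total_variation_def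
    by (rule SUP_cong) (use integral_cong_lebesgue[OF m divergence_borel ae] in auto)
  have dv: "dir_variation u = dir_variation u'"
    unfolding dir_variation_def fun_eq_iff
    by (intro allI SUP_cong) (use integral_cong_lebesgue[OF m fd_test_borel ae] in auto)
  show "Lp_fun p u \<longleftrightarrow> Lp_fun p u'" by (rule lp)
  show "Xp p u \<longleftrightarrow> Xp p u'"
    by (simp add: Xp_def W1p_def BV_def Lp_weak_grad_def w lp tv)
  show "dir_norm p u = dir_norm p u'"
  proof -
    have "Lp_weak_grad p u = Lp_weak_grad p u'" by (simp add: fun_eq_iff Lp_weak_grad_def w)
    then show ?thesis unfolding dir_norm_def[abs_def] dv by (simp only:)
  qed
qed

section \<open>The directional norm as a supremum of difference quotients\<close>

lemma dir_norm_energy_gt1: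
  fixes u :: "'a::euclidean_space \<Rightarrow> real"
  assumes u [measurable]: "u \<in> borel_measurable borel" and p: "p > 1" and X: "Xp p u"
  shows "tdiff p u h \<le> dir_norm p u h" "dir_norm p u h \<le> (SUP j. dq p u h j)"
    "c > 0 \<Longrightarrow> dir_norm p u (c *\<^sub>R h) = ennreal (c powr p) * dir_norm p u h"
    "\<exists>K\<ge>0. \<forall>h. norm h \<le> 1 \<longrightarrow> dir_norm p u h \<le> ennreal K"
proof -
  define G where "G = (SOME G. Lp_weak_grad p u G)"
  have "Lp_fun p u" "\<exists>G. Lp_weak_grad p u G" using X p by (auto simp: Xp_def W1p_def)
  then have fin: "Lpow p u < \<infinity>" and G: "Lp_weak_grad p u G"
    using Lp_fun_iff_Lpow[OF u] someI_ex[of "Lp_weak_grad p u"] by (auto simp: G_def)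
  have Gm: "G \<in> borel_measurable lebesgue" using G by (simp add: Lp_weak_grad_def is_weak_grad_def)
  obtain G' where G'[measurable]: "G' \<in> borel_measurable borel" and ae: "AE x in lborel. G x = G' x"
    using borel_version_vec[OF Gm] by blast
  have ae': "AE x in lebesgue. G x = G' x" using AE_completion[OF ae] .
  have dn: "dir_norm p u h = Lpow p (\<lambda>x. G' x \<bullet> h)" for h
  proof -
    have "dir_norm p u h = (\<integral>\<^sup>+x. ennreal (\<bar>h \<bullet> G x\<bar> powr p) \<partial>lebesgue)"
      using p by (simp add: dir_norm_def G_def)
    also have "\<dots> = (\<integral>\<^sup>+x. ennreal (\<bar>h \<bullet> G' x\<bar> powr p) \<partial>lebesgue)"
      by (rule nn_integral_cong_AE) (use ae' in eventually_elim, simp)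
    also have "\<dots> = Lpow p (\<lambda>x. G' x \<bullet> h)" by (simp add: Lpow_def nn_integral_completion inner_commute)
    finally show ?thesis .
  qed
  have finG: "Lpow p (\<lambda>x. norm (G' x)) < \<infinity>"
  proof -
    have "Lpow p (\<lambda>x. norm (G' x)) = (\<integral>\<^sup>+x. ennreal (\<bar>norm (G x)\<bar> powr p) \<partial>lebesgue)"
      unfolding Lpow_def nn_integral_completion
      by (rule nn_integral_cong_AE) (use ae in eventually_elim, simp)
    also have "\<dots> < \<infinity>" using G by (simp add: Lp_weak_grad_def Lp_fun_def)
    finally show ?thesis .
  qed
  have le: "Lpow p (\<lambda>x. G' x \<bullet> h) \<le> ennreal (norm h powr p) * Lpow p (\<lambda>x. norm (G' x))" for h
  proof -
    have "Lpow p (\<lambda>x. G' x \<bullet> h) \<le> Lpow p (\<lambda>x. norm h * norm (G' x))"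
      unfolding Lpow_def
      using p Cauchy_Schwarz_ineq2[of "G' _" h]
      by (intro nn_integral_mono ennreal_leI powr_mono2) (auto simp: mult.commute abs_mult)
    then show ?thesis by (subst (asm) Lpow_cmult) auto
  qed
  have fing: "Lpow p (\<lambda>x. G' x \<bullet> h) < \<infinity>" for h
    using le[of h] by (rule order.strict_trans1) (use finG in \<open>simp add: ennreal_mult_less_top\<close>)
  have Lg: "loc_int (\<lambda>x. G' x \<bullet> h)" for h
    by (rule loc_int_Lpow[OF _ _ fing]) (use p in auto)
  have Lu: "loc_int u" by (rule loc_int_Lpow[OF _ _ fin]) (use p in auto)
  \<comment> \<open>The definition of a weak gradient tests basis directions only; linearity of the
    derivative of \<phi> extends the identity to every h.\<close>
  have weak: "(\<integral>x. u x * frechet_derivative \<phi> (at x) h \<partial>lborel) = - (\<integral>x. (G' x \<bullet> h) * \<phi> x \<partial>lborel)"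
    if t: "test_fun \<phi>" for \<phi> h
  proof -
    note [measurable] = test_fun_borel[OF t] fd_test_borel[OF t]
    have s: "smooth_fun \<phi>" using t test_fun_def by blast
    have b: "(\<integral>x. u x * frechet_derivative \<phi> (at x) b \<partial>lborel) = - (\<integral>x. (G' x \<bullet> b) * \<phi> x \<partial>lborel)"
      if "b \<in> Basis" for b
    proof -
      have "(\<integral>x. u x * frechet_derivative \<phi> (at x) b \<partial>lborel) = (\<integral>x. u x * frechet_derivative \<phi> (at x) b \<partial>lebesgue)"
        by (subst integral_lebesgue_eq) auto
      also have "\<dots> = - (\<integral>x. (G x \<bullet> b) * \<phi> x \<partial>lebesgue)"
        using G t that by (simp add: Lp_weak_grad_def is_weak_grad_def)
      also have "(\<integral>x. (G x \<bullet> b) * \<phi> x \<partial>lebesgue) = (\<integral>x. (G' x \<bullet> b) * \<phi> x \<partial>lebesgue)"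
      proof (rule integral_cong_lebesgue)
        show "(\<lambda>x. G x \<bullet> b) \<in> borel_measurable lebesgue" using Gm by measurable
        have "(\<lambda>x. G' x \<bullet> b) \<in> borel_measurable borel" by measurable
        then show "(\<lambda>x. G' x \<bullet> b) \<in> borel_measurable lebesgue" by (simp add: measurable_completion)
        show "AE x in lborel. G x \<bullet> b = G' x \<bullet> b" using ae by eventually_elim simp
      qed measurable
      also have "\<dots> = (\<integral>x. (G' x \<bullet> b) * \<phi> x \<partial>lborel)" by (rule integral_lebesgue_eq) measurable
      finally show ?thesis .
    qed
    have "(\<integral>x. u x * frechet_derivative \<phi> (at x) h \<partial>lborel)
        = (\<integral>x. (\<Sum>b\<in>Basis. (h \<bullet> b) * (u x * frechet_derivative \<phi> (at x) b)) \<partial>lborel)"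
      by (subst smooth_fun_fd_sum[OF s]) (simp add: sum_distrib_left algebra_simps)
    also have "\<dots> = (\<Sum>b\<in>Basis. (h \<bullet> b) * (\<integral>x. u x * frechet_derivative \<phi> (at x) b \<partial>lborel))"
      by (subst Bochner_Integration.integral_sum)
         (auto intro!: integrable_mult_right integrable_loc_int_test[OF Lu test_fun_dd[OF t]])
    also have "\<dots> = - (\<Sum>b\<in>Basis. (h \<bullet> b) * (\<integral>x. (G' x \<bullet> b) * \<phi> x \<partial>lborel))"
      by (simp add: b sum_negf)
    also have "(\<Sum>b\<in>Basis. (h \<bullet> b) * (\<integral>x. (G' x \<bullet> b) * \<phi> x \<partial>lborel))
        = (\<integral>x. (\<Sum>b\<in>Basis. (h \<bullet> b) * ((G' x \<bullet> b) * \<phi> x)) \<partial>lborel)"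
      by (subst Bochner_Integration.integral_sum)
         (auto intro!: integrable_mult_right integrable_loc_int_test[OF Lg t])
    also have "\<dots> = (\<integral>x. (G' x \<bullet> h) * \<phi> x \<partial>lborel)"
    proof (rule Bochner_Integration.integral_cong[OF refl])
      fix x
      show "(\<Sum>b\<in>Basis. (h \<bullet> b) * ((G' x \<bullet> b) * \<phi> x)) = (G' x \<bullet> h) * \<phi> x"
        by (subst euclidean_inner[of "G' x" h]) (simp add: sum_distrib_left algebra_simps)
    qed
    finally show ?thesis .
  qed
  have gm: "(\<lambda>x. G' x \<bullet> h) \<in> borel_measurable borel" by measurable
  show "tdiff p u h \<le> dir_norm p u h" "dir_norm p u h \<le> (SUP j. dq p u h j)"
    unfolding dn by (rule weak_derivative_energy[OF u gm p fin fing weak], assumption)+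
  show "dir_norm p u (c *\<^sub>R h) = ennreal (c powr p) * dir_norm p u h" if "c > 0"
    unfolding dn using that Lpow_cmult[of "\<lambda>x. G' x \<bullet> h" p c] by simp
  obtain K where K: "Lpow p (\<lambda>x. norm (G' x)) = ennreal K" "K \<ge> 0"
    using finG by (cases "Lpow p (\<lambda>x. norm (G' x))") auto
  have "dir_norm p u h \<le> ennreal K" if "norm h \<le> 1" for h
  proof -
    have "norm h powr p \<le> 1" using that p by (simp add: powr_le1)
    then have "ennreal (norm h powr p) * ennreal K \<le> 1 * ennreal K"
      by (intro mult_right_mono) (auto simp flip: ennreal_1)
    then show ?thesis using le[of h] unfolding dn K by simp
  qed
  with K(2) show "\<exists>K\<ge>0. \<forall>h. norm h \<le> 1 \<longrightarrow> dir_norm p u h \<le> ennreal K" by blast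
qed

lemma dir_norm_energy_1:
  fixes u :: "'a::euclidean_space \<Rightarrow> real"
  assumes u [measurable]: "u \<in> borel_measurable borel" and X: "Xp 1 u"
  shows "tdiff 1 u h \<le> dir_norm 1 u h" "dir_norm 1 u h \<le> (SUP j. dq 1 u h j)"
    "c > 0 \<Longrightarrow> dir_norm 1 u (c *\<^sub>R h) = ennreal (c powr 1) * dir_norm 1 u h"
    "\<exists>K\<ge>0. \<forall>h. norm h \<le> 1 \<longrightarrow> dir_norm 1 u h \<le> ennreal K"
proof -
  have fin: "Lpow 1 u < \<infinity>" and tv: "total_variation u < \<infinity>"
    using X Lp_fun_iff_Lpow[OF u] by (auto simp: Xp_def BV_def)
  define T where "T = {\<phi>::'a \<Rightarrow> real. test_fun \<phi> \<and> (\<forall>x. \<bar>\<phi> x\<bar> \<le> 1)}"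
  have T0: "(\<lambda>x. 0) \<in> T"
    using test_fun_cmult_bump[of 1 0 1] by (simp add: T_def)
  have int: "(\<integral>x. u x * frechet_derivative \<phi> (at x) h \<partial>lebesgue) = (\<integral>x. u x * frechet_derivative \<phi> (at x) h \<partial>lborel)"
    if "\<phi> \<in> T" for \<phi> h
    using that by (intro integral_lebesgue_eq borel_measurable_times fd_test_borel) (auto simp: T_def)
  have dn: "dir_norm 1 u h = (SUP \<phi>\<in>T. ennreal (\<integral>x. u x * frechet_derivative \<phi> (at x) h \<partial>lborel))" for h
    unfolding dir_norm_def dir_variation_def T_def[symmetric] using int by (auto intro!: SUP_cong)
  show "tdiff 1 u h \<le> dir_norm 1 u h" "dir_norm 1 u h \<le> (SUP j. dq 1 u h j)"
    unfolding dn T_def using variation_energy[OF u fin] by auto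
  have lin: "frechet_derivative \<phi> (at x) (c *\<^sub>R h) = c * frechet_derivative \<phi> (at x) h" if "\<phi> \<in> T" for \<phi> x c h
  proof -
    have "smooth_fun \<phi>" using that by (simp add: T_def test_fun_def)
    then show ?thesis
      using linear_scale[OF linear_frechet_derivative[OF smooth_fun_differentiable]] by fastforce
  qed
  show "dir_norm 1 u (c *\<^sub>R h) = ennreal (c powr 1) * dir_norm 1 u h" if c: "c > 0"
  proof -
    have "dir_norm 1 u (c *\<^sub>R h) = (SUP \<phi>\<in>T. ennreal c * ennreal (\<integral>x. u x * frechet_derivative \<phi> (at x) h \<partial>lborel))"
      unfolding dn
    proof (rule SUP_cong[OF refl])
      fix \<phi> assume "\<phi> \<in> T"
      then have "(\<integral>x. u x * frechet_derivative \<phi> (at x) (c *\<^sub>R h) \<partial>lborel) = c * (\<integral>x. u x * frechet_derivative \<phi> (at x) h \<partial>lborel)"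
        by (simp add: lin mult.left_commute)
      then show "ennreal (\<integral>x. u x * frechet_derivative \<phi> (at x) (c *\<^sub>R h) \<partial>lborel)
         = ennreal c * ennreal (\<integral>x. u x * frechet_derivative \<phi> (at x) h \<partial>lborel)"
        using c by (simp add: ennreal_mult')
    qed
    also have "\<dots> = ennreal (c powr 1) * dir_norm 1 u h"
      unfolding dn using c T0 by (subst SUP_mult_left_ennreal) auto
    finally show ?thesis .
  qed
  define K where "K = max 0 (real_of_ereal (total_variation u))"
  have "dir_norm 1 u h \<le> ennreal K" if h: "norm h \<le> 1" for h
    unfolding dn
  proof (rule SUP_least, rule ennreal_leI)
    fix \<phi> assume \<phi>: "\<phi> \<in> T"
    then have t: "test_fun \<phi>" and b: "\<And>x. \<bar>\<phi> x\<bar> \<le> 1" by (auto simp: T_def)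
    have s: "smooth_fun \<phi>" using t test_fun_def by blast
    \<comment> \<open>This field has norm at most 1 and its divergence is the derivative of \<phi>
      along h, so it competes in the total variation.\<close>
    define \<Phi> where "\<Phi> x = \<phi> x *\<^sub>R h" for x
    have comp: "(\<lambda>x. \<Phi> x \<bullet> b) = (\<lambda>x. (h \<bullet> b) * \<phi> x)" for b by (simp add: \<Phi>_def mult.commute)
    have "norm (\<Phi> x) \<le> 1" for x using b[of x] h by (simp add: \<Phi>_def mult_le_one)
    then have mem: "\<Phi> \<in> {\<phi>. (\<forall>b\<in>Basis. test_fun (\<lambda>x. \<phi> x \<bullet> b)) \<and> (\<forall>x. norm (\<phi> x) \<le> 1)}"
      unfolding comp mem_Collect_eq using test_fun_cmult(1)[OF t] by (auto simp: comp)
    have "divergence \<Phi> x = frechet_derivative \<phi> (at x) h" for x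
      unfolding divergence_def comp test_fun_cmult(2)[OF t] using smooth_fun_fd_sum[OF s, of x h] by simp
    then have "ereal (\<integral>x. u x * frechet_derivative \<phi> (at x) h \<partial>lborel) \<le> total_variation u"
      using SUP_upper[OF mem, of "\<lambda>\<phi>. ereal (\<integral>x. u x * divergence \<phi> x \<partial>lebesgue)"] int[OF \<phi>]
      by (simp add: total_variation_def)
    then show "(\<integral>x. u x * frechet_derivative \<phi> (at x) h \<partial>lborel) \<le> K"
      using tv unfolding K_def by (cases "total_variation u") auto
  qed
  moreover have "K \<ge> 0" by (simp add: K_def)
  ultimately show "\<exists>K\<ge>0. \<forall>h. norm h \<le> 1 \<longrightarrow> dir_norm 1 u h \<le> ennreal K" by blast
qed

text \<open>The interface to \<open>dir_norm\<close> for all p >= 1: later arguments no longer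
  distinguish p = 1 from p > 1.\<close>

lemma dir_norm_energy:
  fixes u :: "'a::euclidean_space \<Rightarrow> real"
  assumes "u \<in> borel_measurable borel" and "p \<ge> 1" and "Xp p u"
  shows "tdiff p u h \<le> dir_norm p u h" "dir_norm p u h \<le> (SUP j. dq p u h j)"
    "c > 0 \<Longrightarrow> dir_norm p u (c *\<^sub>R h) = ennreal (c powr p) * dir_norm p u h"
    "\<exists>K\<ge>0. \<forall>h. norm h \<le> 1 \<longrightarrow> dir_norm p u h \<le> ennreal K"
proof -
  have "p = 1 \<or> p > 1" using assms(2) by linarith
  then show "tdiff p u h \<le> dir_norm p u h" "dir_norm p u h \<le> (SUP j. dq p u h j)"
    "c > 0 \<Longrightarrow> dir_norm p u (c *\<^sub>R h) = ennreal (c powr p) * dir_norm p u h"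
    "\<exists>K\<ge>0. \<forall>h. norm h \<le> 1 \<longrightarrow> dir_norm p u h \<le> ennreal K"
    using dir_norm_energy_gt1[OF assms(1) _ assms(3)] dir_norm_energy_1[OF assms(1)] assms(3) by auto
qed

lemma Xp_Lpow:
  assumes "u \<in> borel_measurable borel" "p \<ge> 1" "Xp p u" shows "Lpow p u < \<infinity>"
  using assms Lp_fun_iff_Lpow[OF assms(1)] by (cases "p = 1") (auto simp: Xp_def W1p_def BV_def split: if_splits)

text \<open>No quotient exceeds the norm, by the bound on T at 2^-j h and homogeneity. Measurability
  in h, continuity and the behaviour under dilation are all derived from this formula.\<close>

lemma dir_norm_eq_SUP:
  fixes u :: "'a::euclidean_space \<Rightarrow> real"
  assumes "u \<in> borel_measurable borel" and "p \<ge> 1" and "Xp p u"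
  shows "dir_norm p u h = (SUP j. dq p u h j)"
proof (rule antisym[OF dir_norm_energy(2)[OF assms] SUP_least])
  fix j
  have "dq p u h j \<le> ennreal ((2 ^ j) powr p) * dir_norm p u ((1/2) ^ j *\<^sub>R h)"
    unfolding dq_def by (intro mult_left_mono dir_norm_energy(1)[OF assms]) auto
  also have "\<dots> = ennreal ((2 ^ j) powr p * ((1/2) ^ j) powr p) * dir_norm p u h"
    by (subst dir_norm_energy(3)[OF assms]) (auto simp: ennreal_mult mult.assoc)
  also have "(2 ^ j :: real) powr p * ((1/2) ^ j) powr p = 1"
    by (subst powr_mult[symmetric]) (auto simp flip: power_mult_distrib)
  finally show "dq p u h j \<le> dir_norm p u h" by simp
qed

section \<open>Test functions have finite energy\<close>

lemma Lpow_test_fun: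
  assumes "test_fun f" "p > 0" shows "Lpow p f < \<infinity>"
  using test_fun_powr[OF assms] by (simp add: Lpow_def integrable_iff_bounded)

lemma test_fun_W1p:
  fixes u :: "'a::euclidean_space \<Rightarrow> real"
  assumes t: "test_fun u" and p: "p > 1"
  shows "W1p p u"
proof -
  note [measurable] = test_fun_borel[OF t] fd_test_borel[OF t]
  define G where "G x = (\<Sum>b\<in>Basis. frechet_derivative u (at x) b *\<^sub>R b)" for x
  have [measurable]: "G \<in> borel_measurable borel" unfolding G_def by measurable
  have Gb: "G x \<bullet> b = frechet_derivative u (at x) b" if "b \<in> Basis" for x b
    using that by (simp add: G_def)
  obtain R where R: "R > 0" "\<And>x. norm x > R \<Longrightarrow> u x = 0" using t test_fun_iff by blast
  have G0: "G x = 0" if "norm x > R" for x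
    using frechet_derivative_zero_outside[OF R(2) that] by (simp add: G_def)
  obtain B where B: "\<And>b x. \<bar>frechet_derivative u (at x) b\<bar> \<le> B b"
    using test_fun_bounded[OF test_fun_dd[OF t]] by metis
  have GB: "norm (G x) \<le> (\<Sum>b\<in>Basis. B b)" for x
    unfolding G_def by (rule order.trans[OF norm_sum]) (auto intro!: sum_mono B)
  have "integrable lborel (\<lambda>x. \<bar>norm (G x)\<bar> powr p)"
  proof (rule integrable_bounded_support)
    show "\<bar>\<bar>norm (G x)\<bar> powr p\<bar> \<le> (\<Sum>b\<in>Basis. B b) powr p" for x
      using GB[of x] p by (simp add: powr_mono2)
    show "norm x > R \<Longrightarrow> \<bar>norm (G x)\<bar> powr p = 0" for x using G0 by simp
  qed measurable
  then have "Lpow p (\<lambda>x. norm (G x)) < \<infinity>" by (simp add: Lpow_def integrable_iff_bounded)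
  then have L: "Lp_fun p (\<lambda>x. norm (G x))" by (subst Lp_fun_iff_Lpow) auto
  have "is_weak_grad u G" unfolding is_weak_grad_def
  proof (intro conjI allI impI ballI)
    show "G \<in> borel_measurable lebesgue" by (simp add: measurable_completion)
    fix \<phi> :: "'a \<Rightarrow> real" and v :: 'a assume \<phi>: "test_fun \<phi>" and v: "v \<in> Basis"
    note [measurable] = test_fun_borel[OF \<phi>] fd_test_borel[OF \<phi>]
    have "(\<integral>x. u x * frechet_derivative \<phi> (at x) v \<partial>lebesgue) = (\<integral>x. u x * frechet_derivative \<phi> (at x) v \<partial>lborel)"
      by (rule integral_lebesgue_eq) measurable
    also have "\<dots> = - (\<integral>x. (G x \<bullet> v) * \<phi> x \<partial>lborel)"
      unfolding Gb[OF v] by (rule integration_by_parts_test[OF t \<phi>])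
    also have "(\<integral>x. (G x \<bullet> v) * \<phi> x \<partial>lborel) = (\<integral>x. (G x \<bullet> v) * \<phi> x \<partial>lebesgue)"
      by (rule integral_lebesgue_eq[symmetric]) measurable
    finally show "(\<integral>x. u x * frechet_derivative \<phi> (at x) v \<partial>lebesgue) = - (\<integral>x. (G x \<bullet> v) * \<phi> x \<partial>lebesgue)" .
  qed
  with L Lpow_test_fun[OF t] p show ?thesis
    unfolding W1p_def Lp_weak_grad_def by (subst Lp_fun_iff_Lpow) auto
qed

lemma test_fun_BV:
  fixes u :: "'a::euclidean_space \<Rightarrow> real"
  assumes t: "test_fun u"
  shows "BV u"
proof -
  note [measurable] = test_fun_borel[OF t] fd_test_borel[OF t]
  have Lu: "loc_int u" using test_fun_bounded[OF t] loc_int_bounded by (metis test_fun_borel[OF t])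
  define K where "K = (\<Sum>b\<in>(Basis::'a set). \<integral>x. \<bar>frechet_derivative u (at x) b\<bar> \<partial>lborel)"
  have "total_variation u \<le> ereal K"
    unfolding total_variation_def
  proof (rule SUP_least)
    fix \<Phi> :: "'a \<Rightarrow> 'a"
    assume "\<Phi> \<in> {\<phi>. (\<forall>b\<in>Basis. test_fun (\<lambda>x. \<phi> x \<bullet> b)) \<and> (\<forall>x. norm (\<phi> x) \<le> 1)}"
    then have \<Phi>: "\<And>b. b \<in> Basis \<Longrightarrow> test_fun (\<lambda>x. \<Phi> x \<bullet> b)" "\<And>x. norm (\<Phi> x) \<le> 1" by auto
    have dm: "divergence \<Phi> \<in> borel_measurable borel" using \<Phi>(1) divergence_borel by blast
    have "(\<integral>x. u x * divergence \<Phi> x \<partial>lebesgue) = (\<integral>x. u x * divergence \<Phi> x \<partial>lborel)"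
      using dm by (intro integral_lebesgue_eq) auto
    also have "\<dots> = (\<Sum>b\<in>Basis. \<integral>x. u x * frechet_derivative (\<lambda>y. \<Phi> y \<bullet> b) (at x) b \<partial>lborel)"
      unfolding divergence_def sum_distrib_left
      by (rule Bochner_Integration.integral_sum) (rule integrable_loc_int_test[OF Lu test_fun_dd[OF \<Phi>(1)]])
    also have "\<dots> \<le> K" unfolding K_def
    proof (rule sum_mono)
      fix b :: 'a assume b: "b \<in> Basis"
      have i: "integrable lborel (\<lambda>x. \<bar>frechet_derivative u (at x) b\<bar>)"
        using integrable_test[OF test_fun_dd[OF t]] by simp
      have "\<bar>\<Phi> x \<bullet> b\<bar> \<le> 1" for x using \<Phi>(2)[of x] Basis_le_norm[OF b, of "\<Phi> x"] by linarith
      then have le: "\<bar>frechet_derivative u (at x) b * (\<Phi> x \<bullet> b)\<bar> \<le> \<bar>frechet_derivative u (at x) b\<bar>" for x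
        unfolding abs_mult by (simp add: mult_left_le)
      have "(\<integral>x. u x * frechet_derivative (\<lambda>y. \<Phi> y \<bullet> b) (at x) b \<partial>lborel)
         = - (\<integral>x. frechet_derivative u (at x) b * (\<Phi> x \<bullet> b) \<partial>lborel)"
        by (rule integration_by_parts_test[OF t \<Phi>(1)[OF b]])
      also have "\<dots> \<le> \<bar>\<integral>x. frechet_derivative u (at x) b * (\<Phi> x \<bullet> b) \<partial>lborel\<bar>" by simp
      also have "\<dots> \<le> (\<integral>x. \<bar>frechet_derivative u (at x) b * (\<Phi> x \<bullet> b)\<bar> \<partial>lborel)" by (rule integral_abs_bound)
      also have "\<dots> \<le> (\<integral>x. \<bar>frechet_derivative u (at x) b\<bar> \<partial>lborel)"
        by (rule integral_mono'[OF i]) (use le in auto)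
      finally show "(\<integral>x. u x * frechet_derivative (\<lambda>y. \<Phi> y \<bullet> b) (at x) b \<partial>lborel)
         \<le> (\<integral>x. \<bar>frechet_derivative u (at x) b\<bar> \<partial>lborel)" .
    qed
    finally show "ereal (\<integral>x. u x * divergence \<Phi> x \<partial>lebesgue) \<le> ereal K" by simp
  qed
  also have "\<dots> < \<infinity>" by simp
  finally show ?thesis
    using Lpow_test_fun[OF t, of 1] unfolding BV_def by (subst Lp_fun_iff_Lpow) auto
qed

lemma test_fun_Xp: "test_fun u \<Longrightarrow> p \<ge> 1 \<Longrightarrow> Xp p u"
  by (simp add: Xp_def test_fun_W1p test_fun_BV)

section \<open>Continuity of the energies in the direction\<close>

text \<open>A substitute for the usual argument with a seminorm: q is a p-th power and subadditive
  only up to 1 + e and C. Applied to s + h and to s = (s + h) + (-h), the hypothesis bounds the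
  change of q from both sides.\<close>

lemma continuous_on_eps_subadditive:
  fixes q :: "'a::real_normed_vector \<Rightarrow> real"
  assumes nn: "\<And>x. q x \<ge> 0" and lim: "(q \<longlongrightarrow> 0) (nhds 0)"
    and sub: "\<And>e. e > 0 \<Longrightarrow> \<exists>C\<ge>0. \<forall>a b. q (a + b) \<le> (1 + e) * q a + C * q b"
  shows "continuous_on UNIV q"
  unfolding continuous_on_eq_continuous_at[OF open_UNIV] isCont_def
proof (intro ballI)
  fix s :: 'a
  have "((\<lambda>h. q (s + h)) \<longlongrightarrow> q s) (at 0)"
  proof (rule tendstoI)
    fix r :: real assume r: "r > 0"
    \<comment> \<open>Makes e q(s) at most r/4; the cap 1/4 controls the product of e with the
      growth r/2 of q(s + h).\<close>
    define e where "e = min (1/4) (r / (4 * (q s + 1)))"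
    have e: "e > 0" "e \<le> 1/4" using r nn[of s] unfolding e_def
      by (simp add: add_nonneg_pos, intro min.cobounded1)
    have "e * (q s + 1) \<le> r / (4 * (q s + 1)) * (q s + 1)" using nn[of s] by (intro mult_right_mono) (auto simp: e_def)
    also have "\<dots> = r / 4" using nn[of s] by (simp add: field_simps)
    finally have eq: "e * q s \<le> r / 4" using e by (simp add: algebra_simps)
    obtain C where C: "C \<ge> 0" "\<And>a b. q (a + b) \<le> (1 + e) * q a + C * q b" using sub[OF e(1)] by blast
    have l: "(q \<longlongrightarrow> 0) (at 0)" using lim by (rule tendsto_mono[rotated]) (simp add: at_within_le_nhds)
    have l': "((\<lambda>h. q (- h)) \<longlongrightarrow> 0) (at 0)"
    proof (rule filterlim_compose[OF lim])
      have "((\<lambda>h. - h) \<longlongrightarrow> - (0::'a)) (at 0)" by (intro tendsto_intros)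
      then show "((\<lambda>h. - h) \<longlongrightarrow> (0::'a)) (at 0)" by simp
    qed
    have lC: "((\<lambda>h. C * q h) \<longlongrightarrow> C * 0) (at 0)" "((\<lambda>h. C * q (- h)) \<longlongrightarrow> C * 0) (at 0)"
      by (intro tendsto_mult tendsto_const l l')+
    have "\<forall>\<^sub>F h in at 0. C * q h < r / 4" "\<forall>\<^sub>F h in at 0. C * q (- h) < r / 4"
      by (rule order_tendstoD(2)[OF lC(1)] order_tendstoD(2)[OF lC(2)], use r in simp)+
    then show "\<forall>\<^sub>F h in at 0. dist (q (s + h)) (q s) < r"
    proof eventually_elim
      case (elim h)
      have 1: "q (s + h) \<le> (1 + e) * q s + C * q h" by (rule C)
      have 2: "q s \<le> (1 + e) * q (s + h) + C * q (- h)" using C(2)[of "s + h" "- h"] by simp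
      have 3: "q (s + h) < q s + r / 2" using 1 elim eq by (simp add: algebra_simps)
      have "e * q (s + h) \<le> e * (q s + r / 2)" using 3 e by (intro mult_left_mono) auto
      also have "\<dots> = e * q s + e * (r / 2)" by (simp add: distrib_left)
      also have "\<dots> \<le> r / 4 + 1 / 4 * (r / 2)" using r by (intro add_mono eq mult_right_mono e(2)) auto
      finally have "q s < q (s + h) + r" using 2 elim r by (simp add: algebra_simps)
      with 3 r show ?case by (simp add: dist_real_def abs_less_iff)
    qed
  qed
  then show "(q \<longlongrightarrow> q s) (at s)" by (subst LIM_offset_zero_iff) (auto simp: add.commute)
qed

lemma enn2real_le_linear:
  assumes "x \<le> ennreal a * y + ennreal c * z" "a \<ge> 0" "c \<ge> 0" "x < \<infinity>" "y < \<infinity>" "z < \<infinity>"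
  shows "enn2real x \<le> a * enn2real y + c * enn2real z"
proof -
  obtain x' y' z' where "x = ennreal x'" "x' \<ge> 0" "y = ennreal y'" "y' \<ge> 0" "z = ennreal z'" "z' \<ge> 0"
    using assms(4-6) by (cases x; cases y; cases z) auto
  then show ?thesis using assms(1-3) by (simp flip: ennreal_mult ennreal_plus)
qed

lemma tdiff_finite:
  fixes u :: "'a::euclidean_space \<Rightarrow> real"
  assumes "u \<in> borel_measurable borel" "p \<ge> 1" "Lpow p u < \<infinity>"
  shows "tdiff p u h < \<infinity>"
proof -
  have "tdiff p u h \<le> ennreal (2 powr (p + 1)) * Lpow p u" by (rule tdiff_le_Lpow) (use assms in auto)
  also have "\<dots> < \<infinity>" using assms by (simp add: ennreal_mult_less_top)
  finally show ?thesis .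
qed

lemma tdiff_continuous:
  fixes u :: "'a::euclidean_space \<Rightarrow> real"
  assumes u: "u \<in> borel_measurable borel" "p \<ge> 1" "Lpow p u < \<infinity>"
  shows "continuous_on UNIV (\<lambda>h. enn2real (tdiff p u h))"
proof (rule continuous_on_eps_subadditive)
  show "((\<lambda>h. enn2real (tdiff p u h)) \<longlongrightarrow> 0) (nhds 0)"
    using tendsto_enn2real[of "tdiff p u" 0] tdiff_tendsto_zero[OF u(1,3,2)] by simp
  show "\<exists>C\<ge>0. \<forall>a b. enn2real (tdiff p u (a + b)) \<le> (1 + e) * enn2real (tdiff p u a) + C * enn2real (tdiff p u b)"
    if e: "e > 0" for e
  proof -
    obtain C where "C \<ge> 0" "\<And>a b. tdiff p u (a + b) \<le> ennreal (1 + e) * tdiff p u a + ennreal C * tdiff p u b"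
      using tdiff_add_eps[OF u(2) e] u(1) by blast
    then show ?thesis
      using e tdiff_finite[OF u] by (intro exI[of _ C]) (auto intro!: enn2real_le_linear)
  qed
qed simp

lemma dir_norm_bound:
  fixes u :: "'a::euclidean_space \<Rightarrow> real"
  assumes u: "u \<in> borel_measurable borel" "p \<ge> 1" "Xp p u"
  shows "\<exists>K\<ge>0. \<forall>h. dir_norm p u h \<le> ennreal (K * norm h powr p)"
proof -
  obtain K where K: "K \<ge> 0" "\<And>h. norm h \<le> 1 \<Longrightarrow> dir_norm p u h \<le> ennreal K"
    using dir_norm_energy(4)[OF u] by blast
  have "dir_norm p u h \<le> ennreal (K * norm h powr p)" for h
  proof (cases "h = 0")
    case True
    have "dq p u 0 j = 0" for j by (simp add: dq_def)
    then show ?thesis using True by (simp add: dir_norm_eq_SUP[OF u])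
  next
    case False
    then have "dir_norm p u h = dir_norm p u (norm h *\<^sub>R sgn h)" by (simp add: sgn_div_norm)
    also have "\<dots> = ennreal (norm h powr p) * dir_norm p u (sgn h)"
      using False by (intro dir_norm_energy(3)[OF u]) auto
    also have "\<dots> \<le> ennreal (norm h powr p) * ennreal K"
      using False by (intro mult_left_mono K) (auto simp: norm_sgn)
    finally show ?thesis using K(1) by (simp add: ennreal_mult mult.commute)
  qed
  with K(1) show ?thesis by blast
qed

lemma dir_norm_continuous:
  fixes u :: "'a::euclidean_space \<Rightarrow> real"
  assumes u: "u \<in> borel_measurable borel" "p \<ge> 1" "Xp p u"
  shows "continuous_on UNIV (\<lambda>h. enn2real (dir_norm p u h))"
proof (rule continuous_on_eps_subadditive)
  obtain K where K: "K \<ge> 0" "\<And>h. dir_norm p u h \<le> ennreal (K * norm h powr p)"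
    using dir_norm_bound[OF u] by blast
  have fin: "dir_norm p u h < \<infinity>" for h using K(2)[of h] by (rule order.strict_trans1) simp
  have le: "enn2real (dir_norm p u h) \<le> K * norm h powr p" for h
    using K enn2real_mono[OF K(2)[of h]] by simp
  have l: "((\<lambda>h. K * norm h powr p) \<longlongrightarrow> K * norm (0::'a) powr p) (nhds (0::'a))"
    by (rule tendsto_mult[OF tendsto_const tendsto_powr'[OF tendsto_norm[OF filterlim_ident] tendsto_const]]) (use u(2) in auto)
  show "((\<lambda>h. enn2real (dir_norm p u h)) \<longlongrightarrow> 0) (nhds 0)"
  proof (rule tendsto_sandwich[OF _ _ tendsto_const])
    show "((\<lambda>h. K * norm h powr p) \<longlongrightarrow> 0) (nhds (0::'a))" using l u(2) by simp
  qed (use le in auto)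
  show "\<exists>C\<ge>0. \<forall>a b. enn2real (dir_norm p u (a + b)) \<le> (1 + e) * enn2real (dir_norm p u a) + C * enn2real (dir_norm p u b)"
    if e: "e > 0" for e
  proof -
    obtain C where C: "C \<ge> 0" "\<And>a b. tdiff p u (a + b) \<le> ennreal (1 + e) * tdiff p u a + ennreal C * tdiff p u b"
      using tdiff_add_eps[OF u(2) e] u(1) by blast
    \<comment> \<open>Each dyadic quotient satisfies the bound with the same e and C, so the
      supremum does too.\<close>
    have "dir_norm p u (a + b) \<le> ennreal (1 + e) * dir_norm p u a + ennreal C * dir_norm p u b" for a b
    proof (subst dir_norm_eq_SUP[OF u, of "a + b"], rule SUP_least)
      fix j
      have up: "dq p u x j \<le> dir_norm p u x" for x
        unfolding dir_norm_eq_SUP[OF u] by (rule SUP_upper) simp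
      have "dq p u (a + b) j \<le> ennreal ((2 ^ j) powr p) *
          (ennreal (1 + e) * tdiff p u ((1/2) ^ j *\<^sub>R a) + ennreal C * tdiff p u ((1/2) ^ j *\<^sub>R b))"
        unfolding dq_def scaleR_add_right by (intro mult_left_mono C) auto
      also have "\<dots> = ennreal (1 + e) * dq p u a j + ennreal C * dq p u b j"
        unfolding dq_def by (simp add: distrib_left mult.left_commute)
      also have "\<dots> \<le> ennreal (1 + e) * dir_norm p u a + ennreal C * dir_norm p u b"
        by (intro add_mono mult_left_mono up) auto
      finally show "dq p u (a + b) j \<le> ennreal (1 + e) * dir_norm p u a + ennreal C * dir_norm p u b" .
    qed
    then show ?thesis
      using e fin C(1) by (intro exI[of _ C]) (auto intro!: enn2real_le_linear)
  qed
qed simp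

section \<open>Weak compactness of measures on the sphere\<close>

text \<open>Helly's selection theorem concerns measures on the line. It is transported to the sphere
  through a continuous surjection of the Cantor set onto the sphere and a Borel section of it.\<close>

definition bitsum :: "(nat \<Rightarrow> real) \<Rightarrow> (nat \<Rightarrow> nat) \<Rightarrow> (nat \<Rightarrow> bool) \<Rightarrow> real" where
  "bitsum c i b = (\<Sum>j. if b (i j) then c j else 0)"

text \<open>Weierstrass test in the product topology. The reindexing i serves both uses: the
  identity for the ternary code, a pairing function for the coordinates of a vector.\<close>

lemma bitsum_continuous:
  assumes c: "summable c" "\<And>j. c j \<ge> 0"
  shows "continuous_on UNIV (bitsum c i)"
proof -
  have cont: "continuous_on UNIV (\<lambda>b::nat \<Rightarrow> bool. if b (i j) then c j else 0)" for j
  proof -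
    have "continuous_on UNIV (\<lambda>t::bool. if t then c j else 0)"
      by (rule Topological_Spaces.continuous_on_discrete)
    from continuous_on_compose2[OF this continuous_on_product_coordinates[of "i j"]] show ?thesis by simp
  qed
  have ul: "uniform_limit UNIV (\<lambda>n b. \<Sum>j<n. if b (i j) then c j else 0) (bitsum c i) sequentially"
    unfolding bitsum_def[abs_def] by (rule Weierstrass_m_test[OF _ c(1)]) (use c(2) in auto)
  have cs: "\<forall>\<^sub>F n in sequentially. continuous_on UNIV (\<lambda>b. \<Sum>j<n. if b (i j) then c j else 0)"
    by (intro always_eventually allI continuous_on_sum cont)
  show ?thesis by (rule uniform_limit_theorem[OF cs ul]) simp
qed

text \<open>Ternary digits 0 and 2, the middle-thirds set. Base 3 avoids the double expansions of
  base 2 and makes the code injective.\<close>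

definition cantor_code :: "(nat \<Rightarrow> bool) \<Rightarrow> real" where
  "cantor_code = bitsum (\<lambda>j. 2 * (1/3) ^ Suc j) id"

lemma third_sums: "(\<lambda>j. 2 * (1/3) ^ Suc (j + n)) sums ((1/3) ^ n :: real)"
proof -
  have "(\<lambda>j. (1/3 :: real) ^ j) sums (1 / (1 - 1/3))" by (rule geometric_sums) simp
  then have "(\<lambda>j. 2 * (1/3) ^ Suc n * (1/3 :: real) ^ j) sums (2 * (1/3) ^ Suc n * (1 / (1 - 1/3)))"
    by (rule sums_mult)
  then show ?thesis by (simp add: power_add algebra_simps)
qed

text \<open>At the first differing digit the gain 2 * 3^-(n+1) exceeds the largest possible tail,
  which sums to 3^-(n+1).\<close>

lemma cantor_code_less:
  assumes eq: "\<And>j. j < n \<Longrightarrow> b j = b' j" and "b n" "\<not> b' n"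
  shows "cantor_code b' < cantor_code b"
proof -
  define f where "f b j = (if b j then 2 * (1/3 :: real) ^ Suc j else 0)" for b :: "nat \<Rightarrow> bool" and j
  have sm0: "summable (\<lambda>j. 2 * (1/3 :: real) ^ Suc (j + k))" for k using third_sums sums_summable by blast
  have sm: "summable (f b)" for b
    by (rule summable_comparison_test[OF _ sm0[of 0]]) (auto simp: f_def)
  have code: "cantor_code b = (\<Sum>j<Suc n. f b j) + (\<Sum>j. f b (j + Suc n))" for b
  proof -
    have "cantor_code b = suminf (f b)" unfolding cantor_code_def bitsum_def f_def id_apply ..
    then show ?thesis using suminf_split_initial_segment[OF sm, of b "Suc n"] by (simp only: add.commute)
  qed
  have tail: "(\<Sum>j. f b (j + Suc n)) \<le> (1/3) ^ Suc n" for b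
  proof -
    have "(\<Sum>j. f b (j + Suc n)) \<le> (\<Sum>j. 2 * (1/3) ^ Suc (j + Suc n))"
      by (rule suminf_le[OF _ summable_ignore_initial_segment[OF sm] sm0]) (auto simp: f_def)
    also have "\<dots> = (1/3) ^ Suc n" using third_sums[of "Suc n"] by (simp add: sums_iff)
    finally show ?thesis .
  qed
  have tail0: "(\<Sum>j. f b (j + Suc n)) \<ge> 0" for b
    by (rule suminf_nonneg[OF summable_ignore_initial_segment[OF sm]]) (auto simp: f_def)
  have "(\<Sum>j<n. f b j) = (\<Sum>j<n. f b' j)" by (rule sum.cong) (auto simp: f_def eq)
  then have "(\<Sum>j<Suc n. f b j) = (\<Sum>j<Suc n. f b' j) + 2 * (1/3) ^ Suc n"
    using assms by (simp add: f_def)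
  then have "cantor_code b \<ge> (\<Sum>j<Suc n. f b' j) + 2 * (1/3) ^ Suc n" using code[of b] tail0[of b] by simp
  moreover have "cantor_code b' \<le> (\<Sum>j<Suc n. f b' j) + (1/3) ^ Suc n" using code[of b'] tail[of b'] by simp
  moreover have "(1/3 :: real) ^ Suc n > 0" by simp
  ultimately show ?thesis by linarith
qed

lemma cantor_code_inj: "inj cantor_code"
proof (rule injI, rule ccontr)
  fix b b' assume eq: "cantor_code b = cantor_code b'" and "b \<noteq> b'"
  then have ex: "\<exists>n. b n \<noteq> b' n" by auto
  define n where "n = (LEAST n. b n \<noteq> b' n)"
  have n: "b n \<noteq> b' n" unfolding n_def using ex by (rule LeastI_ex)
  have l: "\<And>j. j < n \<Longrightarrow> b j = b' j" unfolding n_def using not_less_Least by blast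
  show False
    using cantor_code_less[of n b b'] cantor_code_less[of n b' b] n l eq by (cases "b n") auto
qed

lemma compact_bits: "compact (UNIV :: (nat \<Rightarrow> bool) set)"
proof -
  have "compact_space (product_topology (\<lambda>i::nat. euclidean :: bool topology) UNIV)"
    unfolding compact_space_product_topology by (auto simp: compact_space_def finite_imp_compact)
  then show ?thesis
    unfolding euclidean_product_topology by (simp add: compact_space_def)
qed

text \<open>The partial sums are floor(2^n x) / 2^n, since doubling y changes its floor to twice the
  floor plus the parity bit.\<close>

lemma binary_expansion:
  fixes x :: real assumes x: "0 \<le> x" "x < 1"
  shows "(\<Sum>j. if odd \<lfloor>2 ^ Suc j * x\<rfloor> then (1/2) ^ Suc j else 0) = x"
proof -
  define f where "f j = (if odd \<lfloor>2 ^ Suc j * x\<rfloor> then (1/2 :: real) ^ Suc j else 0)" for j :: nat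
  have part: "(\<Sum>j<n. f j) = of_int \<lfloor>2 ^ n * x\<rfloor> / 2 ^ n" for n
  proof (induction n)
    case 0 then show ?case using x by (simp add: floor_eq_iff)
  next
    case (Suc n)
    define y where "y = 2 ^ n * x"
    have h: "\<lfloor>2 * y\<rfloor> = 2 * \<lfloor>y\<rfloor> + (if odd \<lfloor>2 * y\<rfloor> then 1 else 0)"
    proof -
      have "\<lfloor>2 * y\<rfloor> = 2 * \<lfloor>y\<rfloor> \<or> \<lfloor>2 * y\<rfloor> = 2 * \<lfloor>y\<rfloor> + 1"
        using floor_correct[of y] floor_correct[of "2 * y"] by linarith
      then show ?thesis by auto
    qed
    have "(\<Sum>j<Suc n. f j) = of_int \<lfloor>y\<rfloor> / 2 ^ n + (if odd \<lfloor>2 * y\<rfloor> then (1/2) ^ Suc n else 0)"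
      unfolding sum.lessThan_Suc Suc by (simp add: f_def y_def mult.assoc)
    also have "\<dots> = of_int (2 * \<lfloor>y\<rfloor> + (if odd \<lfloor>2 * y\<rfloor> then 1 else 0)) / 2 ^ Suc n"
      by (simp add: field_simps power_divide)
    also have "\<dots> = of_int \<lfloor>2 * y\<rfloor> / 2 ^ Suc n" by (simp only: h[symmetric])
    finally show ?case by (simp add: y_def mult.assoc)
  qed
  have "(\<lambda>n. of_int \<lfloor>2 ^ n * x\<rfloor> / 2 ^ n) \<longlonglongrightarrow> x"
  proof (rule tendsto_sandwich[OF _ _ _ tendsto_const])
    show "\<forall>\<^sub>F n in sequentially. of_int \<lfloor>2 ^ n * x\<rfloor> / 2 ^ n \<le> x"
      by (intro always_eventually allI) (simp add: field_simps)
    show "\<forall>\<^sub>F n in sequentially. x - (1/2) ^ n \<le> of_int \<lfloor>2 ^ n * x\<rfloor> / 2 ^ n"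
    proof (intro always_eventually allI)
      fix n :: nat
      have "2 ^ n * x - 1 \<le> of_int \<lfloor>2 ^ n * x\<rfloor>" by linarith
      then have "(2 ^ n * x - 1) / 2 ^ n \<le> of_int \<lfloor>2 ^ n * x\<rfloor> / 2 ^ n" by (intro divide_right_mono) auto
      then show "x - (1/2) ^ n \<le> of_int \<lfloor>2 ^ n * x\<rfloor> / 2 ^ n" by (simp add: diff_divide_distrib power_divide)
    qed
    have "(\<lambda>n. x - (1/2) ^ n) \<longlonglongrightarrow> x - 0" by (intro tendsto_diff tendsto_const LIMSEQ_power_zero) simp
    then show "(\<lambda>n. x - (1/2) ^ n) \<longlonglongrightarrow> x" by simp
  qed
  then have "f sums x" unfolding sums_def part .
  then have "suminf f = x" by (simp add: sums_iff)
  then show ?thesis by (simp only: f_def[abs_def])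
qed

text \<open>A pairing function splits one bit sequence into a sequence for each coordinate, and
  binary expansions map onto a cube around the sphere. The code identifies bit sequences with a
  compact subset C of the line. The image may be larger than the sphere.\<close>

lemma cantor_parametrisation:
  "\<exists>C (d :: real \<Rightarrow> 'a::euclidean_space). compact C \<and> C \<noteq> {} \<and> continuous_on UNIV d \<and> sphere 0 1 \<subseteq> d ` C"
proof -
  obtain idx :: "'a \<Rightarrow> nat" where idx: "inj_on idx Basis"
    using finite_imp_inj_to_nat_seg[OF finite_Basis] by blast
  define D where "D b = (\<Sum>v\<in>Basis. (4 * bitsum (\<lambda>j. (1/2) ^ Suc j) (\<lambda>j. prod_encode (idx v, j)) b - 2) *\<^sub>R v)" for b :: "nat \<Rightarrow> bool"
  have smh: "summable (\<lambda>j. (1/2 :: real) ^ Suc j)" by (intro summable_mult[of "\<lambda>j. (1/2 :: real) ^ j" "1/2", simplified] summable_geometric | simp)+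
  have Dc: "continuous_on UNIV D"
    unfolding D_def by (intro continuous_intros bitsum_continuous smh) auto
  have surj: "\<exists>b. D b = x" if x: "norm x = 1" for x
  proof -
    \<comment> \<open>Coordinates of unit vectors land in [1/4, 3/4]; the slack of the cube of side
      4 keeps them below 1, as \<open>binary_expansion\<close> requires.\<close>
    define y where "y v = (x \<bullet> v + 2) / 4" for v
    have y: "0 \<le> y v" "y v < 1" if "v \<in> Basis" for v
      using Basis_le_norm[OF that, of x] x by (auto simp: y_def)
    define b where "b n = (case prod_decode n of (k, j) \<Rightarrow> odd \<lfloor>2 ^ Suc j * y (inv_into Basis idx k)\<rfloor>)" for n
    have bits: "bitsum (\<lambda>j. (1/2) ^ Suc j) (\<lambda>j. prod_encode (idx v, j)) b = y v" if v: "v \<in> Basis" for v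
    proof -
      have "(\<lambda>j. if b (prod_encode (idx v, j)) then (1/2::real) ^ Suc j else 0)
          = (\<lambda>j. if odd \<lfloor>2 ^ Suc j * y v\<rfloor> then (1/2) ^ Suc j else 0)"
        using v idx by (intro ext) (simp add: b_def)
      then show ?thesis unfolding bitsum_def by (simp only: binary_expansion[OF y[OF v]])
    qed
    have "4 * y v - 2 = x \<bullet> v" for v by (simp add: y_def field_simps)
    then have "D b = (\<Sum>v\<in>Basis. (x \<bullet> v) *\<^sub>R v)"
      unfolding D_def by (intro sum.cong refl) (simp only: bits)
    then show ?thesis by (auto simp: euclidean_representation)
  qed
  have ec: "continuous_on UNIV cantor_code"
    unfolding cantor_code_def
    using third_sums[of 0, THEN sums_summable] by (intro bitsum_continuous) auto
  define C where "C = range cantor_code"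
  have C: "compact C" unfolding C_def by (rule compact_continuous_image[OF ec compact_bits])
  have "continuous_on C (inv cantor_code)"
    unfolding C_def by (rule continuous_on_inv[OF ec compact_bits]) (simp add: cantor_code_inj)
  then have "continuous_on C (D \<circ> inv cantor_code)"
    by (rule continuous_on_compose) (rule continuous_on_subset[OF Dc], simp)
  then obtain d where d: "continuous_on UNIV d" "\<And>x. x \<in> C \<Longrightarrow> d x = (D \<circ> inv cantor_code) x"
    using Tietze_unbounded[of C "D \<circ> inv cantor_code" UNIV] compact_imp_closed[OF C] by auto
  have "x \<in> d ` C" if x: "norm x = 1" for x
  proof -
    obtain b where "D b = x" using surj[OF x] by blast
    then have "d (cantor_code b) = x" using d(2)[of "cantor_code b"] by (simp add: C_def cantor_code_inj)
    then show ?thesis by (auto simp: C_def)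
  qed
  then have "sphere 0 1 \<subseteq> d ` C" by auto
  moreover have "C \<noteq> {}" by (simp add: C_def)
  ultimately show ?thesis using C d(1) by blast
qed

text \<open>The smallest point of each compact fibre. For x in the image, c x <= a means that x lies
  in the image of the part of C below a, and such images are closed.\<close>

lemma measurable_section:
  fixes d :: "real \<Rightarrow> 'a::euclidean_space"
  assumes C: "compact C" "C \<noteq> {}" and d: "continuous_on UNIV d"
  shows "\<exists>c\<in>borel_measurable borel. (\<forall>x. c x \<in> C) \<and> (\<forall>x\<in>d ` C. d (c x) = x)"
proof -
  obtain s0 where s0: "s0 \<in> C" using C by blast
  define S where "S x = {s\<in>C. d s = x}" for x
  \<comment> \<open>The default \<open>s0\<close> off the image keeps every value of c inside C,
    hence bounded.\<close>
  define c where "c x = (if x \<in> d ` C then Inf (S x) else s0)" for x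
  have cl: "closed C" "bounded C" using C compact_imp_closed compact_imp_bounded by auto
  have Sx: "Inf (S x) \<in> S x" if "x \<in> d ` C" for x
  proof (rule closed_contains_Inf)
    show "S x \<noteq> {}" using that by (auto simp: S_def)
    show "bdd_below (S x)" using cl(2) bounded_imp_bdd_below bdd_below_mono[of C "S x"] by (auto simp: S_def)
    have "S x = C \<inter> d -` {x}" by (auto simp: S_def)
    then show "closed (S x)"
      using cl(1) continuous_closed_vimage[of "{x}" d] d by (auto simp: continuous_on_eq_continuous_at)
  qed
  have "c x \<in> C" for x using Sx s0 by (auto simp: c_def S_def)
  moreover have "d (c x) = x" if "x \<in> d ` C" for x using Sx[OF that] that by (simp add: c_def S_def)
  moreover have "c \<in> borel_measurable borel"
  proof (rule borel_measurableI_le)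
    fix a :: real
    have im: "closed (d ` (C \<inter> {..a}))" for a
    proof -
      have "compact (C \<inter> {..a})" using C(1) by (intro compact_Int_closed) auto
      then show ?thesis by (intro compact_imp_closed compact_continuous_image continuous_on_subset[OF d]) auto
    qed
    have "closed (d ` C)"
      by (intro compact_imp_closed compact_continuous_image continuous_on_subset[OF d] C) auto
    have bb: "bdd_below (S x)" for x
      using cl(2) bounded_imp_bdd_below bdd_below_mono[of C "S x"] by (auto simp: S_def)
    have "{x \<in> space borel. c x \<le> a} = d ` (C \<inter> {..a}) \<union> (if s0 \<le> a then - (d ` C) else {})"
    proof (intro set_eqI iffI)
      fix x assume x: "x \<in> {x \<in> space borel. c x \<le> a}"
      show "x \<in> d ` (C \<inter> {..a}) \<union> (if s0 \<le> a then - (d ` C) else {})"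
      proof (cases "x \<in> d ` C")
        case True
        then have "c x \<in> C" "d (c x) = x" "c x \<le> a" using Sx[OF True] x by (auto simp: c_def S_def)
        then show ?thesis by force
      qed (use x in \<open>auto simp: c_def\<close>)
    next
      fix x assume "x \<in> d ` (C \<inter> {..a}) \<union> (if s0 \<le> a then - (d ` C) else {})"
      then consider s where "s \<in> C" "s \<le> a" "d s = x" | "s0 \<le> a" "x \<notin> d ` C" by (auto split: if_splits)
      then show "x \<in> {x \<in> space borel. c x \<le> a}"
      proof cases
        case 1
        then have "x \<in> d ` C" "Inf (S x) \<le> s" by (auto simp: S_def intro!: cInf_lower bb[unfolded S_def])
        then show ?thesis using 1 by (simp add: c_def)
      qed (simp add: c_def)
    qed
    moreover have "d ` (C \<inter> {..a}) \<in> sets borel" "- (d ` C) \<in> sets borel"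
      using im \<open>closed (d ` C)\<close> by auto
    ultimately show "{x \<in> space borel. c x \<le> a} \<in> sets borel" by auto
  qed
  ultimately show ?thesis by blast
qed

text \<open>The normalised measures are pushed to the line by c, where they sit in a fixed bounded
  set and are tight; the limit returns by d. Although c is only Borel, the functions integrated on
  the line are f composed with d, which are continuous, and d undoes c on the sphere.\<close>

lemma sphere_measures_weak_compact:
  fixes M :: "nat \<Rightarrow> 'a::euclidean_space measure"
  assumes sets [measurable_cong]: "\<And>n. sets (M n) = sets borel"
    and mass: "\<And>n. emeasure (M n) UNIV = ennreal (a n)" "\<And>n. a n \<ge> 0" "a \<longlonglongrightarrow> \<alpha>"
    and supp: "\<And>n. AE x in M n. norm x = 1"
  shows "\<exists>s M'. strict_mono (s :: nat \<Rightarrow> nat) \<and> sets M' = sets borel \<and> finite_measure M' \<and> (AE x in M'. norm x = 1) \<and>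
     (\<forall>f::'a \<Rightarrow> real. continuous_on UNIV f \<and> (\<exists>B. \<forall>x. \<bar>f x\<bar> \<le> B) \<longrightarrow>
        (\<lambda>n. integral\<^sup>L (M (s n)) f) \<longlonglongrightarrow> integral\<^sup>L M' f)"
proof -
  have space: "space (M n) = UNIV" for n using sets_eq_imp_space_eq[OF sets[of n]] by simp
  have finM: "finite_measure (M n)" for n by (rule finite_measureI) (simp add: space mass)
  have "\<alpha> \<ge> 0" by (rule LIMSEQ_le_const[OF mass(3)]) (use mass(2) in auto)
  then consider "\<alpha> = 0" | "\<alpha> > 0" by linarith
  then show ?thesis
  proof cases
    \<comment> \<open>Masses tending to 0 cannot be normalised, but then the null measure is the
      limit.\<close>
    case 1
    have "(\<lambda>n. integral\<^sup>L (M n) f) \<longlonglongrightarrow> 0" if f: "continuous_on UNIV f" "\<And>x. \<bar>f x\<bar> \<le> B" for f :: "'a \<Rightarrow> real" and B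
    proof (rule Lim_null_comparison)
      have [measurable]: "f \<in> borel_measurable borel" using f(1) by (rule borel_measurable_continuous_onI)
      show "\<forall>\<^sub>F n in sequentially. norm (integral\<^sup>L (M n) f) \<le> B * a n"
      proof (intro always_eventually allI)
        fix n
        interpret finite_measure "M n" by (rule finM)
        have "norm (integral\<^sup>L (M n) f) \<le> (\<integral>x. norm (f x) \<partial>M n)" by (rule integral_norm_bound)
        also have "\<dots> \<le> (\<integral>x. B \<partial>M n)"
          by (rule integral_mono') (use f(2) order.trans[OF abs_ge_zero f(2)] in auto)
        also have "\<dots> = B * a n" using mass(1,2)[of n] by (simp add: measure_def space)
        finally show "norm (integral\<^sup>L (M n) f) \<le> B * a n" .
      qed
      show "(\<lambda>n. B * a n) \<longlonglongrightarrow> 0" using tendsto_mult[OF tendsto_const mass(3), of B] 1 by simp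
    qed
    note null = this
    show ?thesis
    proof (intro exI[of _ id] exI[of _ "null_measure borel"] conjI allI impI)
      show "AE x in null_measure borel. norm (x::'a) = 1" by (rule AE_I[of _ _ UNIV]) auto
      show "finite_measure (null_measure borel :: 'a measure)" by (rule finite_measureI) simp
      fix f :: "'a \<Rightarrow> real" assume "continuous_on UNIV f \<and> (\<exists>B. \<forall>x. \<bar>f x\<bar> \<le> B)"
      then show "(\<lambda>n. integral\<^sup>L (M (id n)) f) \<longlonglongrightarrow> integral\<^sup>L (null_measure borel) f"
        using null by (auto simp: integral_null_measure)
    qed (auto simp: strict_mono_id)
  next
    case 2
    then have "\<forall>\<^sub>F n in sequentially. a n > 0" using mass(3) order_tendstoD(1) by blast
    then obtain N where N: "\<And>n. n \<ge> N \<Longrightarrow> a n > 0" by (auto simp: eventually_sequentially)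
    obtain C and d :: "real \<Rightarrow> 'a" where C: "compact C" "C \<noteq> {}" "continuous_on UNIV d" "sphere 0 1 \<subseteq> d ` C"
      using cantor_parametrisation by blast
    obtain c where c [measurable]: "c \<in> borel_measurable borel" and cC: "\<And>x. c x \<in> C" "\<And>x. norm x = 1 \<Longrightarrow> d (c x) = x"
      using measurable_section[OF C(1-3)] C(4) by (metis in_mono mem_sphere_0)
    have [measurable]: "d \<in> borel_measurable borel" using C(3) by (rule borel_measurable_continuous_onI)
    \<comment> \<open>The shift by N skips the finitely many indices at which the mass may
      vanish.\<close>
    define P where "P n = density (M (n + N)) (\<lambda>_. ennreal (1 / a (n + N)))" for n
    have setsP [measurable_cong, simp]: "sets (P n) = sets borel" for n by (simp add: P_def sets)
    have massP: "emeasure (P n) UNIV = 1" for n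
      using N[of "n + N"] mass(1)[of "n + N"] space[of "n + N"]
      by (simp add: P_def emeasure_density nn_integral_cmult sets flip: ennreal_mult)
    have probP: "prob_space (P n)" for n
      by (rule prob_spaceI) (use massP space in \<open>simp add: P_def\<close>)
    define \<nu> where "\<nu> n = distr (P n) borel c" for n
    have rd: "real_distribution (\<nu> n)" for n
    proof -
      interpret prob_space "P n" by (rule probP)
      show ?thesis unfolding \<nu>_def by (rule real_distribution_distr) measurable
    qed
    obtain l where l: "l > 0" "\<And>x. x \<in> C \<Longrightarrow> \<bar>x\<bar> \<le> l" using compact_imp_bounded[OF C(1)] by (auto simp: bounded_pos)
    have tight: "tight \<nu>" unfolding tight_def
    proof (intro conjI allI impI)
      fix e :: real assume e: "e > 0"
      \<comment> \<open>The half-open interval starts at -l - 1 so as to contain the point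
        -l.\<close>
      have "measure (\<nu> n) {- l - 1<..l} = 1" for n
      proof -
        interpret prob_space "P n" by (rule probP)
        have "c -` {- l - 1<..l} \<inter> space (P n) = space (P n)" using l cC(1) by (force simp: abs_le_iff)
        then show ?thesis unfolding \<nu>_def by (simp add: measure_distr prob_space)
      qed
      then show "\<exists>a b. a < b \<and> (\<forall>n. 1 - e < measure (\<nu> n) {a<..b})"
        using e l by (intro exI[of _ "- l - 1"] exI[of _ l]) auto
    qed (rule rd)
    obtain r \<nu>' where r: "strict_mono r" "real_distribution \<nu>'" "weak_conv_m (\<nu> \<circ> id \<circ> r) \<nu>'"
      using tight_imp_convergent_subsubsequence[OF tight strict_mono_id] by blast
    interpret \<nu>': real_distribution \<nu>' by (rule r(2))
    define s where "s n = r n + N" for n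
    have s: "strict_mono s" using r(1) by (auto simp: s_def strict_mono_def)
    define M' where "M' = density (distr \<nu>' borel d) (\<lambda>_. ennreal \<alpha>)"
    have setsM': "sets M' = sets borel" by (simp add: M'_def)
    have spaceM': "space M' = UNIV" by (simp add: M'_def)
    have intM': "integral\<^sup>L M' f = \<alpha> * (\<integral>x. f (d x) \<partial>\<nu>')" if [measurable]: "f \<in> borel_measurable borel" for f :: "'a \<Rightarrow> real"
      unfolding M'_def using 2 by (subst integral_density) (auto simp: integral_distr)
    have finM': "finite_measure M'"
    proof (rule finite_measureI)
      have "emeasure M' (space M') = ennreal \<alpha> * emeasure (distr \<nu>' borel d) UNIV"
        unfolding M'_def by (simp add: emeasure_density nn_integral_cmult)
      also have "emeasure (distr \<nu>' borel d) UNIV = 1"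
        using \<nu>'.emeasure_space_1 by (simp add: emeasure_distr)
      finally show "emeasure M' (space M') \<noteq> \<infinity>" by simp
    qed
    have conv: "(\<lambda>n. integral\<^sup>L (M (s n)) f) \<longlonglongrightarrow> integral\<^sup>L M' f"
      if f: "continuous_on UNIV f" "\<And>x. \<bar>f x\<bar> \<le> B" for f :: "'a \<Rightarrow> real" and B
    proof -
      have [measurable]: "f \<in> borel_measurable borel" using f(1) by (rule borel_measurable_continuous_onI)
      have "(\<lambda>n. \<integral>x. f (d x) \<partial>((\<nu> \<circ> id \<circ> r) n)) \<longlonglongrightarrow> (\<integral>x. f (d x) \<partial>\<nu>')"
      proof (rule weak_conv_imp_integral_bdd_continuous_conv[of _ _ _ B])
        show "isCont (\<lambda>x. f (d x)) x" for x
          using continuous_on_compose2[OF f(1) C(3)] by (simp add: continuous_on_eq_continuous_at)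
      qed (use r rd f in \<open>auto simp: o_def\<close>)
      then have l1: "(\<lambda>n. a (s n) * (\<integral>x. f (d x) \<partial>\<nu> (r n))) \<longlonglongrightarrow> \<alpha> * (\<integral>x. f (d x) \<partial>\<nu>')"
        using LIMSEQ_subseq_LIMSEQ[OF mass(3) s] by (intro tendsto_mult) (auto simp: o_def)
      have "a (s n) * (\<integral>x. f (d x) \<partial>\<nu> (r n)) = integral\<^sup>L (M (s n)) f" for n
      proof -
        have "(\<integral>x. f (d x) \<partial>\<nu> (r n)) = (\<integral>x. f (d (c x)) \<partial>P (r n))"
          unfolding \<nu>_def by (subst integral_distr) auto
        also have "\<dots> = (\<integral>x. 1 / a (s n) * f (d (c x)) \<partial>M (s n))"
          unfolding P_def s_def using N[of "r n + N"]
          by (subst integral_density) (auto simp: sets)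
        also have "\<dots> = 1 / a (s n) * (\<integral>x. f (d (c x)) \<partial>M (s n))" by (rule integral_mult_right_zero)
        also have "(\<integral>x. f (d (c x)) \<partial>M (s n)) = (\<integral>x. f x \<partial>M (s n))"
          by (rule integral_cong_AE) (use supp[of "s n"] cC(2) in \<open>auto simp: sets\<close>)
        finally show ?thesis using N[of "s n"] by (simp add: s_def)
      qed
      then show ?thesis using l1 intM'[of f] by simp
    qed
    \<comment> \<open>Since d may take values off the sphere, the support of the limit is recovered
      by testing with a bounded continuous function that vanishes exactly on the sphere.\<close>
    have "AE x in M'. norm x = 1"
    proof -
      define f where "f x = min 1 \<bar>norm x - 1\<bar>" for x :: 'a
      have fc: "continuous_on UNIV f" unfolding f_def by (intro continuous_intros)
      have fb: "\<bar>f x\<bar> \<le> 1" for x by (simp add: f_def)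
      have [measurable]: "f \<in> borel_measurable borel" using fc by (rule borel_measurable_continuous_onI)
      have "integral\<^sup>L (M n) f = 0" for n
        by (rule integral_eq_zero_AE) (use supp[of n] in \<open>auto simp: f_def\<close>)
      then have z: "integral\<^sup>L M' f = 0" using LIMSEQ_unique[OF conv[OF fc fb]] by simp
      interpret finite_measure M' by (rule finM')
      have "integrable M' f"
        by (rule integrable_const_bound[of _ 1]) (use fb in \<open>auto simp: measurable_cong_sets[OF setsM' refl]\<close>)
      then have "AE x in M'. f x = 0"
        using z by (subst (asm) integral_nonneg_eq_0_iff_AE) (auto simp: f_def)
      then show ?thesis by eventually_elim (auto simp: f_def min_def split: if_splits)
    qed
    then show ?thesis using s setsM' finM' conv by blast
  qed
qed

section \<open>The nonlocal energies\<close>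

lemma AE_lborel_reflect:
  fixes P :: "'a::euclidean_space \<Rightarrow> bool"
  assumes "AE z in lborel. P z"
  shows "AE y in lborel. P (a - y)"
proof -
  obtain N where N: "{z. \<not> P z} \<subseteq> N" "emeasure lborel N = 0" "N \<in> sets borel"
    using AE_E[OF assms] by auto
  have m: "{y. a - y \<in> N} \<in> sets borel"
  proof -
    have "(\<lambda>y. a - y) -` N \<inter> space borel \<in> sets borel" by (rule measurable_sets[OF _ N(3)]) measurable
    then show ?thesis by (simp add: vimage_def)
  qed
  have "emeasure lborel {y. a - y \<in> N} = (\<integral>\<^sup>+y. indicator {y. a - y \<in> N} y \<partial>lborel)" using m by simp
  also have "\<dots> = (\<integral>\<^sup>+y. indicator N (a - y) \<partial>lborel)" by (rule nn_integral_cong) (simp add: indicator_def)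
  also have "\<dots> = (\<integral>\<^sup>+y. indicator N y \<partial>lborel)"
    using N(3) by (intro nn_integral_lborel_reflect) simp
  also have "\<dots> = 0" using N by simp
  finally show ?thesis using N(1) m by (intro AE_I[of _ _ "{y. a - y \<in> N}"]) auto
qed

definition kernel_energy :: "('a::euclidean_space \<Rightarrow> real) \<Rightarrow> real \<Rightarrow> ('a \<Rightarrow> real) \<Rightarrow> ennreal" where
  "kernel_energy r p u = (\<integral>\<^sup>+z. ennreal (r z / norm z powr p) * tdiff p u z \<partial>lborel)"

text \<open>Vanishing tails for every s > 0 and a convergent \<open>kernel_mass\<close> are the
  working form of condition (A); the last section proves the passage both ways.\<close>

definition kernel_tail :: "('a::euclidean_space \<Rightarrow> real) \<Rightarrow> real \<Rightarrow> real \<Rightarrow> ennreal" where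
  "kernel_tail r p s = (\<integral>\<^sup>+z. ennreal (r z / norm z powr p) * indicator {z. norm z \<ge> s} z \<partial>lborel)"

definition kernel_mass :: "('a::euclidean_space \<Rightarrow> real) \<Rightarrow> ennreal" where
  "kernel_mass r = (\<integral>\<^sup>+z. ennreal (r z) * indicator (ball 0 1) z \<partial>lborel)"

lemma tdiff_borel [measurable]:
  fixes u :: "'a::euclidean_space \<Rightarrow> real"
  assumes [measurable]: "u \<in> borel_measurable borel"
  shows "tdiff p u \<in> borel_measurable borel"
  unfolding tdiff_def[abs_def] Lpow_def
  using lborel.borel_measurable_nn_integral[of "\<lambda>h x. ennreal (\<bar>u (x + h) - u x\<bar> powr p)" borel] by simp

text \<open>For fixed x the null set where the kernel differs from r is reflected into a null set of
  y, so representatives may be inserted before the substitution z = x - y and Fubini. The increment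
  then appears at -z, which has the same energy.\<close>

lemma F_tp_eq_kernel_energy:
  fixes u u' r :: "'a::euclidean_space \<Rightarrow> real"
  assumes [measurable]: "u' \<in> borel_measurable borel" "r \<in> borel_measurable borel"
    and u: "AE x in lborel. u x = u' x" and r: "AE z in lborel. \<rho> t z = r z" and r0: "\<And>z. r z \<ge> 0"
  shows "F_tp \<rho> t p u = kernel_energy r p u'"
proof -
  define g where "g x z = ennreal (\<bar>u' x - u' (x - z)\<bar> powr p / norm z powr p * r z)" for x z
  have [measurable]: "(\<lambda>(x, z). g x z) \<in> borel_measurable (borel \<Otimes>\<^sub>M borel)" unfolding g_def by measurable
  have gx [measurable]: "g x \<in> borel_measurable borel" for x unfolding g_def by measurable
  have "F_tp \<rho> t p u = (\<integral>\<^sup>+x. \<integral>\<^sup>+y. ennreal (\<bar>u x - u y\<bar> powr p / norm (x - y) powr p * \<rho> t (x - y)) \<partial>lborel \<partial>lborel)"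
    unfolding F_tp_def nn_integral_completion ..
  also have "\<dots> = (\<integral>\<^sup>+x. \<integral>\<^sup>+y. g x (x - y) \<partial>lborel \<partial>lborel)"
  proof (rule nn_integral_cong_AE, use u in eventually_elim)
    case (elim x)
    show ?case
    proof (rule nn_integral_cong_AE)
      show "AE y in lborel. ennreal (\<bar>u x - u y\<bar> powr p / norm (x - y) powr p * \<rho> t (x - y)) = g x (x - y)"
        using u AE_lborel_reflect[OF r, of x] by eventually_elim (simp add: g_def elim)
    qed
  qed
  also have "\<dots> = (\<integral>\<^sup>+x. \<integral>\<^sup>+z. g x z \<partial>lborel \<partial>lborel)"
    by (intro nn_integral_cong nn_integral_lborel_reflect) measurable
  also have "\<dots> = (\<integral>\<^sup>+z. \<integral>\<^sup>+x. g x z \<partial>lborel \<partial>lborel)"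
    by (rule lborel_pair.Fubini') (simp add: split_beta')
  also have "\<dots> = kernel_energy r p u'"
    unfolding kernel_energy_def
  proof (rule nn_integral_cong)
    fix z :: 'a
    have "(\<integral>\<^sup>+x. g x z \<partial>lborel) = (\<integral>\<^sup>+x. ennreal (r z / norm z powr p) * ennreal (\<bar>u' (x + - z) - u' x\<bar> powr p) \<partial>lborel)"
      using r0 by (intro nn_integral_cong) (simp add: g_def abs_minus_commute mult.commute flip: ennreal_mult)
    also have "\<dots> = ennreal (r z / norm z powr p) * tdiff p u' (- z)"
      unfolding tdiff_def Lpow_def by (rule nn_integral_cmult) measurable
    finally show "(\<integral>\<^sup>+x. g x z \<partial>lborel) = ennreal (r z / norm z powr p) * tdiff p u' z"
      by (simp add: tdiff_uminus)
  qed
  finally show ?thesis .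
qed

lemma Liminf_affine_ennreal:
  fixes c y :: ennreal assumes "c < \<infinity>"
  shows "liminf (\<lambda>k::nat. c * f k + y) = c * liminf f + y"
proof (rule Liminf_compose_continuous_mono[where f = "\<lambda>x. c * x + y"])
  show "continuous_on UNIV (\<lambda>x. c * x + y)"
    using assms by (intro continuous_on_add_ennreal ennreal_continuous_on_cmult continuous_on_const continuous_on_id) simp
  show "mono (\<lambda>x. c * x + y)" by (intro monoI add_right_mono mult_left_mono) auto
qed simp

text \<open>Only f may fail to converge. As liminf is not additive, Y is first replaced by its limit
  plus a small number, and the remaining affine map is continuous and monotone.\<close>

lemma le_liminf_affine:
  fixes X f Y :: "nat \<Rightarrow> ennreal"
  assumes le: "\<forall>\<^sub>F k in sequentially. X k \<le> c * f k + Y k" and X: "X \<longlonglongrightarrow> x" and Y: "Y \<longlonglongrightarrow> y"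
    and c: "c < \<infinity>" and y: "y < \<infinity>"
  shows "x \<le> c * liminf f + y"
proof (rule ennreal_le_epsilon)
  fix e :: real assume e: "e > 0"
  have "y < y + ennreal e" using y e by (cases y) (auto simp: ennreal_less_iff simp flip: ennreal_plus)
  then have "\<forall>\<^sub>F k in sequentially. Y k < y + ennreal e" using Y by (intro order_tendstoD)
  with le have ev: "\<forall>\<^sub>F k in sequentially. X k \<le> c * f k + (y + ennreal e)"
    by eventually_elim (meson add_left_mono less_imp_le order.trans)
  have "x = liminf X" using lim_imp_Liminf[OF _ X] by simp
  also have "\<dots> \<le> liminf (\<lambda>k. c * f k + (y + ennreal e))" by (rule Liminf_mono[OF ev])
  also have "\<dots> = c * liminf f + (y + ennreal e)" by (rule Liminf_affine_ennreal[OF c])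
  finally show "x \<le> c * liminf f + y + ennreal e" by (simp add: add.assoc)
qed

text \<open>The increment of u over m z + h is the increment of v over m z, plus the increment of u
  - v over m z, plus one of u over h. Only the first carries the sharp factor; the other two are
  bounded independently of m and z, which is what an unbounded m requires.\<close>

lemma tdiff_scaled_le:
  fixes u v :: "'a::euclidean_space \<Rightarrow> real"
  assumes [measurable]: "u \<in> borel_measurable borel" "v \<in> borel_measurable borel" and p: "p \<ge> 1"
    and C: "\<And>f g :: 'a \<Rightarrow> real. f \<in> borel_measurable borel \<Longrightarrow> g \<in> borel_measurable borel \<Longrightarrow>
       Lpow p (\<lambda>x. f x + g x) \<le> ennreal (1 + e) * Lpow p f + ennreal C * Lpow p g"
    and m: "m > 0"
  shows "tdiff p u (real m *\<^sub>R z + h) \<le> ennreal (1 + e) * (ennreal (real m powr p) * tdiff p v z)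
     + ennreal C * (ennreal (2 powr p) * (ennreal (2 powr (p + 1)) * Lpow p (\<lambda>x. v x - u x) + tdiff p u h))"
proof -
  let ?w = "real m *\<^sub>R z"
  have "tdiff p u (?w + h) = Lpow p (\<lambda>x. (v (x + ?w) - v x)
      + (((\<lambda>x. u x - v x) (x + ?w) - (\<lambda>x. u x - v x) x) + (u (x + ?w + h) - u (x + ?w))))"
    unfolding tdiff_def by (simp add: algebra_simps)
  also have "\<dots> \<le> ennreal (1 + e) * tdiff p v ?w + ennreal C *
      Lpow p (\<lambda>x. ((\<lambda>x. u x - v x) (x + ?w) - (\<lambda>x. u x - v x) x) + (u (x + ?w + h) - u (x + ?w)))"
    unfolding tdiff_def by (rule C) measurable
  also have "\<dots> \<le> ennreal (1 + e) * (ennreal (real m powr p) * tdiff p v z) + ennreal C *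
      (ennreal (2 powr p) * (ennreal (2 powr (p + 1)) * Lpow p (\<lambda>x. v x - u x) + tdiff p u h))"
  proof (intro add_mono mult_left_mono)
    show "tdiff p v ?w \<le> ennreal (real m powr p) * tdiff p v z"
      by (rule tdiff_multiple_le) (use p m in auto)
    have "Lpow p (\<lambda>x. ((\<lambda>x. u x - v x) (x + ?w) - (\<lambda>x. u x - v x) x) + (u (x + ?w + h) - u (x + ?w)))
       \<le> ennreal (2 powr p) * (tdiff p (\<lambda>x. u x - v x) ?w + Lpow p (\<lambda>x. u (x + ?w + h) - u (x + ?w)))"
      unfolding tdiff_def by (rule Lpow_add_le) (use p in auto)
    also have "Lpow p (\<lambda>x. u (x + ?w + h) - u (x + ?w)) = tdiff p u h"
      using Lpow_translate[of "\<lambda>x. u (x + h) - u x" p ?w] by (simp add: tdiff_def algebra_simps)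
    also have "tdiff p (\<lambda>x. u x - v x) ?w \<le> ennreal (2 powr (p + 1)) * Lpow p (\<lambda>x. u x - v x)"
      by (rule tdiff_le_Lpow) (use p in auto)
    also have "Lpow p (\<lambda>x. u x - v x) = Lpow p (\<lambda>x. v x - u x)"
      by (simp add: Lpow_def abs_minus_commute)
    finally show "Lpow p (\<lambda>x. ((\<lambda>x. u x - v x) (x + ?w) - (\<lambda>x. u x - v x) x) + (u (x + ?w + h) - u (x + ?w)))
       \<le> ennreal (2 powr p) * (ennreal (2 powr (p + 1)) * Lpow p (\<lambda>x. v x - u x) + tdiff p u h)"
      by (simp add: add_right_mono mult_left_mono)
  qed auto
  finally show ?thesis .
qed


section \<open>Radial projection and the two energy inequalities\<close>

text \<open>The cut-off to the unit ball makes the mass finite when r is only locally integrable;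
  the origin is removed because it has no direction.\<close>

definition sph :: "('a::euclidean_space \<Rightarrow> real) \<Rightarrow> 'a measure" where
  "sph r = distr (density lborel (\<lambda>z. ennreal (r z) * indicator (ball 0 1 - {0}) z)) borel (\<lambda>z. z /\<^sub>R norm z)"

lemma sets_sph [simp, measurable_cong]: "sets (sph r) = sets borel"
  by (simp add: sph_def)

lemma ball_borel [measurable]: "ball a s \<in> sets (borel :: 'a::euclidean_space measure)"
  by simp

lemma ball0_borel [measurable]: "ball 0 s - {0} \<in> sets (borel :: 'a::euclidean_space measure)"
  by simp

lemma nn_integral_sph:
  fixes r :: "'a::euclidean_space \<Rightarrow> real"
  assumes [measurable]: "r \<in> borel_measurable borel" "f \<in> borel_measurable borel"
  shows "(\<integral>\<^sup>+x. f x \<partial>sph r) = (\<integral>\<^sup>+z. ennreal (r z) * indicator (ball 0 1 - {0}) z * f (z /\<^sub>R norm z) \<partial>lborel)"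
  unfolding sph_def by (simp add: nn_integral_distr nn_integral_density)

lemma AE_lborel_nonzero: "AE z in lborel. z \<noteq> (0::'a::euclidean_space)"
  by (rule AE_lborel_singleton)

lemma emeasure_sph:
  fixes r :: "'a::euclidean_space \<Rightarrow> real"
  assumes [measurable]: "r \<in> borel_measurable borel"
  shows "emeasure (sph r) UNIV = kernel_mass r"
proof -
  have "emeasure (sph r) UNIV = (\<integral>\<^sup>+x. 1 \<partial>sph r)" by (simp add: sph_def)
  also have "\<dots> = (\<integral>\<^sup>+z. ennreal (r z) * indicator (ball 0 1 - {0}) z * 1 \<partial>lborel)"
    by (rule nn_integral_sph) measurable
  also have "\<dots> = kernel_mass r"
    unfolding kernel_mass_def
    by (rule nn_integral_cong_AE) (use AE_lborel_nonzero in eventually_elim, auto simp: indicator_def)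
  finally show ?thesis .
qed

lemma AE_sph:
  fixes r :: "'a::euclidean_space \<Rightarrow> real"
  assumes [measurable]: "r \<in> borel_measurable borel"
  shows "AE x in sph r. norm x = 1"
  unfolding sph_def by (subst AE_distr_iff) (auto simp: AE_density split: split_indicator)

lemma dq_borel [measurable]:
  fixes u :: "'a::euclidean_space \<Rightarrow> real"
  assumes [measurable]: "u \<in> borel_measurable borel"
  shows "(\<lambda>\<sigma>. dq p u \<sigma> j) \<in> borel_measurable borel"
  unfolding dq_def by measurable

lemma dir_norm_borel:
  fixes u :: "'a::euclidean_space \<Rightarrow> real"
  assumes u: "u \<in> borel_measurable borel" "p \<ge> 1" "Xp p u"
  shows "dir_norm p u \<in> borel_measurable borel"
proof -
  note [measurable] = u(1)
  have "dir_norm p u = (\<lambda>\<sigma>. SUP j. dq p u \<sigma> j)" using dir_norm_eq_SUP[OF u] by auto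
  then show ?thesis by simp
qed

text \<open>Inside the unit ball the factor |z|^p from homogeneity cancels the weight of the kernel.
  Outside, only the crude bound 2^(p+1) times the energy of u is available, and the tail pays for
  it.\<close>

lemma kernel_energy_le:
  fixes r u :: "'a::euclidean_space \<Rightarrow> real"
  assumes r [measurable]: "r \<in> borel_measurable borel" and r0: "\<And>z. r z \<ge> 0"
    and u: "u \<in> borel_measurable borel" "p \<ge> 1" "Xp p u"
  shows "kernel_energy r p u \<le> (\<integral>\<^sup>+\<sigma>. dir_norm p u \<sigma> \<partial>sph r) + ennreal (2 powr (p + 1)) * Lpow p u * kernel_tail r p 1"
proof -
  note [measurable] = u(1) dir_norm_borel[OF u]
  define G where "G = ennreal (2 powr (p + 1)) * Lpow p u"
  have "kernel_energy r p u \<le> (\<integral>\<^sup>+z. ennreal (r z) * indicator (ball 0 1 - {0}) z * dir_norm p u (z /\<^sub>R norm z)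
      + G * (ennreal (r z / norm z powr p) * indicator {z. norm z \<ge> 1} z) \<partial>lborel)"
    unfolding kernel_energy_def
  proof (rule nn_integral_mono_AE, use AE_lborel_nonzero in eventually_elim)
    case (elim z)
    show ?case
    proof (cases "norm z \<ge> 1")
      case True
      have "ennreal (r z / norm z powr p) * tdiff p u z \<le> ennreal (r z / norm z powr p) * G"
        unfolding G_def using u by (intro mult_left_mono tdiff_le_Lpow) auto
      then show ?thesis using True by (simp add: mult.commute)
    next
      case False
      have "tdiff p u z \<le> dir_norm p u (norm z *\<^sub>R (z /\<^sub>R norm z))" using elim dir_norm_energy(1)[OF u, of z] by simp
      also have "\<dots> = ennreal (norm z powr p) * dir_norm p u (z /\<^sub>R norm z)"
        using elim by (intro dir_norm_energy(3)[OF u]) simp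
      finally have "ennreal (r z / norm z powr p) * tdiff p u z
          \<le> ennreal (r z / norm z powr p) * (ennreal (norm z powr p) * dir_norm p u (z /\<^sub>R norm z))"
        by (rule mult_left_mono) simp
      also have "\<dots> = ennreal (r z / norm z powr p * norm z powr p) * dir_norm p u (z /\<^sub>R norm z)"
        by (subst ennreal_mult) (use r0 in \<open>auto simp: mult.assoc\<close>)
      also have "r z / norm z powr p * norm z powr p = r z" using elim by simp
      finally show ?thesis using False elim by simp
    qed
  qed
  also have "\<dots> = (\<integral>\<^sup>+\<sigma>. dir_norm p u \<sigma> \<partial>sph r) + G * kernel_tail r p 1"
    unfolding kernel_tail_def by (simp add: nn_integral_add nn_integral_cmult nn_integral_sph)
  finally show ?thesis by (simp add: G_def)
qed

lemma tdiff_sph_le: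
  fixes r u v :: "'a::euclidean_space \<Rightarrow> real"
  assumes r [measurable]: "r \<in> borel_measurable borel" and r0: "\<And>z. r z \<ge> 0"
    and uv [measurable]: "u \<in> borel_measurable borel" "v \<in> borel_measurable borel" and p: "p \<ge> 1"
    and d: "d > 0" and e: "e > 0" and s: "0 < s" "s \<le> d" "s \<le> 1"
    and C: "\<And>f g :: 'a \<Rightarrow> real. f \<in> borel_measurable borel \<Longrightarrow> g \<in> borel_measurable borel \<Longrightarrow>
       Lpow p (\<lambda>x. f x + g x) \<le> ennreal (1 + e) * Lpow p f + ennreal C * Lpow p g"
    and close: "\<And>h. norm h < s \<Longrightarrow>
       ennreal C * (ennreal (2 powr p) * (ennreal (2 powr (p + 1)) * Lpow p (\<lambda>x. v x - u x) + tdiff p u h)) \<le> ennreal e"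
  shows "(\<integral>\<^sup>+\<sigma>. tdiff p u (d *\<^sub>R \<sigma>) \<partial>sph r) \<le> ennreal ((1 + e) * d powr p) * kernel_energy r p v
     + (ennreal e * kernel_mass r + ennreal (2 powr (p + 1)) * Lpow p u * kernel_tail r p s)"
proof -
  define G where "G = ennreal (2 powr (p + 1)) * Lpow p u"
  have small: "tdiff p u (d *\<^sub>R (z /\<^sub>R norm z)) \<le> ennreal ((1 + e) * d powr p / norm z powr p) * tdiff p v z + ennreal e"
    if z: "z \<noteq> 0" "norm z < s" for z
  proof -
    \<comment> \<open>Positive because |z| < s <= d. The remainder h is shorter than |z|, hence
      shorter than s, where \<open>close\<close> applies.\<close>
    define m where "m = nat \<lfloor>d / norm z\<rfloor>"
    have "1 \<le> d / norm z" using z s by (simp add: field_simps)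
    then have fl: "\<lfloor>d / norm z\<rfloor> \<ge> 1" by simp
    then have m: "m > 0" "real m \<le> d / norm z" "d / norm z < real m + 1"
      unfolding m_def by auto
    define h where "h = (d / norm z - real m) *\<^sub>R z"
    have "norm h = (d / norm z - real m) * norm z" using m by (simp add: h_def)
    also have "\<dots> \<le> 1 * norm z" using m by (intro mult_right_mono) auto
    finally have h: "norm h < s" using z by simp
    have eq: "d *\<^sub>R (z /\<^sub>R norm z) = real m *\<^sub>R z + h"
      using z by (simp add: h_def scaleR_diff_left divide_inverse)
    have "tdiff p u (d *\<^sub>R (z /\<^sub>R norm z)) \<le> ennreal (1 + e) * (ennreal (real m powr p) * tdiff p v z) + ennreal e"
      unfolding eq using tdiff_scaled_le[OF uv p C m(1), of z h] close[OF h]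
      by (meson add_left_mono order.trans)
    also have "ennreal (1 + e) * (ennreal (real m powr p) * tdiff p v z)
       \<le> ennreal (1 + e) * (ennreal ((d / norm z) powr p) * tdiff p v z)"
      using m p by (intro mult_left_mono mult_right_mono ennreal_leI powr_mono2) auto
    also have "\<dots> = ennreal ((1 + e) * d powr p / norm z powr p) * tdiff p v z"
    proof -
      have "ennreal (1 + e) * ennreal ((d / norm z) powr p) = ennreal ((1 + e) * d powr p / norm z powr p)"
        using e d by (subst ennreal_mult[symmetric]) (auto simp: powr_divide)
      then show ?thesis by (simp only: mult.assoc[symmetric])
    qed
    finally show ?thesis by (simp add: add_right_mono)
  qed
  have "(\<integral>\<^sup>+\<sigma>. tdiff p u (d *\<^sub>R \<sigma>) \<partial>sph r)
     = (\<integral>\<^sup>+z. ennreal (r z) * indicator (ball 0 1 - {0}) z * tdiff p u (d *\<^sub>R (z /\<^sub>R norm z)) \<partial>lborel)"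
    by (rule nn_integral_sph) measurable
  also have "\<dots> \<le> (\<integral>\<^sup>+z. ennreal ((1 + e) * d powr p) * (ennreal (r z / norm z powr p) * tdiff p v z)
       + (ennreal e * (ennreal (r z) * indicator (ball 0 1) z)
       + G * (ennreal (r z / norm z powr p) * indicator {z. norm z \<ge> s} z)) \<partial>lborel)"
  proof (rule nn_integral_mono_AE, use AE_lborel_nonzero in eventually_elim)
    case (elim z)
    \<comment> \<open>The projected measure ignores the first region. Near 0 the multiples of z are
      used; in the annulus r <= r / |z|^p, so the crude bound is paid by the tail.\<close>
    consider "norm z \<ge> 1" | "norm z < s" | "norm z \<ge> s" "norm z < 1" by linarith
    then show ?case
    proof cases
      case 1
      then show ?thesis by simp
    next
      case 2
      have "ennreal (r z) * tdiff p u (d *\<^sub>R (z /\<^sub>R norm z))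
          \<le> ennreal (r z) * (ennreal ((1 + e) * d powr p / norm z powr p) * tdiff p v z + ennreal e)"
        by (rule mult_left_mono[OF small[OF elim 2]]) simp
      also have "\<dots> = ennreal ((1 + e) * d powr p) * (ennreal (r z / norm z powr p) * tdiff p v z) + ennreal e * ennreal (r z)"
      proof -
        have "ennreal (r z) * ennreal ((1 + e) * d powr p / norm z powr p)
            = ennreal ((1 + e) * d powr p) * ennreal (r z / norm z powr p)"
          using r0[of z] e by (simp flip: ennreal_mult'')
        then show ?thesis by (simp add: distrib_left mult.assoc[symmetric] mult.commute[of "ennreal e"])
      qed
      finally show ?thesis using 2 s elim by simp
    next
      case 3
      have "r z \<le> r z / norm z powr p"
      proof -
        have "norm z powr p \<le> 1" using 3 p by (simp add: powr_le1)
        then have "r z * norm z powr p \<le> r z" using r0[of z] by (simp add: mult_left_le)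
        then show ?thesis using elim by (simp add: field_simps)
      qed
      then have "ennreal (r z) * tdiff p u (d *\<^sub>R (z /\<^sub>R norm z)) \<le> ennreal (r z / norm z powr p) * G"
        unfolding G_def using p by (intro mult_mono ennreal_leI tdiff_le_Lpow) auto
      then show ?thesis using 3 elim by (simp add: mult.commute add_increasing add_increasing2)
    qed
  qed
  also have "\<dots> = ennreal ((1 + e) * d powr p) * kernel_energy r p v + (ennreal e * kernel_mass r + G * kernel_tail r p s)"
    unfolding kernel_energy_def kernel_mass_def kernel_tail_def
    by (simp add: nn_integral_add nn_integral_cmult)
  finally show ?thesis by (simp add: G_def)
qed


section \<open>Passage to the limit in the kernels\<close>

lemma dq_mono:
  fixes u :: "'a::euclidean_space \<Rightarrow> real"
  assumes u: "u \<in> borel_measurable borel" "p \<ge> 1"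
  shows "incseq (dq p u \<sigma>)"
proof (rule incseq_SucI)
  fix j
  have "tdiff p u ((1/2) ^ j *\<^sub>R \<sigma>) = tdiff p u (real 2 *\<^sub>R ((1/2) ^ Suc j *\<^sub>R \<sigma>))" by simp
  also have "\<dots> \<le> ennreal (real 2 powr p) * tdiff p u ((1/2) ^ Suc j *\<^sub>R \<sigma>)"
    by (rule tdiff_multiple_le[OF u]) simp
  finally have "dq p u \<sigma> j \<le> ennreal ((2 ^ j) powr p) * (ennreal (real 2 powr p) * tdiff p u ((1/2) ^ Suc j *\<^sub>R \<sigma>))"
    unfolding dq_def by (rule mult_left_mono) simp
  also have "\<dots> = dq p u \<sigma> (Suc j)"
    unfolding dq_def by (simp add: mult.assoc[symmetric] powr_mult mult.commute flip: ennreal_mult)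
  finally show "dq p u \<sigma> j \<le> dq p u \<sigma> (Suc j)" .
qed

lemma ennreal_le_affine_limit:
  fixes x L :: ennreal
  assumes "\<And>e. 0 < e \<Longrightarrow> e \<le> 1 \<Longrightarrow> x \<le> ennreal ((1 + e) * c) * L + ennreal (e * \<alpha>)" "c > 0" "\<alpha> \<ge> 0"
  shows "x \<le> ennreal c * L"
proof (cases "L = \<infinity>")
  case True
  then show ?thesis using assms(2) by (simp add: ennreal_mult_top)
next
  case False
  then obtain l where l: "L = ennreal l" "l \<ge> 0" by (cases L) auto
  have le: "x \<le> ennreal (c * l + e * (c * l + \<alpha>))" if "0 < e" "e \<le> 1" for e
  proof -
    have "x \<le> ennreal ((1 + e) * c * l + e * \<alpha>)"
      using assms(1)[OF that] assms(2,3) l that by (simp flip: ennreal_mult ennreal_plus)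
    then show ?thesis by (simp add: algebra_simps)
  qed
  have x: "x < \<infinity>" using le[of 1] by (rule order.strict_trans1) simp_all
  then obtain x' where x': "x = ennreal x'" "x' \<ge> 0" by (cases x) auto
  have "x' \<le> c * l"
  proof (rule field_le_epsilon)
    fix e :: real assume e: "e > 0"
    define b where "b = c * l + \<alpha> + 1"
    have b: "b > 0" "c * l + \<alpha> \<le> b" using assms l by (auto simp: b_def intro!: add_nonneg_pos)
    define e' where "e' = min 1 (e / b)"
    have e': "0 < e'" "e' \<le> 1" using e b by (auto simp: e'_def)
    have "0 \<le> c * l + e' * (c * l + \<alpha>)" using assms l e' by simp
    then have "x' \<le> c * l + e' * (c * l + \<alpha>)" using le[OF e'] x' by simp
    also have "e' * (c * l + \<alpha>) \<le> e / b * b"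
      using b e' e assms l by (intro mult_mono) (auto simp: e'_def)
    finally show "x' \<le> c * l + e" using b by simp
  qed
  then show ?thesis using x' l assms by (simp add: ennreal_mult[symmetric])
qed

text \<open>The upper bound passes to the limit because the directional norm is continuous on the
  sphere. In the lower bound the step d stays fixed while k tends to infinity, since T at a fixed
  step is bounded and continuous in the direction; e and then d are removed afterwards.\<close>

lemma kernel_limit:
  fixes r :: "nat \<Rightarrow> 'a::euclidean_space \<Rightarrow> real"
  assumes r [measurable]: "\<And>k. r k \<in> borel_measurable borel" and r0: "\<And>k z. r k z \<ge> 0" and p: "p \<ge> 1"
    and tail: "\<And>s. s > 0 \<Longrightarrow> (\<lambda>k. kernel_tail (r k) p s) \<longlonglongrightarrow> 0"
    and mass: "\<And>k. kernel_mass (r k) = ennreal (a k)" "\<And>k. a k \<ge> 0" "a \<longlonglongrightarrow> \<alpha>"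
  shows "\<exists>s \<mu>. strict_mono s \<and> sphere_measure \<mu> \<and>
    (\<forall>u. u \<in> borel_measurable borel \<longrightarrow> Xp p u \<longrightarrow> limsup (\<lambda>k. kernel_energy (r (s k)) p u) \<le> D_mu \<mu> p u) \<and>
    (\<forall>v u. (\<forall>k. v k \<in> borel_measurable borel) \<longrightarrow> u \<in> borel_measurable borel \<longrightarrow> Xp p u \<longrightarrow>
       (\<lambda>k. Lpow p (\<lambda>x. v k x - u x)) \<longlonglongrightarrow> 0 \<longrightarrow> D_mu \<mu> p u \<le> liminf (\<lambda>k. kernel_energy (r (s k)) p (v k)))"
proof -
  have \<alpha>: "\<alpha> \<ge> 0" by (rule LIMSEQ_le_const[OF mass(3)]) (use mass(2) in auto)
  obtain s :: "nat \<Rightarrow> nat" and M' where s: "strict_mono s" and M': "sets M' = sets borel" "finite_measure M'" "AE x in M'. norm x = 1"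
    and conv: "\<And>f::'a \<Rightarrow> real. continuous_on UNIV f \<Longrightarrow> (\<exists>B. \<forall>x. \<bar>f x\<bar> \<le> B) \<Longrightarrow>
        (\<lambda>n. integral\<^sup>L (sph (r (s n))) f) \<longlonglongrightarrow> integral\<^sup>L M' f"
    using sphere_measures_weak_compact[of "\<lambda>k. sph (r k)" a \<alpha>] emeasure_sph[OF r] AE_sph[OF r] mass by auto
  note [measurable_cong] = M'(1)
  have finS: "finite_measure (sph (r k))" for k
  proof (rule finite_measureI)
    have "space (sph (r k)) = UNIV" by (simp add: sph_def)
    then show "emeasure (sph (r k)) (space (sph (r k))) \<noteq> \<infinity>" by (simp add: emeasure_sph mass)
  qed
  have nnconv: "(\<lambda>n. \<integral>\<^sup>+x. ennreal (f x) \<partial>sph (r (s n))) \<longlonglongrightarrow> (\<integral>\<^sup>+x. ennreal (f x) \<partial>M')"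
    if f: "continuous_on UNIV f" "\<And>x. 0 \<le> f x" "\<And>x. f x \<le> B" for f :: "'a \<Rightarrow> real" and B
  proof -
    have [measurable]: "f \<in> borel_measurable borel" using f(1) by (rule borel_measurable_continuous_onI)
    have "integrable M f" if "finite_measure M" "sets M = sets borel" for M
    proof -
      interpret finite_measure M by fact
      note [measurable_cong] = that(2)
      show ?thesis by (rule integrable_const_bound[of _ B]) (use f in auto)
    qed
    then have nn: "(\<integral>\<^sup>+x. ennreal (f x) \<partial>M) = ennreal (integral\<^sup>L M f)" if "finite_measure M" "sets M = sets borel" for M
      using that f(2) by (intro nn_integral_eq_integral) auto
    have "\<exists>B. \<forall>x. \<bar>f x\<bar> \<le> B" using f by (intro exI[of _ B]) auto
    then show ?thesis
      unfolding nn[OF M'(2,1)] nn[OF finS sets_sph] using conv[OF f(1)] by (intro tendsto_ennrealI) auto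
  qed
  define \<mu> where "\<mu> = restrict_space M' (sphere 0 1)"
  have sp: "space M' = UNIV" using sets_eq_imp_space_eq[OF M'(1)] by simp
  have sph: "sphere_measure \<mu>"
  proof -
    have "finite_measure \<mu>" unfolding \<mu>_def by (rule finite_measure_restrict_space[OF M'(2)]) (simp add: M'(1) sp)
    moreover have "sets \<mu> = sets (restrict_space borel (sphere 0 1))"
      unfolding \<mu>_def by (rule sets_restrict_space_cong[OF M'(1)])
    ultimately show ?thesis by (simp add: sphere_measure_def)
  qed
  have int\<mu>: "(\<integral>\<^sup>+x. f x \<partial>\<mu>) = (\<integral>\<^sup>+x. f x \<partial>M')" for f
  proof -
    have "(\<integral>\<^sup>+x. f x \<partial>\<mu>) = (\<integral>\<^sup>+x. f x * indicator (sphere 0 1) x \<partial>M')"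
      unfolding \<mu>_def by (rule nn_integral_restrict_space) (simp add: M'(1) sp)
    also have "\<dots> = (\<integral>\<^sup>+x. f x \<partial>M')"
      by (rule nn_integral_cong_AE) (use M'(3) in eventually_elim, simp)
    finally show ?thesis .
  qed
  have ts: "(\<lambda>k. kernel_tail (r (s k)) p x) \<longlonglongrightarrow> 0" if "x > 0" for x
    using LIMSEQ_subseq_LIMSEQ[OF tail[OF that] s] by (simp add: o_def)
  have upper: "limsup (\<lambda>k. kernel_energy (r (s k)) p u) \<le> D_mu \<mu> p u"
    if u: "u \<in> borel_measurable borel" "Xp p u" for u
  proof -
    note X = u(1) p u(2)
    obtain K where K: "K \<ge> 0" "\<And>h. norm h \<le> 1 \<Longrightarrow> dir_norm p u h \<le> ennreal K"
      using dir_norm_energy(4)[OF X] by blast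
    \<comment> \<open>Truncation at K gives a bounded continuous function on the whole space that
      agrees with the directional norm on the sphere, where all the measures live.\<close>
    define f where "f h = min (enn2real (dir_norm p u h)) K" for h
    have fc: "continuous_on UNIV f" unfolding f_def by (intro continuous_intros dir_norm_continuous[OF X])
    have feq: "ennreal (f h) = dir_norm p u h" if h: "norm h = 1" for h
    proof -
      obtain l where l: "dir_norm p u h = ennreal l" "l \<ge> 0"
        using K(2)[of h] h by (cases "dir_norm p u h") (auto simp: top_unique)
      then have "l \<le> K" using K(1) K(2)[of h] h by simp
      then show ?thesis using l by (simp add: f_def)
    qed
    have fs: "(\<integral>\<^sup>+x. dir_norm p u x \<partial>sph (r k)) = (\<integral>\<^sup>+x. ennreal (f x) \<partial>sph (r k))" for k
      by (rule nn_integral_cong_AE) (use AE_sph[OF r, of k] in eventually_elim, simp add: feq)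
    have fM: "D_mu \<mu> p u = (\<integral>\<^sup>+x. ennreal (f x) \<partial>M')"
      unfolding D_mu_def int\<mu> by (rule nn_integral_cong_AE) (use M'(3) in eventually_elim, simp add: feq)
    define G where "G = ennreal (2 powr (p + 1)) * Lpow p u"
    have G: "G < \<infinity>" using Xp_Lpow[OF X] by (simp add: G_def ennreal_mult_less_top)
    have "(\<lambda>k. G * kernel_tail (r (s k)) p 1) \<longlonglongrightarrow> G * 0"
      using G by (intro ennreal_tendsto_cmult ts) auto
    then have "(\<lambda>k. (\<integral>\<^sup>+x. ennreal (f x) \<partial>sph (r (s k))) + G * kernel_tail (r (s k)) p 1) \<longlonglongrightarrow> D_mu \<mu> p u + G * 0"
      unfolding fM by (intro tendsto_add nnconv[OF fc, where B = K]) (use K in \<open>auto simp: f_def\<close>)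
    then have l: "limsup (\<lambda>k. (\<integral>\<^sup>+x. ennreal (f x) \<partial>sph (r (s k))) + G * kernel_tail (r (s k)) p 1) = D_mu \<mu> p u"
      by (subst lim_imp_Limsup) auto
    have "limsup (\<lambda>k. kernel_energy (r (s k)) p u)
       \<le> limsup (\<lambda>k. (\<integral>\<^sup>+x. ennreal (f x) \<partial>sph (r (s k))) + G * kernel_tail (r (s k)) p 1)"
      using kernel_energy_le[OF r r0 X] by (intro Limsup_mono always_eventually allI) (simp add: fs G_def)
    then show ?thesis unfolding l .
  qed
  have lower: "D_mu \<mu> p u \<le> liminf (\<lambda>k. kernel_energy (r (s k)) p (v k))"
    if v [measurable]: "\<And>k. v k \<in> borel_measurable borel" and u [measurable]: "u \<in> borel_measurable borel" and X: "Xp p u"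
      and lim: "(\<lambda>k. Lpow p (\<lambda>x. v k x - u x)) \<longlonglongrightarrow> 0" for v u
  proof -
    note X = u p X
    define L where "L = liminf (\<lambda>k. kernel_energy (r (s k)) p (v k))"
    have fin: "Lpow p u < \<infinity>" by (rule Xp_Lpow[OF X])
    define G where "G = ennreal (2 powr (p + 1)) * Lpow p u"
    have G: "G < \<infinity>" using fin by (simp add: G_def ennreal_mult_less_top)
    have tG: "tdiff p u h \<le> G" for h unfolding G_def by (rule tdiff_le_Lpow) (use p in auto)
    have scale: "(\<integral>\<^sup>+\<sigma>. tdiff p u (d *\<^sub>R \<sigma>) \<partial>M') \<le> ennreal (d powr p) * L" if d: "d > 0" for d
    proof (rule ennreal_le_affine_limit[OF _ _ \<alpha>])
      fix e :: real assume e: "0 < e" "e \<le> 1"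
      obtain C where C: "C \<ge> 0" "\<And>f g :: 'a \<Rightarrow> real. f \<in> borel_measurable borel \<Longrightarrow> g \<in> borel_measurable borel \<Longrightarrow>
         Lpow p (\<lambda>x. f x + g x) \<le> ennreal (1 + e) * Lpow p f + ennreal C * Lpow p g"
        using Lpow_add_eps[OF p e(1)] by blast
      \<comment> \<open>The constant in front of the error in \<open>tdiff_scaled_le\<close>, with C
        + 1 to keep it positive; the two error terms are then made smaller than e/2/B each.\<close>
      define B where "B = (C + 1) * 2 powr p"
      have B: "B > 0" using C by (simp add: B_def)
      have "\<forall>\<^sub>F h in nhds 0. tdiff p u h < ennreal (e / 2 / B)"
        by (rule order_tendstoD(2)[OF tdiff_tendsto_zero[OF u fin p]]) (use e B in simp)
      then obtain s0 where s0: "s0 > 0" "\<And>h. norm h < s0 \<Longrightarrow> tdiff p u h < ennreal (e / 2 / B)"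
        unfolding eventually_nhds_metric dist_norm by auto
      define x where "x = min s0 (min d 1)"
      have x: "0 < x" "x \<le> d" "x \<le> 1" "x \<le> s0" using s0 d by (auto simp: x_def)
      have ev: "\<forall>\<^sub>F k in sequentially. Lpow p (\<lambda>x. v k x - u x) < ennreal (e / 2 / B / 2 powr (p + 1))"
        by (rule order_tendstoD(2)[OF lim]) (use e B in simp)
      have ev2: "\<forall>\<^sub>F k in sequentially. (\<integral>\<^sup>+\<sigma>. tdiff p u (d *\<^sub>R \<sigma>) \<partial>sph (r (s k)))
          \<le> ennreal ((1 + e) * d powr p) * kernel_energy (r (s k)) p (v k)
             + (ennreal e * kernel_mass (r (s k)) + G * kernel_tail (r (s k)) p x)"
        using ev
      proof eventually_elim
        case (elim k)
        show ?case unfolding G_def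
        proof (rule tdiff_sph_le[OF r r0 u v p d e(1) x(1-3) C(2)])
          fix h :: 'a assume h: "norm h < x"
          have "ennreal (2 powr (p + 1)) * Lpow p (\<lambda>x. v k x - u x) + tdiff p u h
             \<le> ennreal (2 powr (p + 1)) * ennreal (e / 2 / B / 2 powr (p + 1)) + ennreal (e / 2 / B)"
            using elim s0(2)[of h] h x(4) by (intro add_mono mult_left_mono) auto
          also have "\<dots> = ennreal (e / B)" using e B by (simp flip: ennreal_mult ennreal_plus)
          finally have "ennreal C * (ennreal (2 powr p) * (ennreal (2 powr (p + 1)) * Lpow p (\<lambda>x. v k x - u x) + tdiff p u h))
             \<le> ennreal C * (ennreal (2 powr p) * ennreal (e / B))"
            by (intro mult_left_mono) auto
          also have "\<dots> = ennreal (C * 2 powr p * (e / B))" 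
            using C(1) e B by (simp add: mult.assoc flip: ennreal_mult)
          also have "\<dots> \<le> ennreal (B * (e / B))"
            using e B by (intro ennreal_leI mult_right_mono) (auto simp: B_def)
          also have "B * (e / B) = e" using B by simp
          finally show "ennreal C * (ennreal (2 powr p) * (ennreal (2 powr (p + 1)) * Lpow p (\<lambda>x. v k x - u x) + tdiff p u h)) \<le> ennreal e" .
        qed
      qed
      have cont: "(\<lambda>k. \<integral>\<^sup>+\<sigma>. tdiff p u (d *\<^sub>R \<sigma>) \<partial>sph (r (s k))) \<longlonglongrightarrow> (\<integral>\<^sup>+\<sigma>. tdiff p u (d *\<^sub>R \<sigma>) \<partial>M')"
      proof -
        have "continuous_on UNIV (\<lambda>\<sigma>. enn2real (tdiff p u (d *\<^sub>R \<sigma>)))"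
          using continuous_on_compose2[OF tdiff_continuous[OF u p fin], of UNIV "\<lambda>\<sigma>. d *\<^sub>R \<sigma>"]
          by (simp add: continuous_intros)
        moreover have "enn2real (tdiff p u (d *\<^sub>R \<sigma>)) \<le> enn2real G" for \<sigma>
          using tG[of "d *\<^sub>R \<sigma>"] G by (intro enn2real_mono) auto
        moreover have "ennreal (enn2real (tdiff p u h)) = tdiff p u h" for h
          using tdiff_finite[OF u p fin, of h] by (intro ennreal_enn2real) simp
        ultimately show ?thesis
          using nnconv[of "\<lambda>\<sigma>. enn2real (tdiff p u (d *\<^sub>R \<sigma>))" "enn2real G"] by simp
      qed
      have "(\<lambda>k. ennreal e * ennreal (a (s k)) + G * kernel_tail (r (s k)) p x) \<longlonglongrightarrow> ennreal e * ennreal \<alpha> + G * 0"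
        using G x LIMSEQ_subseq_LIMSEQ[OF mass(3) s]
        by (intro tendsto_add ennreal_tendsto_cmult tendsto_ennrealI ts) (auto simp: o_def)
      then have "(\<lambda>k. ennreal e * kernel_mass (r (s k)) + G * kernel_tail (r (s k)) p x) \<longlonglongrightarrow> ennreal (e * \<alpha>)"
        using e \<alpha> by (simp add: mass ennreal_mult)
      from le_liminf_affine[OF ev2 cont this]
      show "(\<integral>\<^sup>+\<sigma>. tdiff p u (d *\<^sub>R \<sigma>) \<partial>M') \<le> ennreal ((1 + e) * d powr p) * L + ennreal (e * \<alpha>)"
        by (simp add: L_def)
    qed (use d in simp)
    \<comment> \<open>The bound at a fixed step is now used at d = 2^-j, and monotonicity in j moves
      the supremum out of the integral.\<close>
    have "D_mu \<mu> p u = (\<integral>\<^sup>+\<sigma>. (SUP j. dq p u \<sigma> j) \<partial>M')"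
      unfolding D_mu_def int\<mu> by (intro nn_integral_cong dir_norm_eq_SUP[OF X])
    also have "\<dots> = (SUP j. \<integral>\<^sup>+\<sigma>. dq p u \<sigma> j \<partial>M')"
      by (rule nn_integral_monotone_convergence_SUP)
         (use dq_mono[OF u p] in \<open>auto simp: incseq_def le_fun_def\<close>)
    also have "\<dots> \<le> L"
    proof (rule SUP_least)
      fix j
      have "(\<integral>\<^sup>+\<sigma>. dq p u \<sigma> j \<partial>M') = ennreal ((2 ^ j) powr p) * (\<integral>\<^sup>+\<sigma>. tdiff p u ((1/2) ^ j *\<^sub>R \<sigma>) \<partial>M')"
        unfolding dq_def by (rule nn_integral_cmult) measurable
      also have "\<dots> \<le> ennreal ((2 ^ j) powr p) * (ennreal (((1/2) ^ j) powr p) * L)"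
        by (intro mult_left_mono scale) auto
      also have "\<dots> = ennreal ((2 ^ j) powr p * ((1/2) ^ j) powr p) * L"
        by (simp add: ennreal_mult mult.assoc)
      also have "(2 ^ j :: real) powr p * ((1/2) ^ j) powr p = 1"
        by (subst powr_mult[symmetric]) (auto simp flip: power_mult_distrib)
      finally show "(\<integral>\<^sup>+\<sigma>. dq p u \<sigma> j \<partial>M') \<le> L" by simp
    qed
    finally show ?thesis by (simp add: L_def)
  qed
  show ?thesis
    by (intro exI[of _ s] exI[of _ \<mu>]) (use s sph upper lower in blast)
qed

section \<open>Rigidity: what convergence of energies says about the kernels\<close>

lemma ennreal_squeeze_zero:
  fixes x y T :: "nat \<Rightarrow> ennreal"
  assumes x: "x \<longlonglongrightarrow> ennreal X" and y: "y \<longlonglongrightarrow> ennreal Y" and XY: "0 \<le> X" "X \<le> Y"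
    and le: "\<And>k. y k + T k \<le> x k"
  shows "T \<longlonglongrightarrow> 0"
proof (rule tendsto_zero_ennreal)
  fix e :: real assume e: "e > 0"
  have "\<forall>\<^sub>F k in sequentially. x k < ennreal (X + e / 2)"
    by (rule order_tendstoD(2)[OF x]) (use e XY in \<open>simp add: ennreal_less_iff\<close>)
  moreover have "\<forall>\<^sub>F k in sequentially. ennreal (Y - e / 2) \<le> y k"
  proof (cases "Y - e / 2 < 0")
    case True
    then show ?thesis by (simp add: ennreal_neg)
  next
    case False
    then have "\<forall>\<^sub>F k in sequentially. ennreal (Y - e / 2) < y k"
      by (intro order_tendstoD(1)[OF y]) (use e in \<open>simp add: ennreal_less_iff\<close>)
    then show ?thesis by eventually_elim simp
  qed
  ultimately show "\<forall>\<^sub>F k in sequentially. T k < ennreal e"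
  proof eventually_elim
    case (elim k)
    show ?case
    proof (rule ccontr)
      assume "\<not> T k < ennreal e"
      then have "ennreal (Y - e / 2) + ennreal e \<le> y k + T k" using elim by (intro add_mono) auto
      moreover have "ennreal (X + e / 2) \<le> ennreal (Y - e / 2) + ennreal e"
      proof (cases "Y - e / 2 < 0")
        case True
        then have "ennreal (Y - e / 2) = 0" by (simp add: ennreal_neg)
        moreover have "ennreal (X + e / 2) \<le> ennreal e" using True XY by (intro ennreal_leI) linarith
        ultimately show ?thesis by simp
      next
        case False
        then show ?thesis using XY e by (simp add: ennreal_leI flip: ennreal_plus)
      qed
      ultimately show False using elim le[of k] by (meson leD order.trans)
    qed
  qed
qed

lemma tdiff_dilate:
  fixes b :: "'a::euclidean_space \<Rightarrow> real"
  assumes [measurable]: "b \<in> borel_measurable borel"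
  shows "tdiff p b (2 *\<^sub>R h) = ennreal (2 ^ DIM('a)) * tdiff p (\<lambda>x. b (2 *\<^sub>R x)) h"
  unfolding tdiff_def Lpow_def
  by (subst nn_integral_lborel_affine[where c = 2 and t = 0]) (auto simp: scaleR_add_right)

text \<open>Once b and its translate have disjoint supports, T no longer depends on z. This
  saturation is the source of the strict inequality in
  \<open>kernel_energy_dilate_le\<close>.\<close>

lemma tdiff_disjoint_support:
  fixes b :: "'a::euclidean_space \<Rightarrow> real"
  assumes [measurable]: "b \<in> borel_measurable borel" and s: "\<And>x. norm x \<ge> s \<Longrightarrow> b x = 0"
    and z: "norm z \<ge> 2 * s" and p: "p \<ge> 1"
  shows "tdiff p b z = 2 * Lpow p b"
proof -
  have "\<bar>b (x + z) - b x\<bar> powr p = \<bar>b (x + z)\<bar> powr p + \<bar>b x\<bar> powr p" for x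
  proof -
    have "norm z \<le> norm (x + z) + norm x" by norm
    then have "norm x \<ge> s \<or> norm (x + z) \<ge> s" using z by linarith
    then have "b x = 0 \<or> b (x + z) = 0" using s by blast
    then show ?thesis using p by auto
  qed
  then have "tdiff p b z = Lpow p (\<lambda>x. b (x + z)) + Lpow p b"
    unfolding tdiff_def Lpow_def by (simp add: nn_integral_add)
  also have "\<dots> = 2 * Lpow p b" by (simp add: Lpow_translate mult_2)
  finally show ?thesis .
qed

lemma bump_Lpow:
  assumes s: "s > 0" and p: "p \<ge> 1"
  shows "\<exists>\<beta>>0. Lpow p (bump (s\<^sup>2) 1 :: 'a::euclidean_space \<Rightarrow> real) = ennreal \<beta>"
proof -
  let ?b = "bump (s\<^sup>2) 1 :: 'a \<Rightarrow> real"
  have t: "test_fun ?b" using test_fun_cmult_bump[of 1 1 "s\<^sup>2"] by simp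
  note [measurable] = test_fun_borel[OF t]
  have fin: "Lpow p ?b < \<infinity>" using Lpow_test_fun[OF t] p by simp
  have "Lpow p ?b \<noteq> 0"
  proof
    assume "Lpow p ?b = 0"
    then have "AE x in lborel. ennreal (\<bar>?b x\<bar> powr p) = 0"
      unfolding Lpow_def by (subst (asm) nn_integral_0_iff_AE) auto
    then have "AE x in lborel. x \<notin> ball (0::'a) s"
    proof eventually_elim
      case (elim x)
      then have "?b x = 0" by simp
      then show ?case using bump_pos[of x s] by auto
    qed
    then have "emeasure lborel (ball (0::'a) s) = 0"
      by (subst (asm) AE_iff_measurable[OF _ refl]) (auto simp: ball_def)
    then show False using s emeasure_lborel_ball_finite content_ball_pos[of s "0::'a"] by (simp add: measure_def)
  qed
  then show ?thesis using fin by (cases "Lpow p ?b") (auto simp: less_le)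
qed

lemma sphere_measure_space:
  assumes "sphere_measure \<mu>" shows "space \<mu> = sphere 0 1"
  using assms sets_eq_imp_space_eq[of \<mu> "restrict_space borel (sphere 0 1)"]
  by (simp add: sphere_measure_def space_restrict_space)

lemma D_mu_finite:
  assumes \<mu>: "sphere_measure \<mu>" and u: "u \<in> borel_measurable borel" "p \<ge> 1" "Xp p u"
  shows "D_mu \<mu> p u < \<infinity>"
proof -
  obtain K where K: "\<And>h. norm h \<le> 1 \<Longrightarrow> dir_norm p u h \<le> ennreal K"
    using dir_norm_energy(4)[OF u] by blast
  have "D_mu \<mu> p u \<le> (\<integral>\<^sup>+\<sigma>. ennreal K \<partial>\<mu>)"
    unfolding D_mu_def by (rule nn_integral_mono) (use K sphere_measure_space[OF \<mu>] in auto)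
  also have "\<dots> = ennreal K * emeasure \<mu> (space \<mu>)" by simp
  also have "\<dots> < \<infinity>"
    using \<mu> finite_measure.emeasure_finite[of \<mu> "space \<mu>"] by (simp add: sphere_measure_def ennreal_mult_less_top less_top)
  finally show ?thesis .
qed

text \<open>Dilation by 2 turns the j-th quotient of b into the (j+1)-st of the dilate: 2^N comes
  from the substitution and 2^-p from the shift of j, and the supremum over j does not see the
  shift.\<close>

lemma D_mu_dilate:
  fixes b :: "'a::euclidean_space \<Rightarrow> real"
  assumes \<mu>: "sphere_measure \<mu>" and p: "p \<ge> 1"
    and b: "b \<in> borel_measurable borel" "Xp p b" and B: "(\<lambda>x. b (2 *\<^sub>R x)) \<in> borel_measurable borel" "Xp p (\<lambda>x. b (2 *\<^sub>R x))"
  shows "D_mu \<mu> p b \<le> ennreal (2 ^ DIM('a) / 2 powr p) * D_mu \<mu> p (\<lambda>x. b (2 *\<^sub>R x))"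
proof -
  let ?B = "\<lambda>x. b (2 *\<^sub>R x)"
  note XB = B(1) p B(2)
  note Xb = b(1) p b(2)
  have dn: "dir_norm p b \<sigma> \<le> ennreal (2 ^ DIM('a) / 2 powr p) * dir_norm p ?B \<sigma>" for \<sigma>
    unfolding dir_norm_eq_SUP[OF Xb]
  proof (rule SUP_least)
    fix j
    have "dq p b \<sigma> j = ennreal ((2 ^ j) powr p) * tdiff p b (2 *\<^sub>R ((1/2) ^ Suc j *\<^sub>R \<sigma>))"
      by (simp add: dq_def)
    also have "\<dots> = ennreal ((2 ^ j) powr p) * (ennreal (2 ^ DIM('a)) * tdiff p ?B ((1/2) ^ Suc j *\<^sub>R \<sigma>))"
      by (simp only: tdiff_dilate[OF b(1)])
    also have "\<dots> = ennreal (2 ^ DIM('a) / 2 powr p) * dq p ?B \<sigma> (Suc j)"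
    proof -
      have "ennreal ((2 ^ j) powr p) * ennreal (2 ^ DIM('a)) = ennreal (2 ^ DIM('a) / 2 powr p) * ennreal ((2 ^ Suc j) powr p)"
        by (subst (1 2) ennreal_mult[symmetric]) (auto simp: powr_mult)
      then show ?thesis unfolding dq_def by (simp only: mult.assoc[symmetric])
    qed
    also have "\<dots> \<le> ennreal (2 ^ DIM('a) / 2 powr p) * dir_norm p ?B \<sigma>"
      unfolding dir_norm_eq_SUP[OF XB] by (intro mult_left_mono SUP_upper) auto
    finally show "dq p b \<sigma> j \<le> ennreal (2 ^ DIM('a) / 2 powr p) * dir_norm p ?B \<sigma>" .
  qed
  have "dir_norm p ?B \<in> borel_measurable \<mu>"
  proof -
    have "dir_norm p ?B \<in> borel_measurable (restrict_space borel (sphere 0 1))"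
      by (rule measurable_restrict_space1[OF dir_norm_borel[OF XB]])
    moreover have "sets \<mu> = sets (restrict_space borel (sphere 0 1))" using \<mu> by (simp add: sphere_measure_def)
    ultimately show ?thesis by (simp cong: measurable_cong_sets)
  qed
  then show ?thesis
    unfolding D_mu_def by (subst nn_integral_cmult[symmetric]) (auto intro!: nn_integral_mono dn)
qed

text \<open>Pointwise in z, the rescaled T of the dilate is 2^-p T(2z), which is at most T(z). For
  |z| >= 2s both T(z) and T(2z) equal 2 \<beta>, so there the gap is 2 \<beta> (1 - 2^-p).\<close>

lemma kernel_energy_dilate_le:
  fixes r :: "'a::euclidean_space \<Rightarrow> real"
  assumes [measurable]: "r \<in> borel_measurable borel" "b \<in> borel_measurable borel"
    and r0: "\<And>z. r z \<ge> 0" and p: "p \<ge> 1" and s: "\<And>x. norm x \<ge> s \<Longrightarrow> b x = 0" "s > 0" and \<beta>: "Lpow p b = ennreal \<beta>" "\<beta> > 0"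
  shows "ennreal (2 ^ DIM('a) / 2 powr p) * kernel_energy r p (\<lambda>x. b (2 *\<^sub>R x))
     + ennreal (2 * \<beta> * (1 - 1 / 2 powr p)) * kernel_tail r p (2 * s) \<le> kernel_energy r p b"
proof -
  let ?B = "\<lambda>x. b (2 *\<^sub>R x)"
  let ?c = "ennreal (2 ^ DIM('a) / 2 powr p)"
  let ?k = "2 * \<beta> * (1 - 1 / 2 powr p)"
  have k: "?k \<ge> 0" using \<beta> p by (simp add: ge_one_powr_ge_zero)
  have cB: "?c * tdiff p ?B z = ennreal (1 / 2 powr p) * tdiff p b (2 *\<^sub>R z)" for z
    unfolding tdiff_dilate[OF assms(2)] by (simp add: mult.assoc[symmetric] flip: ennreal_mult)
  have pt: "?c * tdiff p ?B z + ennreal ?k * indicator {z. norm z \<ge> 2 * s} z \<le> tdiff p b z" for z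
  proof (cases "norm z \<ge> 2 * s")
    case True
    have "tdiff p b z = 2 * ennreal \<beta>" "tdiff p b (2 *\<^sub>R z) = 2 * ennreal \<beta>"
      using True s(2) \<beta>(1) by (auto intro!: tdiff_disjoint_support[OF assms(2) s(1) _ p, folded \<beta>(1)] simp flip: \<beta>(1))
    then have e: "tdiff p b z = ennreal (2 * \<beta>)" "tdiff p b (2 *\<^sub>R z) = ennreal (2 * \<beta>)"
      using \<beta>(2) by (simp_all add: ennreal_mult)
    have "ennreal (1 / 2 powr p) * ennreal (2 * \<beta>) + ennreal ?k = ennreal (1 / 2 powr p * (2 * \<beta>) + ?k)"
      using \<beta>(2) k by (simp flip: ennreal_mult ennreal_plus)
    also have "1 / 2 powr p * (2 * \<beta>) + ?k = 2 * \<beta>" by (simp add: algebra_simps)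
    finally show ?thesis unfolding cB e using True by simp
  next
    case False
    have "ennreal (1 / 2 powr p) * tdiff p b (2 *\<^sub>R z) \<le> ennreal (1 / 2 powr p) * (ennreal (real 2 powr p) * tdiff p b z)"
      using tdiff_multiple_le[OF assms(2) p, of 2 z] by (intro mult_left_mono) auto
    also have "\<dots> = tdiff p b z" by (simp add: mult.assoc[symmetric] flip: ennreal_mult)
    finally show ?thesis unfolding cB using False by simp
  qed
  have "?c * kernel_energy r p ?B + ennreal ?k * kernel_tail r p (2 * s)
     = (\<integral>\<^sup>+z. ?c * (ennreal (r z / norm z powr p) * tdiff p ?B z)
        + ennreal ?k * (ennreal (r z / norm z powr p) * indicator {z. norm z \<ge> 2 * s} z) \<partial>lborel)"
    unfolding kernel_energy_def kernel_tail_def by (simp add: nn_integral_add nn_integral_cmult)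
  also have "\<dots> = (\<integral>\<^sup>+z. ennreal (r z / norm z powr p) *
        (?c * tdiff p ?B z + ennreal ?k * indicator {z. norm z \<ge> 2 * s} z) \<partial>lborel)"
    by (simp add: distrib_left mult.left_commute)
  also have "\<dots> \<le> kernel_energy r p b"
    unfolding kernel_energy_def by (intro nn_integral_mono mult_left_mono pt) auto
  finally show ?thesis .
qed

text \<open>Every z with 0 < |z| < 1 has a multiple m z of length at least 1/2, where the increment
  of b is saturated. The least such m is at most 3 / (2|z|), whence the constant (3/2)^p.\<close>

lemma kernel_mass_le:
  fixes r b :: "'a::euclidean_space \<Rightarrow> real"
  assumes [measurable]: "r \<in> borel_measurable borel" "b \<in> borel_measurable borel"
    and r0: "\<And>z. r z \<ge> 0" and p: "p \<ge> 1" and s: "\<And>x. norm x \<ge> 1/4 \<Longrightarrow> b x = 0"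
  shows "2 * Lpow p b * kernel_mass r \<le> ennreal ((3/2) powr p) * kernel_energy r p b"
proof -
  have pt: "2 * Lpow p b \<le> ennreal ((3/2) powr p / norm z powr p) * tdiff p b z" if z: "z \<noteq> 0" "norm z < 1" for z
  proof -
    define m where "m = nat \<lceil>1 / (2 * norm z)\<rceil>"
    have "1 / (2 * norm z) > 0" using z by simp
    then have m: "m > 0" "1 / (2 * norm z) \<le> real m" "real m \<le> 1 / (2 * norm z) + 1"
      unfolding m_def by auto
    have "1/2 \<le> real m * norm z" using m(2) z by (simp add: field_simps)
    then have "2 * Lpow p b = tdiff p b (real m *\<^sub>R z)"
      by (intro tdiff_disjoint_support[where s = "1/4", OF assms(2) s _ p, symmetric]) auto
    also have "\<dots> \<le> ennreal (real m powr p) * tdiff p b z" by (rule tdiff_multiple_le[OF assms(2) p m(1)])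
    also have "\<dots> \<le> ennreal ((3 / 2 / norm z) powr p) * tdiff p b z"
    proof (intro mult_right_mono ennreal_leI powr_mono2)
      have "1 / (2 * norm z) + 1 \<le> 3 / 2 / norm z" using z by (simp add: field_simps)
      then show "real m \<le> 3 / 2 / norm z" using m(3) by linarith
    qed (use p in auto)
    finally show ?thesis by (simp add: powr_divide powr_mult)
  qed
  have "2 * Lpow p b * kernel_mass r = (\<integral>\<^sup>+z. 2 * Lpow p b * (ennreal (r z) * indicator (ball 0 1) z) \<partial>lborel)"
    unfolding kernel_mass_def by (subst nn_integral_cmult) auto
  also have "\<dots> \<le> (\<integral>\<^sup>+z. ennreal ((3/2) powr p) * (ennreal (r z / norm z powr p) * tdiff p b z) \<partial>lborel)"
  proof (rule nn_integral_mono_AE, use AE_lborel_nonzero in eventually_elim)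
    case (elim z)
    show ?case
    proof (cases "norm z < 1")
      case True
      have "2 * Lpow p b * ennreal (r z) \<le> ennreal ((3/2) powr p / norm z powr p) * tdiff p b z * ennreal (r z)"
        by (rule mult_right_mono[OF pt[OF elim True]]) simp
      also have "\<dots> = ennreal ((3/2) powr p / norm z powr p) * ennreal (r z) * tdiff p b z" by (simp add: mult_ac)
      also have "ennreal ((3/2) powr p / norm z powr p) * ennreal (r z) = ennreal ((3/2) powr p) * ennreal (r z / norm z powr p)"
        using r0[of z] by (simp flip: ennreal_mult)
      finally show ?thesis using True by (simp add: mult.assoc)
    qed simp
  qed
  also have "\<dots> = ennreal ((3/2) powr p) * kernel_energy r p b"
    unfolding kernel_energy_def by (rule nn_integral_cmult) measurable
  finally show ?thesis .
qed

text \<open>For the tails, \<open>D_mu_dilate\<close> bounds the limit for the bump by that for the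
  rescaled dilate, while for each k the energies satisfy the opposite inequality with a tail term to
  spare. \<open>ennreal_squeeze_zero\<close> forces that term to 0.\<close>

lemma kernel_rigidity:
  fixes r :: "nat \<Rightarrow> 'a::euclidean_space \<Rightarrow> real"
  assumes r: "\<And>k. r k \<in> borel_measurable borel" "\<And>k z. r k z \<ge> 0" and p: "p \<ge> 1" and \<mu>: "sphere_measure \<mu>"
    and lim: "\<And>u. test_fun u \<Longrightarrow> (\<lambda>k. kernel_energy (r k) p u) \<longlonglongrightarrow> D_mu \<mu> p u"
  shows "s > 0 \<Longrightarrow> (\<lambda>k. kernel_tail (r k) p s) \<longlonglongrightarrow> 0"
    and "\<exists>A. \<forall>\<^sub>F k in sequentially. kernel_mass (r k) \<le> ennreal A"
proof -
  define b where "b s = (bump (s\<^sup>2) 1 :: 'a \<Rightarrow> real)" for s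
  have t: "test_fun (b s)" "test_fun (\<lambda>x. b s (2 *\<^sub>R x))" for s
    using test_fun_cmult_bump[of 1 1 "s\<^sup>2"] test_fun_cmult_bump[of "2\<^sup>2" 1 "s\<^sup>2"]
    by (auto simp: b_def bump_scale)
  have bz: "b s x = 0" if "s > 0" "norm x \<ge> s" for s x using bump_zero[OF that] by (simp add: b_def)
  show "(\<lambda>k. kernel_tail (r k) p s) \<longlonglongrightarrow> 0" if s: "s > 0" for s
  proof -
    \<comment> \<open>Saturation starts at twice the support radius.\<close>
    define s' where "s' = s / 2"
    have s': "s' > 0" "2 * s' = s" using s by (auto simp: s'_def)
    let ?b = "b s'" and ?B = "\<lambda>x. b s' (2 *\<^sub>R x)"
    obtain \<beta> where \<beta>: "\<beta> > 0" "Lpow p ?b = ennreal \<beta>" using bump_Lpow[OF s'(1) p] b_def by metis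
    define c where "c = 2 * \<beta> * (1 - 1 / 2 powr p)"
    have "(2::real) powr p > 1" using p by simp
    then have c: "c > 0" using \<beta> by (simp add: c_def)
    note Xb = test_fun_borel[OF t(1)[of s']] test_fun_Xp[OF t(1)[of s'] p]
    note XB = test_fun_borel[OF t(2)[of s']] test_fun_Xp[OF t(2)[of s'] p]
    let ?c = "2 ^ DIM('a) / 2 powr p :: real"
    obtain X where X: "D_mu \<mu> p ?b = ennreal X" "X \<ge> 0"
      using D_mu_finite[OF \<mu> Xb(1) p Xb(2)] by (cases "D_mu \<mu> p ?b") auto
    obtain Y where Y: "D_mu \<mu> p ?B = ennreal Y" "Y \<ge> 0"
      using D_mu_finite[OF \<mu> XB(1) p XB(2)] by (cases "D_mu \<mu> p ?B") auto
    have cY: "ennreal ?c * ennreal Y = ennreal (?c * Y)" using Y by (intro ennreal_mult[symmetric]) auto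
    then have "ennreal X \<le> ennreal (?c * Y)"
      using D_mu_dilate[OF \<mu> p Xb XB] unfolding X(1) Y(1) by simp
    then have XY: "X \<le> ?c * Y" using Y by (subst (asm) ennreal_le_iff) auto
    have "(\<lambda>k. ennreal c * kernel_tail (r k) p (2 * s')) \<longlonglongrightarrow> 0"
    proof (rule ennreal_squeeze_zero[OF _ _ X(2) XY])
      show "(\<lambda>k. kernel_energy (r k) p ?b) \<longlonglongrightarrow> ennreal X" using lim[OF t(1)] X by metis
      have "(\<lambda>k. ennreal ?c * kernel_energy (r k) p ?B) \<longlonglongrightarrow> ennreal ?c * ennreal Y"
        using lim[OF t(2)[of s']] Y by (intro ennreal_tendsto_cmult) auto
      then show "(\<lambda>k. ennreal ?c * kernel_energy (r k) p ?B) \<longlonglongrightarrow> ennreal (?c * Y)"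
        unfolding cY .
      show "ennreal ?c * kernel_energy (r k) p ?B + ennreal c * kernel_tail (r k) p (2 * s') \<le> kernel_energy (r k) p ?b" for k
        unfolding c_def by (rule kernel_energy_dilate_le[OF r(1) Xb(1) r(2) p bz[OF s'(1)] s'(1) \<beta>(2,1)])
    qed
    then have "(\<lambda>k. ennreal (1 / c) * (ennreal c * kernel_tail (r k) p (2 * s'))) \<longlonglongrightarrow> ennreal (1 / c) * 0"
      by (intro ennreal_tendsto_cmult) auto
    then show ?thesis using c s' by (simp add: mult.assoc[symmetric] flip: ennreal_mult)
  qed
  show "\<exists>A. \<forall>\<^sub>F k in sequentially. kernel_mass (r k) \<le> ennreal A"
  proof -
    \<comment> \<open>Radius 1/4, so that shifts of length 1/2 already saturate, as
      \<open>kernel_mass_le\<close> demands.\<close>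
    let ?b = "b (1/4)"
    obtain \<beta> where \<beta>: "\<beta> > 0" "Lpow p ?b = ennreal \<beta>" using bump_Lpow[OF _ p, of "1/4"] b_def by auto
    note Xb = test_fun_borel[OF t(1)[of "1/4"]] test_fun_Xp[OF t(1)[of "1/4"] p]
    obtain X where X: "D_mu \<mu> p ?b = ennreal X" "X \<ge> 0"
      using D_mu_finite[OF \<mu> Xb(1) p Xb(2)] by (cases "D_mu \<mu> p ?b") auto
    have "\<forall>\<^sub>F k in sequentially. kernel_energy (r k) p ?b < ennreal (X + 1)"
      by (rule order_tendstoD(2)[OF lim[OF t(1)]]) (use X in \<open>simp add: ennreal_less_iff\<close>)
    then have "\<forall>\<^sub>F k in sequentially. kernel_mass (r k) \<le> ennreal ((3/2) powr p * (X + 1) / (2 * \<beta>))"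
    proof eventually_elim
      case (elim k)
      have "ennreal (2 * \<beta>) * kernel_mass (r k) = 2 * Lpow p ?b * kernel_mass (r k)"
        using \<beta> by (simp add: ennreal_mult)
      also have "\<dots> \<le> ennreal ((3/2) powr p) * kernel_energy (r k) p ?b"
        by (rule kernel_mass_le[OF r(1) Xb(1) r(2) p]) (use bz in auto)
      also have "\<dots> \<le> ennreal ((3/2) powr p) * ennreal (X + 1)"
        using elim by (intro mult_left_mono) auto
      finally have "ennreal (2 * \<beta>) * kernel_mass (r k) \<le> ennreal ((3/2) powr p * (X + 1))"
        using X by (simp add: ennreal_mult)
      then have "ennreal (1 / (2 * \<beta>)) * (ennreal (2 * \<beta>) * kernel_mass (r k)) \<le> ennreal (1 / (2 * \<beta>)) * ennreal ((3/2) powr p * (X + 1))"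
        by (intro mult_left_mono) auto
      then show ?case using \<beta> X by (simp add: mult.assoc[symmetric] flip: ennreal_mult)
    qed
    then show ?thesis by blast
  qed
qed

section \<open>Concentration of the kernels\<close>

lemma borel_version_kernel:
  fixes f :: "'a::euclidean_space \<Rightarrow> real"
  assumes f: "loc_integrable f" "\<And>z. f z \<ge> 0"
  shows "\<exists>r. r \<in> borel_measurable borel \<and> (\<forall>z. r z \<ge> 0) \<and> (AE z in lborel. f z = r z) \<and> loc_int r
     \<and> f \<in> borel_measurable lebesgue"
proof -
  have i: "integrable lebesgue (\<lambda>z. indicator (cball 0 R) z * f z)" for R
    using f(1) by (simp add: loc_integrable_def set_integrable_def)
  have m: "f \<in> borel_measurable lebesgue"
  proof (rule borel_measurable_LIMSEQ_real)
    show "(\<lambda>z. indicator (cball 0 (real n)) z * f z) \<in> borel_measurable lebesgue" for n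
      using i by (rule borel_measurable_integrable)
    fix z :: 'a
    obtain N :: nat where N: "norm z \<le> real N" using real_arch_simple by blast
    have "\<forall>\<^sub>F n in sequentially. indicator (cball 0 (real n)) z * f z = f z"
      using eventually_ge_at_top[of N] by eventually_elim (use N in \<open>auto simp: indicator_def\<close>)
    then show "(\<lambda>n. indicator (cball 0 (real n)) z * f z) \<longlonglongrightarrow> f z" by (rule tendsto_eventually)
  qed
  obtain r' where r': "r' \<in> borel_measurable borel" "AE z in lborel. f z = r' z" using borel_version_real[OF m] by blast
  \<comment> \<open>Nonnegativity is wanted at every point, while r' agrees with f only almost
    everywhere.\<close>
  define r where "r z = max 0 (r' z)" for z
  have [measurable]: "r \<in> borel_measurable borel" unfolding r_def using r'(1) by measurable
  have ae: "AE z in lborel. f z = r z"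
    using r'(2)
  proof eventually_elim
    case (elim z)
    then show ?case using f(2)[of z] by (simp add: r_def)
  qed
  have "integrable lborel (\<lambda>z. indicator (cball 0 R) z * r z)" for R
  proof -
    have "(\<lambda>z. indicator (cball 0 R) z * r z) \<in> borel_measurable borel" by measurable
    then have mb: "(\<lambda>z. indicator (cball 0 R) z * r z) \<in> borel_measurable lborel" by simp
    have "integrable lebesgue (\<lambda>z. indicator (cball 0 R) z * r z)"
    proof (rule iffD1[OF integrable_cong_AE i[of R]])
      show "AE z in lebesgue. indicator (cball 0 R) z * f z = indicator (cball 0 R) z * r z"
        using AE_completion[OF ae] by eventually_elim simp
      show "(\<lambda>z. indicator (cball 0 R) z * f z) \<in> borel_measurable lebesgue"
        using i by (rule borel_measurable_integrable)
      show "(\<lambda>z. indicator (cball 0 R) z * r z) \<in> borel_measurable lebesgue" using mb by (rule measurable_completion)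
    qed
    then show ?thesis using integrable_completion[OF mb] by simp
  qed
  then have "loc_int r" by (simp add: loc_int_def)
  then show ?thesis using ae m by (intro exI[of _ r]) (auto simp: r_def)
qed

section \<open>From condition (A) to tails and masses\<close>

text \<open>On s <= |z| <= R weak convergence to a multiple of the Dirac mass leaves nothing. For
  |z| > R one has 1 / |z|^p <= 2 / (R^p + |z|^p), so the integral bound of (A) contributes at most a
  multiple of S / R^p; it is small because S does not depend on R.\<close>

lemma kernel_tail_tendsto:
  fixes r :: "nat \<Rightarrow> 'a::euclidean_space \<Rightarrow> real"
  assumes r: "\<And>k. loc_int (r k)" and r0: "\<And>k z. r k z \<ge> 0" and p: "p \<ge> 1"
    and S: "\<And>R. R > 0 \<Longrightarrow> limsup (\<lambda>k. \<integral>\<^sup>+z. ennreal (R powr p * r k z / (R powr p + norm z powr p)) \<partial>lborel) \<le> ennreal S" "S \<ge> 0"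
    and ws: "\<And>g. continuous_on UNIV g \<Longrightarrow> compact (closure {x. g x \<noteq> 0}) \<Longrightarrow> (\<lambda>k. \<integral>z. g z * r k z \<partial>lborel) \<longlonglongrightarrow> \<alpha> * g 0"
    and s: "s > 0"
  shows "(\<lambda>k. kernel_tail (r k) p s) \<longlonglongrightarrow> 0"
proof (rule tendsto_zero_ennreal)
  fix e :: real assume e: "e > 0"
  note [measurable] = loc_int_borel[OF r]
  \<comment> \<open>As R >= 1 gives R^p >= R, this makes the far part, 2 (S + 1) / R^p, smaller than
    e/2.\<close>
  define R where "R = max (max s 1) (4 * (S + 1) / e + 1)"
  have R: "R \<ge> s" "R \<ge> 1" "R > 0" by (auto simp: R_def)
  have "2 / R powr p * (S + 1) < e / 2"
  proof -
    have "R powr 1 \<le> R powr p" using R p by (intro powr_mono) auto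
    moreover have "4 * (S + 1) / e < R" unfolding R_def by linarith
    ultimately have "4 * (S + 1) / e < R powr p" using R by simp
    then have "4 * (S + 1) < e * R powr p" using e by (simp add: field_simps)
    then show ?thesis using R by (simp add: field_simps)
  qed
  \<comment> \<open>Equal to 1 on the annulus, 0 for |z| <= s/2, in particular at the origin, and 0
    beyond R + 1.\<close>
  define g where "g z = max 0 (min (min 1 (2 * norm z / s - 1)) (R + 1 - norm z))" for z :: 'a
  have gc: "continuous_on UNIV g" unfolding g_def by (intro continuous_intros) (use s in auto)
  have [measurable]: "g \<in> borel_measurable borel" using gc by (rule borel_measurable_continuous_onI)
  have g0: "g z \<ge> 0" "\<bar>g z\<bar> \<le> 1" for z by (auto simp: g_def)
  have gz: "g z = 0" if "norm z > R + 1" for z using that by (auto simp: g_def)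
  have g1: "g z = 1" if "s \<le> norm z" "norm z \<le> R" for z
  proof -
    have "2 * norm z / s - 1 \<ge> 1" using that s by (simp add: field_simps)
    then show ?thesis using that by (simp add: g_def)
  qed
  have "compact (closure {x. g x \<noteq> 0})"
    unfolding compact_closure bounded_pos using gz R by (intro exI[of _ "R + 1"]) (force simp: not_less[symmetric])
  from ws[OF gc this] have "(\<lambda>k. \<integral>z. g z * r k z \<partial>lborel) \<longlonglongrightarrow> 0" by (simp add: g_def)
  then have ev1: "\<forall>\<^sub>F k in sequentially. (\<integral>z. g z * r k z \<partial>lborel) < e / 2 * s powr p"
    by (rule order_tendstoD(2)) (use e s in simp)
  have "ennreal S < ennreal (S + 1)" using S(2) by (simp add: ennreal_less_iff del: ennreal_plus)
  then have ev2: "\<forall>\<^sub>F k in sequentially. (\<integral>\<^sup>+z. ennreal (R powr p * r k z / (R powr p + norm z powr p)) \<partial>lborel) < ennreal (S + 1)"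
    using S(1)[OF R(3)] by (intro Limsup_lessD) (rule order.strict_trans1)
  show "\<forall>\<^sub>F k in sequentially. kernel_tail (r k) p s < ennreal e"
    using ev1 ev2
  proof eventually_elim
    case (elim k)
    have i: "integrable lborel (\<lambda>z. g z * r k z)"
      using integrable_loc_int_mult[OF r _ g0(2) gz] by (simp add: mult.commute)
    have "kernel_tail (r k) p s \<le> (\<integral>\<^sup>+z. ennreal (1 / s powr p) * ennreal (g z * r k z)
        + ennreal (2 / R powr p) * ennreal (R powr p * r k z / (R powr p + norm z powr p)) \<partial>lborel)"
      unfolding kernel_tail_def
    proof (rule nn_integral_mono)
      fix z :: 'a
      show "ennreal (r k z / norm z powr p) * indicator {z. s \<le> norm z} z
         \<le> ennreal (1 / s powr p) * ennreal (g z * r k z)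
          + ennreal (2 / R powr p) * ennreal (R powr p * r k z / (R powr p + norm z powr p))"
      proof (cases "s \<le> norm z")
        case sz: True
        show ?thesis
        proof (cases "norm z \<le> R")
          case True
          have "s powr p \<le> norm z powr p" using sz s p by (intro powr_mono2) auto
          then have "r k z / norm z powr p \<le> r k z / s powr p" using s r0 by (intro divide_left_mono mult_pos_pos) auto
          then have "ennreal (r k z / norm z powr p) \<le> ennreal (1 / s powr p) * ennreal (g z * r k z)"
            using g1[OF sz True] r0 by (simp add: ennreal_leI flip: ennreal_mult)
          then show ?thesis using sz by (simp add: add_increasing2)
        next
          case False
          have "R powr p \<le> norm z powr p" using False R p by (intro powr_mono2) auto
          moreover have "norm z > 0" using False R by linarith
          then have "norm z powr p > 0" by simp
          ultimately have "r k z / norm z powr p \<le> 2 * r k z / (R powr p + norm z powr p)"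
          proof -
            assume a: "R powr p \<le> norm z powr p" "norm z powr p > 0"
            then have b: "R powr p + norm z powr p > 0" by (simp add: add_nonneg_pos)
            have "r k z * (R powr p + norm z powr p) \<le> r k z * (2 * norm z powr p)"
              using a r0[of k z] by (intro mult_left_mono) auto
            then have "r k z * (R powr p + norm z powr p) / (norm z powr p * (R powr p + norm z powr p))
                \<le> r k z * (2 * norm z powr p) / (norm z powr p * (R powr p + norm z powr p))"
              using a b by (intro divide_right_mono) auto
            then show ?thesis using a b by (simp add: mult.commute)
          qed
          also have "\<dots> = 2 / R powr p * (R powr p * r k z / (R powr p + norm z powr p))" using R by simp
          finally have "ennreal (r k z / norm z powr p)
             \<le> ennreal (2 / R powr p) * ennreal (R powr p * r k z / (R powr p + norm z powr p))"
            using r0[of k z] by (simp add: ennreal_leI flip: ennreal_mult)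
          then show ?thesis using sz by (simp add: add_increasing)
        qed
      qed simp
    qed
    also have "\<dots> = ennreal (1 / s powr p) * (\<integral>\<^sup>+z. ennreal (g z * r k z) \<partial>lborel)
        + ennreal (2 / R powr p) * (\<integral>\<^sup>+z. ennreal (R powr p * r k z / (R powr p + norm z powr p)) \<partial>lborel)"
      by (simp add: nn_integral_add nn_integral_cmult)
    also have "(\<integral>\<^sup>+z. ennreal (g z * r k z) \<partial>lborel) = ennreal (\<integral>z. g z * r k z \<partial>lborel)"
      by (rule nn_integral_eq_integral[OF i]) (use g0 r0 in auto)
    also have "ennreal (1 / s powr p) * ennreal (\<integral>z. g z * r k z \<partial>lborel)
        + ennreal (2 / R powr p) * (\<integral>\<^sup>+z. ennreal (R powr p * r k z / (R powr p + norm z powr p)) \<partial>lborel)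
       \<le> ennreal (1 / s powr p) * ennreal (e / 2 * s powr p) + ennreal (2 / R powr p) * ennreal (S + 1)"
      using elim by (intro add_mono mult_left_mono ennreal_leI) auto
    also have "\<dots> = ennreal (e / 2 + 2 / R powr p * (S + 1))"
      using s e S(2) by (simp flip: ennreal_mult ennreal_plus)
    also have "\<dots> < ennreal e"
      by (rule ennreal_lessI[OF e]) (use \<open>2 / R powr p * (S + 1) < e / 2\<close> in linarith)
    finally show ?case .
  qed
qed

lemma kernel_mass_eq:
  fixes r :: "'a::euclidean_space \<Rightarrow> real"
  assumes r: "loc_int r" "\<And>z. r z \<ge> 0"
  shows "kernel_mass r = ennreal (\<integral>z. r z * indicator (ball 0 1) z \<partial>lborel)"
proof -
  note [measurable] = loc_int_borel[OF r(1)]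
  have "integrable lborel (\<lambda>z. r z * indicator (ball 0 1) z)"
    by (rule integrable_loc_int_mult[OF r(1), of _ 1 1]) (auto simp: indicator_def)
  from nn_integral_eq_integral[OF this] show ?thesis
    using r(2) by (simp add: kernel_mass_def ennreal_mult' ennreal_indicator)
qed

text \<open>The indicator of the unit ball is not continuous, so the mass is squeezed between the
  integral of a cut-off g, equal to 1 up to radius 1/2, and the same integral plus the tail from
  radius 1/2 on.\<close>

lemma kernel_mass_tendsto:
  fixes r :: "nat \<Rightarrow> 'a::euclidean_space \<Rightarrow> real"
  assumes r: "\<And>k. loc_int (r k)" and r0: "\<And>k z. r k z \<ge> 0" and p: "p \<ge> 1" and \<alpha>: "\<alpha> \<ge> 0"
    and ws: "\<And>g. continuous_on UNIV g \<Longrightarrow> compact (closure {x. g x \<noteq> 0}) \<Longrightarrow> (\<lambda>k. \<integral>z. g z * r k z \<partial>lborel) \<longlonglongrightarrow> \<alpha> * g 0"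
    and tail: "\<And>s. s > 0 \<Longrightarrow> (\<lambda>k. kernel_tail (r k) p s) \<longlonglongrightarrow> 0"
  shows "(\<lambda>k. kernel_mass (r k)) \<longlonglongrightarrow> ennreal \<alpha>"
proof -
  note [measurable] = loc_int_borel[OF r]
  define g where "g z = max 0 (min 1 (2 - 2 * norm z))" for z :: 'a
  have gc: "continuous_on UNIV g" unfolding g_def by (intro continuous_intros)
  have [measurable]: "g \<in> borel_measurable borel" using gc by (rule borel_measurable_continuous_onI)
  have g0: "g z \<ge> 0" "g z \<le> 1" "\<bar>g z\<bar> \<le> 1" for z by (auto simp: g_def)
  have gz: "g z = 0" if "norm z \<ge> 1" for z using that by (auto simp: g_def)
  have "compact (closure {x. g x \<noteq> 0})"
    unfolding compact_closure bounded_pos using gz by (intro exI[of _ 1]) (force simp: not_less[symmetric])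
  from ws[OF gc this] have l: "(\<lambda>k. \<integral>z. g z * r k z \<partial>lborel) \<longlonglongrightarrow> \<alpha>" by (simp add: g_def)
  have i: "(\<integral>\<^sup>+z. ennreal (g z * r k z) \<partial>lborel) = ennreal (\<integral>z. g z * r k z \<partial>lborel)" for k
  proof (rule nn_integral_eq_integral)
    show "integrable lborel (\<lambda>z. g z * r k z)"
      using integrable_loc_int_mult[where R = 1, OF r _ g0(3)] gz by (simp add: mult.commute)
  qed (use g0 r0 in auto)
  show ?thesis
  proof (rule tendsto_sandwich)
    show "(\<lambda>k. ennreal (\<integral>z. g z * r k z \<partial>lborel)) \<longlonglongrightarrow> ennreal \<alpha>" using l by (rule tendsto_ennrealI)
    have "(\<lambda>k. ennreal (\<integral>z. g z * r k z \<partial>lborel) + kernel_tail (r k) p (1/2)) \<longlonglongrightarrow> ennreal \<alpha> + 0"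
      by (intro tendsto_add tendsto_ennrealI l tail) simp
    then show "(\<lambda>k. ennreal (\<integral>z. g z * r k z \<partial>lborel) + kernel_tail (r k) p (1/2)) \<longlonglongrightarrow> ennreal \<alpha>" by simp
    show "\<forall>\<^sub>F k in sequentially. ennreal (\<integral>z. g z * r k z \<partial>lborel) \<le> kernel_mass (r k)"
    proof (intro always_eventually allI)
      fix k
      show "ennreal (\<integral>z. g z * r k z \<partial>lborel) \<le> kernel_mass (r k)"
        unfolding i[symmetric] kernel_mass_def
      proof (rule nn_integral_mono)
        fix z :: 'a
        have "g z * r k z \<le> r k z" using g0[of z] r0[of k z] by (simp add: mult_left_le_one_le)
        then show "ennreal (g z * r k z) \<le> ennreal (r k z) * indicator (ball 0 1) z"
          using gz[of z] by (cases "norm z < 1") (auto intro: ennreal_leI)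
      qed
    qed
    show "\<forall>\<^sub>F k in sequentially. kernel_mass (r k) \<le> ennreal (\<integral>z. g z * r k z \<partial>lborel) + kernel_tail (r k) p (1/2)"
    proof (intro always_eventually allI)
      fix k
      have "kernel_mass (r k) \<le> (\<integral>\<^sup>+z. ennreal (g z * r k z) + ennreal (r k z / norm z powr p) * indicator {z. norm z \<ge> 1/2} z \<partial>lborel)"
        unfolding kernel_mass_def
      proof (rule nn_integral_mono)
        fix z :: 'a
        show "ennreal (r k z) * indicator (ball 0 1) z \<le> ennreal (g z * r k z) + ennreal (r k z / norm z powr p) * indicator {z. norm z \<ge> 1/2} z"
        proof (cases "norm z \<ge> 1/2")
          case half: True
          show ?thesis
          proof (cases "norm z < 1")
            case True
            have "norm z powr p \<le> 1" "norm z powr p > 0" using True half p by (auto simp: powr_le1)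
            then have "r k z \<le> r k z / norm z powr p" using r0[of k z] by (simp add: le_divide_eq mult_left_le)
            then show ?thesis using half by (auto simp: indicator_def intro!: add_increasing ennreal_leI)
          qed simp
        next
          case False
          then have "g z = 1" by (simp add: g_def)
          then show ?thesis by (simp add: indicator_def)
        qed
      qed
      also have "\<dots> = ennreal (\<integral>z. g z * r k z \<partial>lborel) + kernel_tail (r k) p (1/2)"
        unfolding kernel_tail_def i[symmetric] by (rule nn_integral_add) measurable
      finally show "kernel_mass (r k) \<le> ennreal (\<integral>z. g z * r k z \<partial>lborel) + kernel_tail (r k) p (1/2)" .
    qed
  qed
qed

section \<open>From tails and masses back to condition (A)\<close>

text \<open>The factor R^p in front of the tail is harmless, since R is fixed while k tends to
  infinity; the bound \<alpha> is therefore the same for all R.\<close>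

lemma kernel_limsup_le:
  fixes r :: "nat \<Rightarrow> 'a::euclidean_space \<Rightarrow> real"
  assumes r: "\<And>k. r k \<in> borel_measurable borel" and r0: "\<And>k z. r k z \<ge> 0" and p: "p \<ge> 1" and R: "R > 0"
    and mass: "(\<lambda>k. kernel_mass (r k)) \<longlonglongrightarrow> ennreal \<alpha>"
    and tail: "\<And>s. s > 0 \<Longrightarrow> (\<lambda>k. kernel_tail (r k) p s) \<longlonglongrightarrow> 0"
  shows "limsup (\<lambda>k. \<integral>\<^sup>+z. ennreal (R powr p * r k z / (R powr p + norm z powr p)) \<partial>lborel) \<le> ennreal \<alpha>"
proof -
  note [measurable] = r
  have le: "(\<integral>\<^sup>+z. ennreal (R powr p * r k z / (R powr p + norm z powr p)) \<partial>lborel)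
     \<le> kernel_mass (r k) + ennreal (R powr p) * kernel_tail (r k) p 1" for k
  proof -
    have "(\<integral>\<^sup>+z. ennreal (R powr p * r k z / (R powr p + norm z powr p)) \<partial>lborel)
       \<le> (\<integral>\<^sup>+z. ennreal (r k z) * indicator (ball 0 1) z
          + ennreal (R powr p) * (ennreal (r k z / norm z powr p) * indicator {z. norm z \<ge> 1} z) \<partial>lborel)"
    proof (rule nn_integral_mono)
      fix z :: 'a
      have Rp: "R powr p > 0" using R by simp
      show "ennreal (R powr p * r k z / (R powr p + norm z powr p))
         \<le> ennreal (r k z) * indicator (ball 0 1) z + ennreal (R powr p) * (ennreal (r k z / norm z powr p) * indicator {z. norm z \<ge> 1} z)"
      proof (cases "norm z < 1")
        case True
        have "R powr p * r k z \<le> r k z * (R powr p + norm z powr p)" using r0[of k z] by (simp add: algebra_simps)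
        then have "R powr p * r k z / (R powr p + norm z powr p) \<le> r k z"
          using Rp by (simp add: divide_le_eq add_pos_nonneg)
        then show ?thesis using True by (simp add: ennreal_leI)
      next
        case False
        then have "norm z > 0" by linarith
        then have "norm z powr p > 0" by simp
        then have "R powr p * r k z / (R powr p + norm z powr p) \<le> R powr p * r k z / norm z powr p"
          using r0[of k z] Rp by (intro divide_left_mono mult_pos_pos add_pos_pos) auto
        then show ?thesis using False r0[of k z] by (simp add: ennreal_leI flip: ennreal_mult)
      qed
    qed
    also have "\<dots> = kernel_mass (r k) + ennreal (R powr p) * kernel_tail (r k) p 1"
      unfolding kernel_mass_def kernel_tail_def by (simp add: nn_integral_add nn_integral_cmult)
    finally show ?thesis .
  qed
  have "(\<lambda>k. kernel_mass (r k) + ennreal (R powr p) * kernel_tail (r k) p 1) \<longlonglongrightarrow> ennreal \<alpha> + ennreal (R powr p) * 0"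
    by (intro tendsto_add mass ennreal_tendsto_cmult tail) auto
  then have "limsup (\<lambda>k. kernel_mass (r k) + ennreal (R powr p) * kernel_tail (r k) p 1) = ennreal \<alpha>"
    by (subst lim_imp_Limsup) auto
  moreover have "limsup (\<lambda>k. \<integral>\<^sup>+z. ennreal (R powr p * r k z / (R powr p + norm z powr p)) \<partial>lborel)
     \<le> limsup (\<lambda>k. kernel_mass (r k) + ennreal (R powr p) * kernel_tail (r k) p 1)"
    by (intro Limsup_mono always_eventually allI le)
  ultimately show ?thesis by simp
qed

lemma kernel_weak_star:
  fixes r :: "nat \<Rightarrow> 'a::euclidean_space \<Rightarrow> real"
  assumes r: "\<And>k. loc_int (r k)" and r0: "\<And>k z. r k z \<ge> 0" and p: "p \<ge> 1"
    and mass: "\<And>k. kernel_mass (r k) = ennreal (a k)" "\<And>k. a k \<ge> 0" "a \<longlonglongrightarrow> \<alpha>"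
    and tail: "\<And>s. s > 0 \<Longrightarrow> (\<lambda>k. kernel_tail (r k) p s) \<longlonglongrightarrow> 0"
    and g: "continuous_on UNIV g" "compact (closure {x. g x \<noteq> 0})"
  shows "(\<lambda>k. \<integral>z. g z * r k z \<partial>lborel) \<longlonglongrightarrow> \<alpha> * g 0"
proof -
  note [measurable] = loc_int_borel[OF r]
  have [measurable]: "g \<in> borel_measurable borel" using g(1) by (rule borel_measurable_continuous_onI)
  obtain R0 where R0: "\<And>z. norm z > R0 \<Longrightarrow> g z = 0"
    using g(2) unfolding compact_closure bounded_pos by (metis (mono_tags) mem_Collect_eq not_less)
  define R where "R = max 1 R0"
  have R: "R \<ge> 1" "\<And>z. norm z > R \<Longrightarrow> g z = 0" using R0 by (auto simp: R_def)
  have "bounded (g ` cball 0 R)"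
    by (intro compact_imp_bounded compact_continuous_image continuous_on_subset[OF g(1)]) auto
  then obtain B where B: "B > 0" "\<And>z. z \<in> cball 0 R \<Longrightarrow> \<bar>g z\<bar> \<le> B" unfolding bounded_pos by auto
  have gB: "\<bar>g z\<bar> \<le> B" for z using B R(2)[of z] by (cases "norm z \<le> R") auto
  \<comment> \<open>Splits off the part seen by the mass on the unit ball. The remainder is small
    near 0 by continuity of g; elsewhere it is bounded with bounded support, and the tail handles
    it.\<close>
  define h where "h z = g z - g 0 * indicator (ball 0 1) z" for z
  have [measurable]: "h \<in> borel_measurable borel" unfolding h_def by measurable
  have hz: "h z = 0" if "norm z > R" for z using R that by (simp add: h_def)
  have hB: "\<bar>h z\<bar> \<le> 2 * B" for z using gB[of z] gB[of 0] by (auto simp: h_def split: split_indicator)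
  have ih: "integrable lborel (\<lambda>z. h z * r k z)" for k
    using integrable_loc_int_mult[OF r _ hB hz] by (simp add: mult.commute)
  have ib: "integrable lborel (\<lambda>z. r k z * indicator (ball 0 1) z)" for k
    by (rule integrable_loc_int_mult[OF r, of _ 1 1]) (auto simp: indicator_def)
  have a: "a k = (\<integral>z. r k z * indicator (ball 0 1) z \<partial>lborel)" for k
  proof -
    have "0 \<le> (\<integral>z. r k z * indicator (ball 0 1) z \<partial>lborel)" using r0 by (intro Bochner_Integration.integral_nonneg) auto
    then show ?thesis using kernel_mass_eq[OF r r0, of k] mass(1,2)[of k] by simp
  qed
  have split: "(\<integral>z. g z * r k z \<partial>lborel) = (\<integral>z. h z * r k z \<partial>lborel) + g 0 * a k" for k
  proof -
    have "(\<integral>z. g z * r k z \<partial>lborel) = (\<integral>z. h z * r k z + g 0 * (r k z * indicator (ball 0 1) z) \<partial>lborel)"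
      by (intro Bochner_Integration.integral_cong) (auto simp: h_def algebra_simps)
    then show ?thesis using ih ib by (simp add: a)
  qed
  have "(\<lambda>k. \<integral>z. h z * r k z \<partial>lborel) \<longlonglongrightarrow> 0"
  proof (rule tendstoI)
    fix e :: real assume e: "e > 0"
    obtain A where A: "A > 0" "\<And>k. a k \<le> A"
      using convergent_imp_Bseq[of a] mass(3) unfolding convergent_def Bseq_def by (metis abs_le_iff real_norm_def)
    define e' where "e' = e / (4 * A)"
    have e': "e' > 0" using e A by (simp add: e'_def)
    have "\<forall>\<^sub>F z in nhds 0. dist (g z) (g 0) < e'"
      using g(1) e' by (intro tendstoD) (auto simp: continuous_on_def tendsto_at_iff_tendsto_nhds)
    then obtain d0 where d0: "d0 > 0" "\<And>z. dist z 0 < d0 \<Longrightarrow> dist (g z) (g 0) < e'"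
      unfolding eventually_nhds_metric by blast
    define d where "d = min d0 1"
    have d: "d > 0" "d \<le> 1" "\<And>z. norm z < d \<Longrightarrow> \<bar>h z\<bar> \<le> e'"
      using d0 by (auto simp: d_def h_def dist_real_def less_imp_le)
    \<comment> \<open>For d <= |z| <= R the bounds |h| <= 2B and |z|^p <= R^p give |h| r <= c r /
      |z|^p.\<close>
    define c where "c = 2 * B * R powr p"
    have c: "c > 0" using B R by (simp add: c_def)
    have "\<forall>\<^sub>F k in sequentially. kernel_tail (r k) p d < ennreal (e / 4 / c)"
      by (rule order_tendstoD(2)[OF tail[OF d(1)]]) (use e c in simp)
    then show "\<forall>\<^sub>F k in sequentially. dist (\<integral>z. h z * r k z \<partial>lborel) 0 < e"
    proof eventually_elim
      case (elim k)
      have "ennreal \<bar>\<integral>z. h z * r k z \<partial>lborel\<bar> \<le> (\<integral>\<^sup>+z. ennreal \<bar>h z * r k z\<bar> \<partial>lborel)"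
        using integral_norm_bound_ennreal[OF ih, of k] by simp
      also have "\<dots> \<le> (\<integral>\<^sup>+z. ennreal e' * (ennreal (r k z) * indicator (ball 0 1) z)
           + ennreal c * (ennreal (r k z / norm z powr p) * indicator {z. norm z \<ge> d} z) \<partial>lborel)"
      proof (rule nn_integral_mono)
        fix z :: 'a
        have habs: "\<bar>h z * r k z\<bar> = \<bar>h z\<bar> * r k z" using r0[of k z] by (simp add: abs_mult)
        show "ennreal \<bar>h z * r k z\<bar> \<le> ennreal e' * (ennreal (r k z) * indicator (ball 0 1) z)
           + ennreal c * (ennreal (r k z / norm z powr p) * indicator {z. norm z \<ge> d} z)"
        proof (cases "norm z < d")
          case True
          have "\<bar>h z\<bar> * r k z \<le> e' * r k z" using d(3)[OF True] r0 by (intro mult_right_mono) auto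
          then show ?thesis unfolding habs using True d(2) e' r0[of k z] by (simp add: ennreal_leI flip: ennreal_mult)
        next
          case dz: False
          show ?thesis
          proof (cases "norm z \<le> R")
            case True
            have "norm z powr p \<le> R powr p" "norm z powr p > 0" using True dz d p by (auto intro!: powr_mono2)
            then have "r k z \<le> R powr p * (r k z / norm z powr p)"
            proof -
              assume a: "norm z powr p \<le> R powr p" "norm z powr p > 0"
              then have "norm z powr p * r k z \<le> R powr p * r k z" using r0[of k z] by (intro mult_right_mono) auto
              then show ?thesis using a by (simp add: le_divide_eq mult.commute)
            qed
            then have "\<bar>h z\<bar> * r k z \<le> 2 * B * (R powr p * (r k z / norm z powr p))"
              using hB[of z] r0[of k z] B by (intro mult_mono) auto
            also have "\<dots> = c * (r k z / norm z powr p)" by (simp add: c_def)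
            finally have "ennreal (\<bar>h z\<bar> * r k z) \<le> ennreal c * ennreal (r k z / norm z powr p)"
              using r0[of k z] c by (simp add: ennreal_leI flip: ennreal_mult)
            then show ?thesis unfolding habs using dz by (simp add: add_increasing)
          qed (simp add: hz)
        qed
      qed
      also have "\<dots> = ennreal e' * kernel_mass (r k) + ennreal c * kernel_tail (r k) p d"
        unfolding kernel_mass_def kernel_tail_def by (simp add: nn_integral_add nn_integral_cmult)
      also have "\<dots> \<le> ennreal e' * ennreal A + ennreal c * ennreal (e / 4 / c)"
        unfolding mass using A elim by (intro add_mono mult_left_mono ennreal_leI) auto
      also have "\<dots> = ennreal (e' * A + c * (e / 4 / c))"
        using e' A c e by (simp flip: ennreal_mult ennreal_plus)
      also have "e' * A + c * (e / 4 / c) = e / 2" using A c by (simp add: e'_def field_simps)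
      finally have "\<bar>\<integral>z. h z * r k z \<partial>lborel\<bar> \<le> e / 2" using e by (subst (asm) ennreal_le_iff) auto
      then show ?case using e by simp
    qed
  qed
  moreover have "(\<lambda>k. g 0 * a k) \<longlonglongrightarrow> g 0 * \<alpha>" by (intro tendsto_mult tendsto_const mass)
  ultimately show ?thesis unfolding split using tendsto_add[of "\<lambda>k. \<integral>z. h z * r k z \<partial>lborel" 0] by (fastforce simp: mult.commute)
qed

section \<open>Assembly of the equivalence\<close>

lemma Xp_borel_version:
  fixes u :: "'a::euclidean_space \<Rightarrow> real"
  assumes "Lp_fun p u"
  shows "\<exists>u'. u' \<in> borel_measurable borel \<and> (AE x in lborel. u x = u' x) \<and> u \<in> borel_measurable lebesgue
     \<and> (\<forall>q. Xp q u \<longleftrightarrow> Xp q u') \<and> (\<forall>q \<mu>. D_mu \<mu> q u = D_mu \<mu> q u')"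
proof -
  have m: "u \<in> borel_measurable lebesgue" using assms by (simp add: Lp_fun_def)
  obtain u' where u': "u' \<in> borel_measurable borel" "AE x in lborel. u x = u' x" using borel_version_real[OF m] by blast
  have m': "u' \<in> borel_measurable lebesgue" using u'(1) by (simp add: measurable_completion)
  show ?thesis
    using u' m AE_invariance[OF m m' u'(2)] by (intro exI[of _ u']) (auto simp: D_mu_def)
qed

lemma Xp_imp_Lp_fun: "p \<ge> 1 \<Longrightarrow> Xp p u \<Longrightarrow> Lp_fun p u"
  by (cases "p = 1") (auto simp: Xp_def W1p_def BV_def split: if_splits)

theorem theorem1p1:
  fixes \<rho> :: "real \<Rightarrow> 'a::euclidean_space \<Rightarrow> real" and p :: real
  assumes "p \<ge> 1"
    and "\<And>t z. t \<in> {0<..<1} \<Longrightarrow> \<rho> t z \<ge> 0"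
    and "\<And>t. t \<in> {0<..<1} \<Longrightarrow> loc_integrable (\<rho> t)"
  shows "(\<exists>t. infinitesimal_in_I t \<and>
            (SUP R\<in>{0<..}. limsup (\<lambda>k. \<integral>\<^sup>+ z. ennreal (R powr p * \<rho> (t k) z / (R powr p + norm z powr p)) \<partial>lebesgue)) < \<infinity> \<and>
            (\<exists>\<alpha>\<ge>0. weak_star_to_delta (\<lambda>k. \<rho> (t k)) \<alpha>))
     \<longleftrightarrow>
         (\<exists>t \<mu>. infinitesimal_in_I t \<and> sphere_measure \<mu> \<and>
            (\<forall>u. Xp p u \<longrightarrow> limsup (\<lambda>k. F_tp \<rho> (t k) p u) \<le> D_mu \<mu> p u) \<and>
            (\<forall>uk u. (\<forall>k. Lp_fun p (uk k)) \<and> Xp p u \<and>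
                 (\<lambda>k. \<integral>\<^sup>+ x. ennreal (\<bar>uk k x - u x\<bar> powr p) \<partial>lebesgue) \<longlonglongrightarrow> 0
               \<longrightarrow> D_mu \<mu> p u \<le> liminf (\<lambda>k. F_tp \<rho> (t k) p (uk k))))"
    (is "?A \<longleftrightarrow> ?B")
proof -
  note p = assms(1)
  \<comment> \<open>Borel representatives of the kernels, nonnegative everywhere, are chosen for all
    t in I at once, so that \<open>r (t k)\<close> makes sense along any sequence.\<close>
  have "\<forall>t. \<exists>r. t \<in> {0<..<1} \<longrightarrow> r \<in> borel_measurable borel \<and> (\<forall>z. r z \<ge> 0) \<and> (AE z in lborel. \<rho> t z = r z) \<and> loc_int r
     \<and> \<rho> t \<in> borel_measurable lebesgue"
    using borel_version_kernel assms(2,3) by metis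
  from choice[OF this] obtain r where r': "\<And>t. t \<in> {0<..<1} \<Longrightarrow> r t \<in> borel_measurable borel \<and> (\<forall>z. r t z \<ge> 0)
     \<and> (AE z in lborel. \<rho> t z = r t z) \<and> loc_int (r t) \<and> \<rho> t \<in> borel_measurable lebesgue" by blast
  have r: "\<And>t. t \<in> {0<..<1} \<Longrightarrow> r t \<in> borel_measurable borel" "\<And>t z. t \<in> {0<..<1} \<Longrightarrow> r t z \<ge> 0"
     "\<And>t. t \<in> {0<..<1} \<Longrightarrow> AE z in lborel. \<rho> t z = r t z" "\<And>t. t \<in> {0<..<1} \<Longrightarrow> loc_int (r t)"
     "\<And>t. t \<in> {0<..<1} \<Longrightarrow> \<rho> t \<in> borel_measurable lebesgue"
    using r' by blast+
  have I: "t k \<in> {0<..<1}" if "infinitesimal_in_I t" for t k using that by (simp add: infinitesimal_in_I_def)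
  have \<Phi>: "(\<integral>\<^sup>+ z. ennreal (R powr p * \<rho> t z / (R powr p + norm z powr p)) \<partial>lebesgue)
      = (\<integral>\<^sup>+ z. ennreal (R powr p * r t z / (R powr p + norm z powr p)) \<partial>lborel)" if t: "t \<in> {0<..<1}" for t R
    unfolding nn_integral_completion
    by (rule nn_integral_cong_AE) (use r(3)[OF t] in eventually_elim, simp)
  have ws: "(\<integral>z. g z * \<rho> t z \<partial>lebesgue) = (\<integral>z. g z * r t z \<partial>lborel)"
    if t: "t \<in> {0<..<1}" and g: "continuous_on UNIV g" for t and g :: "'a \<Rightarrow> real"
  proof -
    have g': "g \<in> borel_measurable borel" using g by (rule borel_measurable_continuous_onI)
    have rl: "r t \<in> borel_measurable lebesgue" using r(1)[OF t] by (simp add: measurable_completion)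
    have "(\<integral>z. g z * \<rho> t z \<partial>lebesgue) = (\<integral>z. \<rho> t z * g z \<partial>lebesgue)" by (simp add: mult.commute)
    also have "\<dots> = (\<integral>z. r t z * g z \<partial>lebesgue)"
      by (rule integral_cong_lebesgue[OF r(5)[OF t] rl g' r(3)[OF t]])
    also have "\<dots> = (\<integral>z. r t z * g z \<partial>lborel)"
      using r(1)[OF t] g' by (intro integral_lebesgue_eq) auto
    finally show ?thesis by (simp add: mult.commute)
  qed
  have F: "F_tp \<rho> t p u = kernel_energy (r t) p u'"
    if "t \<in> {0<..<1}" "u' \<in> borel_measurable borel" "AE x in lborel. u x = u' x" for t u u'
    using that r by (intro F_tp_eq_kernel_energy) auto
  show ?thesis
  proof
    assume ?A
    then obtain t \<alpha> where t: "infinitesimal_in_I t" and \<alpha>: "\<alpha> \<ge> 0" "weak_star_to_delta (\<lambda>k. \<rho> (t k)) \<alpha>"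
      and S0: "(SUP R\<in>{0<..}. limsup (\<lambda>k. \<integral>\<^sup>+ z. ennreal (R powr p * \<rho> (t k) z / (R powr p + norm z powr p)) \<partial>lebesgue)) < \<infinity>"
      by blast
    note I = I[OF t]
    obtain S where S: "(SUP R\<in>{0<..}. limsup (\<lambda>k. \<integral>\<^sup>+ z. ennreal (R powr p * \<rho> (t k) z / (R powr p + norm z powr p)) \<partial>lebesgue)) = ennreal S" "S \<ge> 0"
      using S0 by (cases "SUP R\<in>{0<..}. limsup (\<lambda>k. \<integral>\<^sup>+ z. ennreal (R powr p * \<rho> (t k) z / (R powr p + norm z powr p)) \<partial>lebesgue)") auto
    have SR: "limsup (\<lambda>k. \<integral>\<^sup>+z. ennreal (R powr p * r (t k) z / (R powr p + norm z powr p)) \<partial>lborel) \<le> ennreal S" if "R > 0" for R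
      unfolding S(1)[symmetric] \<Phi>[OF I, symmetric] by (rule SUP_upper) (use that in simp)
    have wsr: "(\<lambda>k. \<integral>z. g z * r (t k) z \<partial>lborel) \<longlonglongrightarrow> \<alpha> * g 0"
      if "continuous_on UNIV g" "compact (closure {x. g x \<noteq> 0})" for g :: "'a \<Rightarrow> real"
      using \<alpha>(2) that unfolding weak_star_to_delta_def by (simp add: ws[OF I])
    have tail: "(\<lambda>k. kernel_tail (r (t k)) p s) \<longlonglongrightarrow> 0" if "s > 0" for s
      by (rule kernel_tail_tendsto[OF r(4)[OF I] r(2)[OF I] p SR S(2) wsr that])
    define a where "a k = (\<integral>z. r (t k) z * indicator (ball 0 1) z \<partial>lborel)" for k
    have a: "kernel_mass (r (t k)) = ennreal (a k)" "a k \<ge> 0" for k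
      using kernel_mass_eq[OF r(4)[OF I] r(2)[OF I], of k] r(2)[OF I, of k]
      by (auto simp: a_def intro!: Bochner_Integration.integral_nonneg)
    have "(\<lambda>k. kernel_mass (r (t k))) \<longlonglongrightarrow> ennreal \<alpha>"
      by (rule kernel_mass_tendsto[OF r(4)[OF I] r(2)[OF I] p \<alpha>(1) wsr tail])
    then have al: "a \<longlonglongrightarrow> \<alpha>" unfolding a(1) using a(2) \<alpha>(1) by (subst (asm) tendsto_ennreal_iff) auto
    obtain s \<mu> where s: "strict_mono s" and \<mu>: "sphere_measure \<mu>"
      and up: "\<And>u. u \<in> borel_measurable borel \<Longrightarrow> Xp p u \<Longrightarrow> limsup (\<lambda>k. kernel_energy (r (t (s k))) p u) \<le> D_mu \<mu> p u"
      and low: "\<And>v u. (\<And>k. v k \<in> borel_measurable borel) \<Longrightarrow> u \<in> borel_measurable borel \<Longrightarrow> Xp p u \<Longrightarrow>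
       (\<lambda>k. Lpow p (\<lambda>x. v k x - u x)) \<longlonglongrightarrow> 0 \<Longrightarrow> D_mu \<mu> p u \<le> liminf (\<lambda>k. kernel_energy (r (t (s k))) p (v k))"
      using kernel_limit[OF r(1)[OF I] r(2)[OF I] p tail a al] by auto
    have ts: "infinitesimal_in_I (\<lambda>k. t (s k))"
      using t LIMSEQ_subseq_LIMSEQ[OF _ s, of t 0] by (auto simp: infinitesimal_in_I_def o_def)
    have "limsup (\<lambda>k. F_tp \<rho> (t (s k)) p u) \<le> D_mu \<mu> p u" if u: "Xp p u" for u
    proof -
      obtain u' where u': "u' \<in> borel_measurable borel" "AE x in lborel. u x = u' x" "Xp p u \<longleftrightarrow> Xp p u'" "D_mu \<mu> p u = D_mu \<mu> p u'"
        using Xp_borel_version[OF Xp_imp_Lp_fun[OF p u]] by blast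
      show ?thesis unfolding F[OF I u'(1,2)] u'(4) using up u' u by blast
    qed
    moreover have "D_mu \<mu> p u \<le> liminf (\<lambda>k. F_tp \<rho> (t (s k)) p (uk k))"
      if uk: "\<And>k. Lp_fun p (uk k)" and u: "Xp p u" and lim: "(\<lambda>k. \<integral>\<^sup>+ x. ennreal (\<bar>uk k x - u x\<bar> powr p) \<partial>lebesgue) \<longlonglongrightarrow> 0" for uk u
    proof -
      obtain u' where u': "u' \<in> borel_measurable borel" "AE x in lborel. u x = u' x" "Xp p u \<longleftrightarrow> Xp p u'" "D_mu \<mu> p u = D_mu \<mu> p u'"
        using Xp_borel_version[OF Xp_imp_Lp_fun[OF p u]] by blast
      have "\<forall>k. \<exists>v. v \<in> borel_measurable borel \<and> (AE x in lborel. uk k x = v x)"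
        using Xp_borel_version[OF uk] by blast
      then obtain v where v: "\<And>k. v k \<in> borel_measurable borel" "\<And>k. AE x in lborel. uk k x = v k x" by metis
      have "(\<integral>\<^sup>+ x. ennreal (\<bar>uk k x - u x\<bar> powr p) \<partial>lebesgue) = Lpow p (\<lambda>x. v k x - u' x)" for k
        unfolding Lpow_def nn_integral_completion
        by (rule nn_integral_cong_AE) (use v(2)[of k] u'(2) in eventually_elim, simp)
      then have "(\<lambda>k. Lpow p (\<lambda>x. v k x - u' x)) \<longlonglongrightarrow> 0" using lim by simp
      then show ?thesis unfolding F[OF I v] u'(4) using low v(1) u' u by blast
    qed
    ultimately show ?B using ts \<mu> by blast
  next
    assume ?B
    then obtain t \<mu> where t: "infinitesimal_in_I t" and \<mu>: "sphere_measure \<mu>"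
      and up: "\<And>u. Xp p u \<Longrightarrow> limsup (\<lambda>k. F_tp \<rho> (t k) p u) \<le> D_mu \<mu> p u"
      and low: "\<And>uk u. (\<forall>k. Lp_fun p (uk k)) \<and> Xp p u \<and>
                 (\<lambda>k. \<integral>\<^sup>+ x. ennreal (\<bar>uk k x - u x\<bar> powr p) \<partial>lebesgue) \<longlonglongrightarrow> 0
               \<Longrightarrow> D_mu \<mu> p u \<le> liminf (\<lambda>k. F_tp \<rho> (t k) p (uk k))" by blast
    note I = I[OF t]
    \<comment> \<open>Condition (i), together with (ii) for the constant sequence, gives genuine
      convergence of the energies of test functions, which is the input of
      \<open>kernel_rigidity\<close>.\<close>
    have lim: "(\<lambda>k. kernel_energy (r (t k)) p u) \<longlonglongrightarrow> D_mu \<mu> p u" if u: "test_fun u" for u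
    proof -
      have X: "Xp p u" by (rule test_fun_Xp[OF u p])
      have eq: "F_tp \<rho> (t k) p u = kernel_energy (r (t k)) p u" for k
        by (rule F[OF I test_fun_borel[OF u]]) simp
      have 1: "limsup (\<lambda>k. kernel_energy (r (t k)) p u) \<le> D_mu \<mu> p u" using up[OF X] by (simp add: eq)
      have 2: "D_mu \<mu> p u \<le> liminf (\<lambda>k. kernel_energy (r (t k)) p u)"
        using low[of "\<lambda>_. u" u] X Xp_imp_Lp_fun[OF p X] p by (simp add: eq)
      have 3: "liminf (\<lambda>k. kernel_energy (r (t k)) p u) \<le> limsup (\<lambda>k. kernel_energy (r (t k)) p u)"
        by (rule Liminf_le_Limsup) simp
      show ?thesis by (subst tendsto_iff_Liminf_eq_Limsup) (use 1 2 3 in auto)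
    qed
    have rig: "(\<lambda>k. kernel_tail (r (t k)) p x) \<longlonglongrightarrow> 0" if "x > 0" for x
      by (rule kernel_rigidity(1)[OF r(1)[OF I] r(2)[OF I] p \<mu>]) (rule lim that, assumption?)+
    define a where "a k = (\<integral>z. r (t k) z * indicator (ball 0 1) z \<partial>lborel)" for k
    have a: "kernel_mass (r (t k)) = ennreal (a k)" "a k \<ge> 0" for k
      using kernel_mass_eq[OF r(4)[OF I] r(2)[OF I], of k] r(2)[OF I, of k]
      by (auto simp: a_def intro!: Bochner_Integration.integral_nonneg)
    obtain A where "\<forall>\<^sub>F k in sequentially. kernel_mass (r (t k)) \<le> ennreal A"
      using kernel_rigidity(2)[OF r(1)[OF I] r(2)[OF I] p \<mu> lim] by blast
    then obtain N where N: "\<And>k. k \<ge> N \<Longrightarrow> ennreal (a k) \<le> ennreal A" unfolding a eventually_sequentially by blast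
    \<comment> \<open>The bound on the masses holds from N on, hence the shifted sequence;
      \<open>max 0 A\<close> keeps the interval nonempty. The masses need not converge, and
      compactness of the interval selects the subsequence that defines \<alpha>.\<close>
    have mem: "\<forall>n. a (n + N) \<in> {0..max 0 A}"
    proof
      fix n show "a (n + N) \<in> {0..max 0 A}"
      using N[of "n + N"] a(2)[of "n + N"] by (cases "A \<ge> 0") (auto simp: ennreal_neg)
    qed
    have "seq_compact {0..max 0 A}" by (rule compact_imp_seq_compact[OF compact_Icc])
    from seq_compactE[OF this mem] obtain \<alpha> s0 where s0: "\<alpha> \<in> {0..max 0 A}" "strict_mono s0" "((\<lambda>n. a (n + N)) \<circ> s0) \<longlonglongrightarrow> \<alpha>" .
    define s where "s n = s0 n + N" for n
    have s: "strict_mono s" using s0(2) by (auto simp: s_def strict_mono_def)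
    have al: "(\<lambda>n. a (s n)) \<longlonglongrightarrow> \<alpha>" using s0(3) by (simp add: s_def o_def)
    have \<alpha>: "\<alpha> \<ge> 0" using s0(1) by simp
    have tail: "(\<lambda>k. kernel_tail (r (t (s k))) p x) \<longlonglongrightarrow> 0" if "x > 0" for x
      using LIMSEQ_subseq_LIMSEQ[OF rig[OF that] s] by (simp add: o_def)
    have mass: "(\<lambda>k. kernel_mass (r (t (s k)))) \<longlonglongrightarrow> ennreal \<alpha>"
      unfolding a(1) by (rule tendsto_ennrealI[OF al])
    have ts: "infinitesimal_in_I (\<lambda>k. t (s k))"
      using t LIMSEQ_subseq_LIMSEQ[OF _ s, of t 0] by (auto simp: infinitesimal_in_I_def o_def)
    have "(SUP R\<in>{0<..}. limsup (\<lambda>k. \<integral>\<^sup>+ z. ennreal (R powr p * \<rho> (t (s k)) z / (R powr p + norm z powr p)) \<partial>lebesgue)) \<le> ennreal \<alpha>"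
      unfolding \<Phi>[OF I]
      by (rule SUP_least) (rule kernel_limsup_le[OF r(1)[OF I] r(2)[OF I] p _ mass tail], auto)
    also have "\<dots> < \<infinity>" by simp
    finally have "(SUP R\<in>{0<..}. limsup (\<lambda>k. \<integral>\<^sup>+ z. ennreal (R powr p * \<rho> (t (s k)) z / (R powr p + norm z powr p)) \<partial>lebesgue)) < \<infinity>" .
    moreover have "weak_star_to_delta (\<lambda>k. \<rho> (t (s k))) \<alpha>"
      unfolding weak_star_to_delta_def
    proof (intro allI impI)
      fix g :: "'a \<Rightarrow> real" assume g: "continuous_on UNIV g \<and> compact (closure {x. g x \<noteq> 0})"
      show "(\<lambda>k. \<integral>z. g z * \<rho> (t (s k)) z \<partial>lebesgue) \<longlonglongrightarrow> \<alpha> * g 0"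
        unfolding ws[OF I conjunct1[OF g]]
        by (rule kernel_weak_star[OF r(4)[OF I] r(2)[OF I] p a al tail conjunct1[OF g] conjunct2[OF g]])
    qed
    ultimately show ?A using ts \<alpha> by blast
  qed
qed

end
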